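(* Let $S$ be an $N$-tuple of $1$-currents in $\mathbb{R}^n$ with locally finite joint mass and $\operatorname{supp}\partial S\cap\Omega=\emptyset$. If $K\subset\Omega$ is compact and $S(\omega)=T(\omega)$ for all $\omega=(\omega_1,\dots,\omega_N)$ with $\omega_k$ smooth $1$-forms compactly supported in $\Omega$ and $\omega=0$ in $K$, then $\|T\|(K)\le\|S\|(K)$.
   Context: Let $n,N\in\mathbb{N}$, $\Omega\subseteq\mathbb{R}^n$ a bounded domain with smooth boundary, $u_0\colon\mathbb{R}^n\to\mathbb{R}^N$ Lipschitz, $e_\infty=\inf\{\operatorname{ess\,sup}_\Omega|Du|:u\in u_0+W^{1,\infty}_0(\Omega;\mathbb{R}^N)\}$, assumed $>0$ (Frobenius norm $|\cdot|$, inner product $A:B$). For $2\le p<\infty$, $u_p$ is the unique minimiser of $E_p(u)=(\frac{1}{\mathcal{L}^n(\Omega)}\int_\Omega|Du|^p)^{1/p}$ in $u_0+W^{1,p}_0(\Omega;\mathbb{R}^N)$, $e_p=E_p(u_p)$, $\mu_p=\frac{|Du_p|^{p-2}}{e_p^{p-2}\mathcal{L}^n(\Omega)}\mathcal{L}^n\llcorner\Omega$, $M_p=(\mu_p,Du_p)$. Measure-function pair over $\overline\Omega$: $(\mu,F)$ with $\mu$ finite Radon on $\overline\Omega$, $F\in L^2(\mu;\mathbb{R}^{N\times n})$; weak convergence $(\mu_\ell,F_\ell)\rightharpoonup(\mu,F)$ means $\int(\eta+F_\ell:\phi)d\mu_\ell\to\int(\eta+F:\phi)d\mu$ for all $\eta\in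 C^0(\overline\Omega)$, $\phi\in C^0(\overline\Omega;\mathbb{R}^{N\times n})$, and $\limsup_\ell\int(1+|F_\ell|^2)d\mu_\ell<\infty$. Fix $p_\ell\to\infty$ with $u_{p_\ell}\rightharpoonup u_\infty$ weakly in $W^{1,q}$ for all $q<\infty$ and $M_{p_\ell}\rightharpoonup(\mu_\infty,F_\infty)$ weakly. Let $T=[\mu_\infty,F_\infty]$, i.e. $T_k(\omega)=\int_{\overline\Omega}\omega(F_{k\infty})\,d\mu_\infty$ where $F_{k\infty}$ is the $k$-th row of $F_\infty$. Currents: a $1$-current is a continuous linear functional on smooth compactly supported $1$-forms on $\mathbb{R}^n$; $\partial T_k(\sigma)=T_k(d\sigma)$; $T(\omega)=\sum_kT_k(\omega_k)$. An $N$-tuple of $1$-currents with locally finite joint mass (i.e. $\sup\{\sum_kT_k(\omega_k):\operatorname{supp}\omega_k\subseteq K,\ \sup\sum_k|\omega_k|^2\le1\}<\infty$ for every compact $K$) is uniquely $T_k(\omega)=\int\omega(\vec T_k)\,d\|T\|$ with $\|T\|$ Radon and $\sum_k|\vec T_k|^2=1$ $\|T\|$-a.e. *)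

theory Defs
  imports "HOL-Analysis.Analysis" "HOL-Probability.Essential_Supremum"
begin

section \<open>Calculus on R^n (R^n is real^'n, R^(N x n) is real^'n^'m)\<close>

definition pd :: "'n::finite \<Rightarrow> (real^'n \<Rightarrow> real) \<Rightarrow> real^'n \<Rightarrow> real" where
  "pd j g x = frechet_derivative g (at x) (axis j 1)"

fun dpart :: "'n::finite list \<Rightarrow> (real^'n \<Rightarrow> real) \<Rightarrow> real^'n \<Rightarrow> real" where
  "dpart [] g = g"
| "dpart (j # js) g = pd j (dpart js g)"

definition smooth :: "(real^'n::finite \<Rightarrow> real) \<Rightarrow> bool" where
  "smooth g \<longleftrightarrow> (\<forall>js x. dpart js g differentiable (at x))"

definition grad :: "(real^'n::finite \<Rightarrow> real) \<Rightarrow> real^'n \<Rightarrow> real^'n" where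
  "grad g x = (\<chi> j. pd j g x)"

definition jac :: "(real^'n::finite \<Rightarrow> real^'m::finite) \<Rightarrow> real^'n \<Rightarrow> real^'n^'m" where
  "jac f x = (\<chi> k. \<chi> j. pd j (\<lambda>y. f y $ k) x)"

definition supp :: "('a::topological_space \<Rightarrow> 'b::zero) \<Rightarrow> 'a set" where
  "supp f = closure {x. f x \<noteq> 0}"

text \<open>Power with the convention t^0 = 1 also at t = 0 (Isabelle's powr has 0 powr 0 = 0).\<close>
definition pw :: "real \<Rightarrow> real \<Rightarrow> real" where
  "pw t a = (if t = 0 then (if a = 0 then 1 else 0) else t powr a)"

definition smooth_bounded_domain :: "(real^'n::finite) set \<Rightarrow> bool" where
  "smooth_bounded_domain \<Omega> \<longleftrightarrow> open \<Omega> \<and> connected \<Omega> \<and> \<Omega> \<noteq> {} \<and> bounded \<Omega> \<and>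
     (\<forall>x0\<in>frontier \<Omega>. \<exists>U \<rho>. open U \<and> x0 \<in> U \<and> smooth \<rho> \<and>
        \<Omega> \<inter> U = {y\<in>U. \<rho> y < 0} \<and> (\<forall>y\<in>U \<inter> frontier \<Omega>. grad \<rho> y \<noteq> 0))"

definition test_fn :: "(real^'n::finite) set \<Rightarrow> (real^'n \<Rightarrow> real) \<Rightarrow> bool" where
  "test_fn U \<phi> \<longleftrightarrow> smooth \<phi> \<and> compact (supp \<phi>) \<and> supp \<phi> \<subseteq> U"

definition test_vec :: "(real^'n::finite) set \<Rightarrow> (real^'n \<Rightarrow> real^'m::finite) \<Rightarrow> bool" where
  "test_vec U \<phi> \<longleftrightarrow> (\<forall>k. smooth (\<lambda>x. \<phi> x $ k)) \<and> compact (supp \<phi>) \<and> supp \<phi> \<subseteq> U"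

definition weak_grad :: "(real^'n::finite) set \<Rightarrow> (real^'n \<Rightarrow> real^'m::finite)
    \<Rightarrow> (real^'n \<Rightarrow> real^'n^'m) \<Rightarrow> bool" where
  "weak_grad \<Omega> u G \<longleftrightarrow>
     (\<forall>K. compact K \<and> K \<subseteq> \<Omega> \<longrightarrow> integrable (lebesgue_on K) u \<and> integrable (lebesgue_on K) G) \<and>
     (\<forall>\<phi> k j. test_fn \<Omega> \<phi> \<longrightarrow>
        (\<integral>x. u x $ k * pd j \<phi> x \<partial>lebesgue_on \<Omega>) = - (\<integral>x. G x $ k $ j * \<phi> x \<partial>lebesgue_on \<Omega>))"

definition Lp :: "(real^'n::finite) set \<Rightarrow> real \<Rightarrow> (real^'n \<Rightarrow> 'b::euclidean_space) \<Rightarrow> bool" where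
  "Lp \<Omega> p f \<longleftrightarrow> f \<in> borel_measurable (lebesgue_on \<Omega>) \<and>
      integrable (lebesgue_on \<Omega>) (\<lambda>x. norm (f x) powr p)"

definition Linf :: "(real^'n::finite) set \<Rightarrow> (real^'n \<Rightarrow> 'b::euclidean_space) \<Rightarrow> bool" where
  "Linf \<Omega> f \<longleftrightarrow> f \<in> borel_measurable (lebesgue_on \<Omega>) \<and>
      (\<exists>C. AE x in lebesgue_on \<Omega>. norm (f x) \<le> C)"

definition W1p :: "(real^'n::finite) set \<Rightarrow> real \<Rightarrow> (real^'n \<Rightarrow> real^'m::finite)
    \<Rightarrow> (real^'n \<Rightarrow> real^'n^'m) \<Rightarrow> bool" where
  "W1p \<Omega> p u G \<longleftrightarrow> Lp \<Omega> p u \<and> weak_grad \<Omega> u G \<and> Lp \<Omega> p G"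

definition W0p :: "(real^'n::finite) set \<Rightarrow> real \<Rightarrow> (real^'n \<Rightarrow> real^'m::finite) \<Rightarrow> bool" where
  "W0p \<Omega> p w \<longleftrightarrow> (\<exists>G. W1p \<Omega> p w G \<and>
     (\<exists>\<phi>::nat \<Rightarrow> real^'n \<Rightarrow> real^'m. (\<forall>i. test_vec \<Omega> (\<phi> i)) \<and>
        (\<lambda>i. \<integral>x. norm (\<phi> i x - w x) powr p \<partial>lebesgue_on \<Omega>) \<longlonglongrightarrow> 0 \<and>
        (\<lambda>i. \<integral>x. norm (jac (\<phi> i) x - G x) powr p \<partial>lebesgue_on \<Omega>) \<longlonglongrightarrow> 0))"

definition W0inf :: "(real^'n::finite) set \<Rightarrow> (real^'n \<Rightarrow> real^'m::finite) \<Rightarrow> bool" where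
  "W0inf \<Omega> w \<longleftrightarrow> (\<exists>G. weak_grad \<Omega> w G \<and> Linf \<Omega> w \<and> Linf \<Omega> G) \<and> W0p \<Omega> 1 w"

definition e_inf :: "(real^'n::finite) set \<Rightarrow> (real^'n \<Rightarrow> real^'m::finite) \<Rightarrow> ereal" where
  "e_inf \<Omega> u0 = Inf {esssup (lebesgue_on \<Omega>) (\<lambda>x. ereal (norm (G x))) | v G.
       weak_grad \<Omega> v G \<and> W0inf \<Omega> (\<lambda>x. v x - u0 x)}"

text \<open>The functional E_p, expressed through the weak Jacobian G of u.\<close>
definition Ep :: "(real^'n::finite) set \<Rightarrow> real \<Rightarrow> (real^'n \<Rightarrow> real^'n^'m::finite) \<Rightarrow> real" where
  "Ep \<Omega> p G = ((1 / measure lebesgue \<Omega>) * (\<integral>x. norm (G x) powr p \<partial>lebesgue_on \<Omega>)) powr (1 / p)"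

definition Ep_minimiser :: "(real^'n::finite) set \<Rightarrow> real \<Rightarrow> (real^'n \<Rightarrow> real^'m::finite)
    \<Rightarrow> (real^'n \<Rightarrow> real^'m) \<Rightarrow> (real^'n \<Rightarrow> real^'n^'m) \<Rightarrow> bool" where
  "Ep_minimiser \<Omega> p u0 u G \<longleftrightarrow> weak_grad \<Omega> u G \<and> W0p \<Omega> p (\<lambda>x. u x - u0 x) \<and>
     (\<forall>v H. weak_grad \<Omega> v H \<and> W0p \<Omega> p (\<lambda>x. v x - u0 x) \<longrightarrow> Ep \<Omega> p G \<le> Ep \<Omega> p H)"

definition mu_p :: "(real^'n::finite) set \<Rightarrow> real \<Rightarrow> (real^'n \<Rightarrow> real^'n^'m::finite) \<Rightarrow> (real^'n) measure" where
  "mu_p \<Omega> p G = density lebesgue (\<lambda>x. ennreal (indicator \<Omega> x * pw (norm (G x)) (p - 2)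
        / (pw (Ep \<Omega> p G) (p - 2) * measure lebesgue \<Omega>)))"

definition W1q_weak_conv :: "(real^'n::finite) set \<Rightarrow> real \<Rightarrow> (nat \<Rightarrow> real^'n \<Rightarrow> real^'m::finite)
   \<Rightarrow> (nat \<Rightarrow> real^'n \<Rightarrow> real^'n^'m) \<Rightarrow> (real^'n \<Rightarrow> real^'m) \<Rightarrow> (real^'n \<Rightarrow> real^'n^'m) \<Rightarrow> bool" where
  "W1q_weak_conv \<Omega> q us Gs u G \<longleftrightarrow>
     (\<forall>\<^sub>F l in sequentially. W1p \<Omega> q (us l) (Gs l)) \<and> W1p \<Omega> q u G \<and>
     (\<forall>g::real^'n \<Rightarrow> real^'m. Lp \<Omega> (q / (q - 1)) g \<longrightarrow>
        (\<lambda>l. \<integral>x. inner (us l x) (g x) \<partial>lebesgue_on \<Omega>) \<longlonglongrightarrow> (\<integral>x. inner (u x) (g x) \<partial>lebesgue_on \<Omega>)) \<and>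
     (\<forall>g::real^'n \<Rightarrow> real^'n^'m. Lp \<Omega> (q / (q - 1)) g \<longrightarrow>
        (\<lambda>l. \<integral>x. inner (Gs l x) (g x) \<partial>lebesgue_on \<Omega>) \<longlonglongrightarrow> (\<integral>x. inner (G x) (g x) \<partial>lebesgue_on \<Omega>))"

definition mf_pair :: "(real^'n::finite) set \<Rightarrow> (real^'n) measure \<Rightarrow> (real^'n \<Rightarrow> real^'n^'m::finite) \<Rightarrow> bool" where
  "mf_pair \<Omega> \<mu> F \<longleftrightarrow> sets \<mu> = sets borel \<and> finite_measure \<mu> \<and> emeasure \<mu> (- closure \<Omega>) = 0 \<and>
      F \<in> borel_measurable \<mu> \<and> integrable \<mu> (\<lambda>x. norm (F x)^2)"

text \<open>Weak convergence of measure-function pairs; continuous test functions on closure Omega are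
  represented by continuous functions on R^n (Tietze; only values on closure Omega matter).\<close>
definition mf_weak_conv :: "(nat \<Rightarrow> (real^'n::finite) measure) \<Rightarrow> (nat \<Rightarrow> real^'n \<Rightarrow> real^'n^'m::finite)
    \<Rightarrow> (real^'n) measure \<Rightarrow> (real^'n \<Rightarrow> real^'n^'m) \<Rightarrow> bool" where
  "mf_weak_conv \<mu>s Fs \<mu> F \<longleftrightarrow>
     (\<forall>(\<eta>::real^'n \<Rightarrow> real) (\<phi>::real^'n \<Rightarrow> real^'n^'m). continuous_on UNIV \<eta> \<and> continuous_on UNIV \<phi> \<longrightarrow>
        (\<lambda>l. \<integral>x. \<eta> x + inner (Fs l x) (\<phi> x) \<partial>\<mu>s l) \<longlonglongrightarrow> (\<integral>x. \<eta> x + inner (F x) (\<phi> x) \<partial>\<mu>)) \<and>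
     limsup (\<lambda>l. ereal (\<integral>x. 1 + (norm (Fs l x))^2 \<partial>\<mu>s l)) < \<infinity>"

text \<open>A 1-form on R^n is a map x to a covector, identified with a vector: omega(x)(v) = omega x . v.\<close>
definition test_form :: "(real^'n::finite \<Rightarrow> real^'n) \<Rightarrow> bool" where
  "test_form \<omega> \<longleftrightarrow> (\<forall>j. smooth (\<lambda>x. \<omega> x $ j)) \<and> compact (supp \<omega>)"

definition current1 :: "((real^'n::finite \<Rightarrow> real^'n) \<Rightarrow> real) \<Rightarrow> bool" where
  "current1 C \<longleftrightarrow>
     (\<forall>a b \<omega> \<eta>. test_form \<omega> \<and> test_form \<eta> \<longrightarrow> C (\<lambda>x. a *\<^sub>R \<omega> x + b *\<^sub>R \<eta> x) = a * C \<omega> + b * C \<eta>) \<and>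
     (\<forall>K \<omega> \<omega>s. compact K \<and> test_form \<omega> \<and> supp \<omega> \<subseteq> K \<and> (\<forall>i. test_form (\<omega>s i) \<and> supp (\<omega>s i) \<subseteq> K) \<and>
        (\<forall>js j. uniform_limit UNIV (\<lambda>i. dpart js (\<lambda>x. \<omega>s i x $ j)) (dpart js (\<lambda>x. \<omega> x $ j)) sequentially)
        \<longrightarrow> (\<lambda>i. C (\<omega>s i)) \<longlonglongrightarrow> C \<omega>)"

text \<open>An N-tuple of 1-currents is S :: 'm => current; it acts on tuples of forms
  omega :: R^n => R^(N x n) (row k is omega_k) by S(omega) = sum_k S_k(omega_k).\<close>
definition tuple_apply :: "('m::finite \<Rightarrow> (real^'n::finite \<Rightarrow> real^'n) \<Rightarrow> real) \<Rightarrow> (real^'n \<Rightarrow> real^'n^'m) \<Rightarrow> real" where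
  "tuple_apply S \<omega> = (\<Sum>k\<in>UNIV. S k (\<lambda>x. \<omega> x $ k))"

definition tuple_test_form :: "(real^'n::finite \<Rightarrow> real^'n^'m::finite) \<Rightarrow> bool" where
  "tuple_test_form \<omega> \<longleftrightarrow> (\<forall>k. test_form (\<lambda>x. \<omega> x $ k))"

definition loc_finite_joint_mass :: "('m::finite \<Rightarrow> (real^'n::finite \<Rightarrow> real^'n) \<Rightarrow> real) \<Rightarrow> bool" where
  "loc_finite_joint_mass S \<longleftrightarrow> (\<forall>K. compact K \<longrightarrow> (\<exists>C. \<forall>\<omega>. tuple_test_form \<omega> \<and>
       (\<forall>k. supp (\<lambda>x. \<omega> x $ k) \<subseteq> K) \<and> (\<forall>x. (\<Sum>k\<in>UNIV. (norm (\<omega> x $ k))^2) \<le> 1)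
       \<longrightarrow> tuple_apply S \<omega> \<le> C))"

definition radon :: "(real^'n::finite) measure \<Rightarrow> bool" where
  "radon \<nu> \<longleftrightarrow> sets \<nu> = sets borel \<and> (\<forall>K. compact K \<longrightarrow> emeasure \<nu> K < \<infinity>)"

text \<open>(nu, V) represents S: S_k(omega) = int omega(V_k) d nu, with sum_k |V_k|^2 = 1 nu-a.e.;
  nu is then the (joint) mass measure ||S||.\<close>
definition mass_rep :: "('m::finite \<Rightarrow> (real^'n::finite \<Rightarrow> real^'n) \<Rightarrow> real) \<Rightarrow> (real^'n) measure
    \<Rightarrow> (real^'n \<Rightarrow> real^'n^'m) \<Rightarrow> bool" where
  "mass_rep S \<nu> V \<longleftrightarrow> radon \<nu> \<and> V \<in> borel_measurable borel \<and>
     (AE x in \<nu>. (\<Sum>k\<in>UNIV. (norm (V x $ k))^2) = 1) \<and>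
     (\<forall>k \<omega>. test_form \<omega> \<longrightarrow> integrable \<nu> (\<lambda>x. inner (\<omega> x) (V x $ k)) \<and>
        S k \<omega> = (\<integral>x. inner (\<omega> x) (V x $ k) \<partial>\<nu>))"

definition supp0 :: "((real^'n::finite \<Rightarrow> real) \<Rightarrow> real) \<Rightarrow> (real^'n) set" where
  "supp0 D = {x. \<not> (\<exists>U. open U \<and> x \<in> U \<and> (\<forall>\<sigma>. test_fn U \<sigma> \<longrightarrow> D \<sigma> = 0))}"

definition bd :: "((real^'n::finite \<Rightarrow> real^'n) \<Rightarrow> real) \<Rightarrow> (real^'n \<Rightarrow> real) \<Rightarrow> real" where
  "bd C \<sigma> = C (grad \<sigma>)"

definition supp_bd :: "('m::finite \<Rightarrow> (real^'n::finite \<Rightarrow> real^'n) \<Rightarrow> real) \<Rightarrow> (real^'n) set" where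
  "supp_bd S = (\<Union>k. supp0 (bd (S k)))"

definition mf_current :: "(real^'n::finite) measure \<Rightarrow> (real^'n \<Rightarrow> real^'n^'m::finite)
    \<Rightarrow> 'm \<Rightarrow> (real^'n \<Rightarrow> real^'n) \<Rightarrow> real" where
  "mf_current \<mu> F k \<omega> = (\<integral>x. inner (\<omega> x) (F x $ k) \<partial>\<mu>)"

end

theory Submission
  imports Defs "HOL-Probability.Probability_Measure"
begin

text \<open>
  The mollified limit map is an asymptotic calibration. Pass to a subsequence along which the
  energies $e_p$ converge to some $e$. If $e = 0$ then $T = 0$. Otherwise divide by $e_p$: the weighted
  measures become $|Du_p|^{p-2}\,dx$ up to a constant, with $\int |Du_p|^p = |\Omega|$, and the
  mollified limit $u^\epsilon$ satisfies $|Du^\epsilon| \le 1$, because averages of $|Du_p|$ are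
  at most $1 + O(1/p)$.

  Testing the Euler-Lagrange equation with $\zeta (u_p - u^\epsilon)$ and using
  $t^{p-1} \le t^p + 1/p$ gives $T(\phi) \le T(\zeta Du^\epsilon) + O(\epsilon)$ for all
  $|\phi| \le \zeta$. The error is controlled by the $L^p$ Poincare estimate
  $\|u - u^\epsilon\|_p \le \epsilon \|Du\|_p$, whose constant does not depend on $p$. Taking the
  supremum over $\phi$ shows that $Du^\epsilon$ almost calibrates $T$.

  Since $S$ and $T$ have no boundary in the domain, both vanish on the compactly supported exact
  form $X$ that equals $Du^\epsilon$ near $K$, and they agree on $(1 - \theta) X$ for cutoffs
  $\theta$ that equal 1 on $K$. Letting $\theta$ shrink to the indicator of $K$, the restrictions
  of $S$ and $T$ to $K$ agree on $X$, so
  $\|T\|(K) \approx (T \llcorner K)(X) = (S \llcorner K)(X) \le \|S\|(K)$.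
\<close>

subsection \<open>Smooth functions\<close>

text \<open>The limit measure may be singular, while the limit gradient is defined only up to
  Lebesgue null sets, so the two cannot be paired directly; a mollified gradient is continuous and
  can be. The mass of T is reached only through values on test forms: T(\<phi>) \<le> T(\<zeta> X) +
  \<kappa> for all |\<phi>| \<le> \<zeta> turns into a bound 2 \<kappa> for the integral of \<zeta>
  (1 - X . V) against ||T||, where V is the direction field of T. This integrand is nonnegative, so
  the bound survives restriction to K.

  Two mollification scales occur because a minimiser is only Sobolev: a fine one makes it admissible
  in the Euler-Lagrange equation, a coarse one gives the calibration. Their distance is measured in
  L^p while p tends to infinity, so no constant may depend on p.

  T has no boundary in the domain because this is the Euler-Lagrange equation for finite p, a linear
  condition that passes to the limit. The energies stay bounded because the second moment of Du_p
  under mu_p is e_p^2, and weak convergence of pairs bounds it. Dividing by e_p requires a positive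
  limit; in the other case |T_p(\<phi>)| \<le> C e_p decides.\<close>

lemma has_derivative_grad:
  fixes g :: "real^'n::finite \<Rightarrow> real"
  assumes "g differentiable (at x)"
  shows "(g has_derivative (\<lambda>h. grad g x \<bullet> h)) (at x)"
proof -
  let ?D = "frechet_derivative g (at x)"
  have D: "(g has_derivative ?D) (at x)"
    using assms by (simp add: frechet_derivative_works)
  then have lin: "linear ?D"
    by (rule has_derivative_linear)
  have "?D h = grad g x \<bullet> h" for h
  proof -
    have "?D h = ?D (\<Sum>j\<in>UNIV. h $ j *\<^sub>R axis j 1)"
      by (metis (no_types, lifting) basis_expansion scalar_mult_eq_scaleR sum.cong)
    also have "\<dots> = (\<Sum>j\<in>UNIV. h $ j * ?D (axis j 1))"
      using lin by (simp add: linear_sum linear_cmul)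
    also have "\<dots> = grad g x \<bullet> h"
      by (simp add: grad_def pd_def inner_vec_def mult.commute)
    finally show ?thesis .
  qed
  with D show ?thesis
    by (metis (no_types, lifting) ext)
qed

lemma pd_eqI:
  assumes "(g has_derivative g') (at x)"
  shows "pd j g x = g' (axis j 1)"
  using assms by (simp add: pd_def frechet_derivative_at[symmetric])

lemma dpart_append: "dpart (js @ ks) g = dpart js (dpart ks g)"
  by (induction js) auto

lemma smooth_pd: "smooth g \<Longrightarrow> smooth (pd j g)"
  unfolding smooth_def by (metis dpart.simps dpart_append append_Cons append_Nil)

lemma smooth_differentiable: "smooth g \<Longrightarrow> g differentiable (at x)"
  unfolding smooth_def by (metis dpart.simps(1))

lemma smooth_has_derivative: "smooth g \<Longrightarrow> (g has_derivative (\<lambda>h. grad g x \<bullet> h)) (at x)"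
  by (intro has_derivative_grad smooth_differentiable)

lemma smooth_continuous_on: "smooth g \<Longrightarrow> continuous_on A g"
  by (meson continuous_at_imp_continuous_on differentiable_imp_continuous_within smooth_differentiable)

lemma smooth_borel: "smooth g \<Longrightarrow> g \<in> borel_measurable borel"
  by (intro borel_measurable_continuous_onI smooth_continuous_on)

text \<open>Smoothness speaks about all iterated partial derivatives, so it is proved for a whole
  set at once: a set of differentiable functions that \<open>pd\<close> maps into itself. Generated
  algebras, all convolutions of one function with kernels, and scaled reflections serve as such sets
  below.\<close>

lemma smooth_coinduct:
  assumes "g \<in> A"
    and "\<And>f x. f \<in> A \<Longrightarrow> f differentiable (at x)"
    and "\<And>f j. f \<in> A \<Longrightarrow> pd j f \<in> A"
  shows "smooth g"
proof -
  have "dpart js g \<in> A" for js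
    by (induction js) (auto simp: assms)
  then show ?thesis
    unfolding smooth_def using assms by blast
qed

text \<open>The algebra generated by \<open>B\<close>. By the Leibniz rule it is stable under
  differentiation as soon as the derivatives of the generators lie in the algebra; they need not lie
  in \<open>B\<close>.\<close>

inductive_set falg :: "(real^'n::finite \<Rightarrow> real) set \<Rightarrow> (real^'n \<Rightarrow> real) set" for B where
  falg_const: "(\<lambda>x. c) \<in> falg B"
| falg_base: "f \<in> B \<Longrightarrow> f \<in> falg B"
| falg_add: "f \<in> falg B \<Longrightarrow> g \<in> falg B \<Longrightarrow> (\<lambda>x. f x + g x) \<in> falg B"
| falg_mult: "f \<in> falg B \<Longrightarrow> g \<in> falg B \<Longrightarrow> (\<lambda>x. f x * g x) \<in> falg B"

lemma pd_const: "pd j (\<lambda>x. c) = (\<lambda>x. 0)"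
  by (rule ext, subst pd_eqI[OF has_derivative_const]) simp

lemma pd_add:
  assumes "f differentiable (at x)" "g differentiable (at x)"
  shows "pd j (\<lambda>x. f x + g x) x = pd j f x + pd j g x"
  using pd_eqI[OF has_derivative_add[OF assms[unfolded frechet_derivative_works]]]
  by (simp add: pd_def)

lemma pd_mult:
  assumes "f differentiable (at x)" "g differentiable (at x)"
  shows "pd j (\<lambda>x. f x * g x) x = f x * pd j g x + pd j f x * g x"
  using pd_eqI[OF has_derivative_mult[OF assms[unfolded frechet_derivative_works]]]
  by (simp add: pd_def)

lemma falg_smooth:
  assumes "f \<in> falg B"
    and D: "\<And>f x. f \<in> B \<Longrightarrow> f differentiable (at x)"
    and P: "\<And>f j. f \<in> B \<Longrightarrow> pd j f \<in> falg B"
  shows "smooth f"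
proof (rule smooth_coinduct[OF assms(1)])
  show diff: "g differentiable (at x)" if "g \<in> falg B" for g x
    using that by induction (auto intro: D)
  show "pd j g \<in> falg B" if "g \<in> falg B" for g j
    using that
  proof induction
    case (falg_const c)
    then show ?case by (simp add: pd_const falg.falg_const)
  next
    case (falg_base f)
    then show ?case by (rule P)
  next
    case (falg_add f g)
    then have "pd j (\<lambda>x. f x + g x) = (\<lambda>x. pd j f x + pd j g x)"
      by (intro ext pd_add diff)
    with falg_add show ?case by (auto intro: falg.intros)
  next
    case (falg_mult f g)
    then have "pd j (\<lambda>x. f x * g x) = (\<lambda>x. f x * pd j g x + pd j f x * g x)"
      by (intro ext pd_mult diff)
    with falg_mult show ?case by (auto intro: falg.intros)
  qed
qed

lemma smooth_falg: "f \<in> falg {g. smooth g} \<Longrightarrow> smooth f"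
  by (erule falg_smooth) (auto intro: smooth_differentiable smooth_pd falg_base)

lemma smooth_const [simp]: "smooth (\<lambda>x. c)"
  by (intro smooth_falg falg.intros)

lemma smooth_add: "smooth f \<Longrightarrow> smooth g \<Longrightarrow> smooth (\<lambda>x. f x + g x)"
  by (intro smooth_falg falg_add falg_base) auto

lemma smooth_mult: "smooth f \<Longrightarrow> smooth g \<Longrightarrow> smooth (\<lambda>x. f x * g x)"
  by (intro smooth_falg falg_mult falg_base) auto

lemma smooth_cmult: "smooth f \<Longrightarrow> smooth (\<lambda>x. c * f x)"
  by (intro smooth_mult smooth_const)

lemma smooth_diff: "smooth f \<Longrightarrow> smooth g \<Longrightarrow> smooth (\<lambda>x. f x - g x)"
  using smooth_add[OF _ smooth_cmult[of g "- 1"], of f] by simp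

lemma pd_cmult: "smooth f \<Longrightarrow> pd j (\<lambda>x. c * f x) x = c * pd j f x"
  using pd_mult[of "\<lambda>x. c" x f j] by (simp add: smooth_differentiable pd_const)

lemma pd_smooth_diff:
  assumes "smooth f" "smooth g"
  shows "pd j (\<lambda>x. f x - g x) x = pd j f x - pd j g x"
  using pd_eqI[OF has_derivative_diff[OF assms[THEN smooth_has_derivative]], of j]
    pd_eqI[OF assms(1)[THEN smooth_has_derivative]] pd_eqI[OF assms(2)[THEN smooth_has_derivative]]
  by simp

section \<open>Supports and the local nature of partial derivatives\<close>

lemma not_in_supp: "x \<notin> supp f \<Longrightarrow> f x = 0"
  unfolding supp_def using closure_subset[of "{x. f x \<noteq> 0}"] by auto

lemma supp_subset: "(\<And>x. x \<notin> C \<Longrightarrow> f x = 0) \<Longrightarrow> closed C \<Longrightarrow> supp f \<subseteq> C"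
  unfolding supp_def by (metis (mono_tags, lifting) closure_minimal mem_Collect_eq subsetI)

lemma closed_supp [simp]: "closed (supp f)"
  by (simp add: supp_def)

lemma compact_supp_subset: "compact C \<Longrightarrow> supp f \<subseteq> C \<Longrightarrow> compact (supp f)"
  using compact_Int_closed[of C "supp f"] by (simp add: Int_absorb1)

lemma pd_cong_open:
  assumes "open A" "x \<in> A" "\<And>y. y \<in> A \<Longrightarrow> f y = g y"
  shows "pd j f x = pd j g x"
proof -
  have "(f has_derivative d) (at x) \<longleftrightarrow> (g has_derivative d) (at x)" for d
    using has_derivative_transform_within_open[OF _ assms(1,2)] assms(3) by metis
  then show ?thesis
    by (simp add: pd_def frechet_derivative_def)
qed

lemma pd_eq_0_open:
  assumes "open A" "x \<in> A" "\<And>y. y \<in> A \<Longrightarrow> f y = 0"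
  shows "pd j f x = 0"
  using pd_cong_open[OF assms(1,2), of f "\<lambda>_. 0"] assms(3) by (simp add: pd_const)

lemma pd_not_in_supp: "x \<notin> supp f \<Longrightarrow> pd j f x = 0"
  by (rule pd_eq_0_open[of "- supp f"]) (auto simp: not_in_supp)

subsection \<open>A smooth bump function\<close>

text \<open>The powers of 1/t in front of the classical exp(-1/t) are carried along because
  differentiation produces them; over all \<open>k\<close> the family is stable under
  differentiation up to linear combinations.\<close>

definition expinv :: "nat \<Rightarrow> real \<Rightarrow> real" where
  "expinv k t = (if t > 0 then (1 / t) ^ k * exp (- (1 / t)) else 0)"

lemma expinv_tendsto_0: "(expinv k \<longlongrightarrow> 0) (at 0)"
proof -
  have "((\<lambda>t. (1 / t) ^ k * exp (- (1 / t))) \<longlongrightarrow> 0) (at_right (0::real))"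
  proof -
    have "((\<lambda>s. s ^ k / exp s) \<longlongrightarrow> 0) (at_top :: real filter)"
      by (rule tendsto_power_div_exp_0)
    then have "((\<lambda>t. inverse t ^ k / exp (inverse t)) \<longlongrightarrow> 0) (at_right (0::real))"
      by (rule filterlim_compose[OF _ filterlim_inverse_at_top_right])
    then show ?thesis
      by (simp add: exp_minus inverse_eq_divide)
  qed
  then have "(expinv k \<longlongrightarrow> 0) (at_right 0)"
    by (rule Lim_transform_eventually) (auto simp: expinv_def eventually_at_filter)
  moreover have "(expinv k \<longlongrightarrow> 0) (at_left 0)"
    by (rule Lim_transform_eventually[OF tendsto_const]) (auto simp: expinv_def eventually_at_filter)
  ultimately show ?thesis
    by (simp add: filterlim_at_split)
qed

lemma DERIV_expinv:
  "(expinv k has_field_derivative expinv (k + 2) t - real k * expinv (k + 1) t) (at t)"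
proof -
  consider "t > 0" | "t < 0" | "t = 0" by linarith
  then show ?thesis
  proof cases
    case 1
    have inv: "(inverse has_field_derivative - (inverse t)\<^sup>2) (at t)"
      using DERIV_inverse[of t UNIV] 1 by (simp add: numeral_2_eq_2)
    have pow: "((\<lambda>t. inverse t ^ k) has_field_derivative - real k * inverse t ^ (k + 1)) (at t)"
      by (rule DERIV_cong[OF DERIV_power[OF inv]]) (cases k, auto simp: power2_eq_square algebra_simps)
    have "((\<lambda>t. inverse t ^ k * exp (- inverse t)) has_field_derivative
        expinv (k + 2) t - real k * expinv (k + 1) t) (at t)"
      by (rule DERIV_cong[OF DERIV_mult[OF pow DERIV_fun_exp[OF DERIV_minus[OF inv]]]])
        (use 1 in \<open>simp add: expinv_def inverse_eq_divide[symmetric] algebra_simps power2_eq_square\<close>)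
    then have "((\<lambda>t. (1 / t) ^ k * exp (- (1 / t))) has_field_derivative
        expinv (k + 2) t - real k * expinv (k + 1) t) (at t)"
      by (simp add: inverse_eq_divide)
    then show ?thesis
      by (rule has_field_derivative_transform_within_open[of _ _ _ "{0<..}"])
        (use 1 in \<open>auto simp: expinv_def\<close>)
  next
    case 2
    have "((\<lambda>t. 0) has_field_derivative 0) (at t)" by simp
    then have "(expinv k has_field_derivative 0) (at t)"
      by (rule has_field_derivative_transform_within_open[of _ _ _ "{..<0}"])
        (use 2 in \<open>auto simp: expinv_def\<close>)
    with 2 show ?thesis by (simp add: expinv_def)
  next
    case 3
    \<comment> \<open>At the origin the difference quotient of \<open>expinv k\<close> is
      \<open>expinv (k + 1)\<close>, which tends to 0.\<close>
    have "((\<lambda>h. expinv k h / h) \<longlongrightarrow> 0) (at 0)"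
      by (rule Lim_transform_eventually[OF expinv_tendsto_0[of "k + 1"]])
        (auto simp: expinv_def eventually_at_filter)
    then show ?thesis
      using 3 by (simp add: DERIV_def expinv_def)
  qed
qed

lemma smooth_expinv_ball: "smooth (\<lambda>x::real^'n::finite. expinv k (c - x \<bullet> x))"
proof -
  \<comment> \<open>The inner derivative of c - |x|^2 contributes a coordinate factor, so the
    coordinates join the generators.\<close>
  define B :: "(real^'n \<Rightarrow> real) set"
    where "B = range (\<lambda>k x. expinv k (c - x \<bullet> x)) \<union> range (\<lambda>i x. x $ i)"
  have D1: "((\<lambda>x::real^'n. expinv k (c - x \<bullet> x)) has_derivative
      (\<lambda>h. (expinv (k + 2) (c - x \<bullet> x) - real k * expinv (k + 1) (c - x \<bullet> x)) * (- (2 * (x \<bullet> h))))) (at x)"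
    for k x
    by (rule has_derivative_eq_rhs[OF has_derivative_compose[OF _ DERIV_expinv[unfolded has_field_derivative_def]]])
      (auto intro!: derivative_eq_intros simp: inner_commute)
  have D2: "((\<lambda>x::real^'n. x $ i) has_derivative (\<lambda>h. h $ i)) (at x)" for i x
    by (rule bounded_linear.has_derivative[OF bounded_linear_vec_nth has_derivative_ident])
  have P1: "pd j (\<lambda>x::real^'n. expinv k (c - x \<bullet> x)) =
      (\<lambda>x. (expinv (k + 2) (c - x \<bullet> x) + (- real k) * expinv (k + 1) (c - x \<bullet> x)) * (- 2 * x $ j))" for j k
    by (rule ext, subst pd_eqI[OF D1]) (simp add: inner_axis)
  have P2: "pd j (\<lambda>x::real^'n. x $ i) = (\<lambda>x. axis j 1 $ i)" for i j
    by (rule ext, subst pd_eqI[OF D2]) simp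
  have b: "(\<lambda>x. expinv k (c - x \<bullet> x)) \<in> falg B" "(\<lambda>x. x $ i) \<in> falg B" for k i
    by (auto simp: B_def intro!: falg_base)
  show ?thesis
  proof (rule falg_smooth[OF b(1)])
    show "f differentiable (at x)" if "f \<in> B" for f x
      using that D1 D2 unfolding B_def differentiable_def by blast
    show "pd j f \<in> falg B" if "f \<in> B" for f j
    proof -
      have "(\<lambda>x. (expinv (k + 2) (c - x \<bullet> x) + (- real k) * expinv (k + 1) (c - x \<bullet> x)) * (- 2 * x $ j))
          \<in> falg B" for k
        by (intro falg_mult falg_add falg_const b)
      then have "pd j (\<lambda>x::real^'n. expinv k (c - x \<bullet> x)) \<in> falg B" for k
        unfolding P1 .
      moreover have "pd j (\<lambda>x::real^'n. x $ i) \<in> falg B" for i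
        unfolding P2 by (rule falg_const)
      ultimately show ?thesis
        using that unfolding B_def by blast
    qed
  qed
qed

text \<open>A predicate rather than scalings of one bump: the estimates rest on smoothness, sign,
  support radius and unit mass, and their thresholds hold for every kernel of sufficiently small
  radius.\<close>

definition mollifier :: "real \<Rightarrow> (real^'n::finite \<Rightarrow> real) \<Rightarrow> bool" where
  "mollifier \<epsilon> \<eta> \<longleftrightarrow> smooth \<eta> \<and> (\<forall>x. 0 \<le> \<eta> x) \<and> (\<forall>x. norm x > \<epsilon> \<longrightarrow> \<eta> x = 0) \<and>
     integrable lborel \<eta> \<and> (\<integral>x. \<eta> x \<partial>lborel) = 1"

lemma integrable_continuous_bounded_support:
  fixes f :: "'a::euclidean_space \<Rightarrow> 'b::euclidean_space"
  assumes "continuous_on UNIV f" "\<And>x. norm x > R \<Longrightarrow> f x = 0"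
  shows "integrable lborel f"
proof -
  have "integrable lborel (\<lambda>x. indicator (cball 0 R) x *\<^sub>R f x)"
    by (rule borel_integrable_compact[OF compact_cball continuous_on_subset[OF assms(1)]]) simp
  also have "(\<lambda>x. indicator (cball 0 R) x *\<^sub>R f x) = f"
    using assms(2) by (auto simp: indicator_def fun_eq_iff not_le[symmetric])
  finally show ?thesis .
qed

lemma ex_mollifier:
  assumes "\<epsilon> > 0"
  obtains \<eta> :: "real^'n::finite \<Rightarrow> real" where "mollifier \<epsilon> \<eta>"
proof -
  define b where "b = (\<lambda>x::real^'n. expinv 0 (\<epsilon>\<^sup>2 - x \<bullet> x))"
  have sm: "smooth b" unfolding b_def by (rule smooth_expinv_ball)
  have nn: "0 \<le> b x" for x by (simp add: b_def expinv_def)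
  have ze: "b x = 0" if "norm x > \<epsilon>" for x
    using that assms power_strict_mono[of \<epsilon> "norm x" 2]
    by (simp add: b_def expinv_def power2_norm_eq_inner[symmetric])
  have int: "integrable lborel b"
    using smooth_continuous_on[OF sm] ze by (rule integrable_continuous_bounded_support)
  have pos: "(\<integral>x. b x \<partial>lborel) > 0"
  proof -
    \<comment> \<open>A vanishing integral would make the open set where \<open>b\<close> is nonzero
      a null set, hence empty, but it contains 0.\<close>
    have "(\<integral>x. b x \<partial>lborel) \<noteq> 0"
    proof
      assume "(\<integral>x. b x \<partial>lborel) = 0"
      then have "AE x in lborel. b x = 0"
        using int nn by (subst (asm) integral_nonneg_eq_0_iff_AE) auto
      then have "{x. b x \<noteq> 0} \<in> null_sets lborel"
        using smooth_borel[OF sm] by (auto simp: AE_iff_null)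
      moreover have "open {x. b x \<noteq> 0}"
        using smooth_continuous_on[OF sm, of UNIV] by (intro open_Collect_neq) auto
      ultimately have "{x. b x \<noteq> 0} = {}"
        using open_not_negligible by (auto simp: negligible_iff_null_sets intro: null_sets_completionI)
      moreover have "b 0 \<noteq> 0" using assms by (simp add: b_def expinv_def)
      ultimately show False by auto
    qed
    with nn show ?thesis by (simp add: order_less_le)
  qed
  define \<eta> where "\<eta> = (\<lambda>x. (1 / (\<integral>x. b x \<partial>lborel)) * b x)"
  have "smooth \<eta>"
    unfolding \<eta>_def by (rule smooth_cmult[OF sm])
  then have "mollifier \<epsilon> \<eta>"
    unfolding mollifier_def using nn ze int pos by (auto simp: \<eta>_def)
  then show ?thesis by (rule that)
qed

subsection \<open>Convolution with smooth kernels\<close>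

text \<open>Sign and mass are left free, so that partial derivatives of mollifiers are kernels again
  and differentiation of a convolution can be iterated.\<close>

definition kernel :: "real \<Rightarrow> (real^'n::finite \<Rightarrow> real) \<Rightarrow> bool" where
  "kernel R \<eta> \<longleftrightarrow> smooth \<eta> \<and> (\<forall>x. norm x > R \<longrightarrow> \<eta> x = 0)"

definition conv :: "(real^'n::finite \<Rightarrow> real) \<Rightarrow> (real^'n \<Rightarrow> 'b::euclidean_space) \<Rightarrow> real^'n \<Rightarrow> 'b" where
  "conv \<eta> f x = (\<integral>y. \<eta> (x - y) *\<^sub>R f y \<partial>lborel)"

lemma mollifier_kernel: "mollifier \<epsilon> \<eta> \<Longrightarrow> kernel \<epsilon> \<eta>"
  by (simp add: mollifier_def kernel_def)

lemma kernel_pd: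
  assumes "kernel R \<eta>" shows "kernel R (pd j \<eta>)"
proof -
  have "pd j \<eta> x = 0" if "norm x > R" for x
  proof (rule pd_eq_0_open[of "- cball 0 R"])
    show "open (- cball (0::real^'a) R)" by (intro open_Compl closed_cball)
  qed (use that assms in \<open>auto simp: kernel_def\<close>)
  then show ?thesis
    using assms by (simp add: kernel_def smooth_pd)
qed

lemma bounded_support_bounded:
  fixes f :: "'a::euclidean_space \<Rightarrow> 'b::real_normed_vector"
  assumes "continuous_on UNIV f" "\<And>x. norm x > R \<Longrightarrow> f x = 0"
  obtains C where "C > 0" "\<And>x. norm (f x) \<le> C"
proof -
  have "bounded (f ` cball 0 R)"
    by (intro compact_imp_bounded compact_continuous_image continuous_on_subset[OF assms(1)]) auto
  then obtain C where C: "C > 0" "\<And>x. x \<in> cball 0 R \<Longrightarrow> norm (f x) \<le> C"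
    by (auto simp: bounded_pos)
  have "norm (f x) \<le> C" for x
    using C assms(2)[of x] by (cases "norm x > R") auto
  with C(1) that show ?thesis by blast
qed

lemma bounded_support_uniformly_continuous:
  fixes f :: "'a::euclidean_space \<Rightarrow> 'b::real_normed_vector"
  assumes cont: "continuous_on UNIV f" and out: "\<And>x. norm x > R \<Longrightarrow> f x = 0" and "e > 0"
  obtains d where "d > 0" "\<And>x y. norm (x - y) < d \<Longrightarrow> norm (f x - f y) < e"
proof -
  \<comment> \<open>With the radius enlarged by 1 and a modulus of at most 1, either both points lie
    in the ball or \<open>f\<close> vanishes at both.\<close>
  have "uniformly_continuous_on (cball 0 (R + 1)) f"
    by (intro compact_uniformly_continuous continuous_on_subset[OF cont]) auto
  then obtain d where d: "d > 0" "\<And>x y. x \<in> cball 0 (R + 1) \<Longrightarrow> y \<in> cball 0 (R + 1) \<Longrightarrow>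
      dist x y < d \<Longrightarrow> dist (f x) (f y) < e"
    unfolding uniformly_continuous_on_def using \<open>e > 0\<close> by metis
  have "norm (f x - f y) < e" if "norm (x - y) < min d 1" for x y
  proof (cases "x \<in> cball 0 (R + 1) \<and> y \<in> cball 0 (R + 1)")
    case True
    then show ?thesis using d(2)[of x y] that by (simp add: dist_norm)
  next
    case False
    then have "norm x > R \<and> norm y > R"
      using that norm_triangle_ineq3[of x y] by auto
    then show ?thesis using out \<open>e > 0\<close> by simp
  qed
  with d(1) show ?thesis using that[of "min d 1"] by auto
qed

lemma norm_integral_le:
  fixes f :: "'a \<Rightarrow> 'b::{banach,second_countable_topology}"
  assumes "integrable M f" "integrable M g" "\<And>x. norm (f x) \<le> g x"
  shows "norm (\<integral>x. f x \<partial>M) \<le> (\<integral>x. g x \<partial>M)"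
  by (rule order_trans[OF integral_norm_bound integral_mono]) (use assms in auto)

lemma kernel_cont: "kernel R \<eta> \<Longrightarrow> continuous_on A \<eta>"
  by (simp add: kernel_def smooth_continuous_on)

lemma kernel_borel [measurable_dest]: "kernel R \<eta> \<Longrightarrow> \<eta> \<in> borel_measurable borel"
  by (simp add: kernel_def smooth_borel)

lemma kernel_bounded:
  assumes "kernel R \<eta>"
  obtains C where "C > 0" "\<And>x. \<bar>\<eta> x\<bar> \<le> C"
  using bounded_support_bounded[OF kernel_cont[OF assms], of R] assms by (auto simp: kernel_def)

lemma integrable_bounded_scaleR:
  fixes f :: "'a \<Rightarrow> 'b::{banach,second_countable_topology}"
  assumes "integrable M f" "g \<in> borel_measurable M" "\<And>x. \<bar>g x\<bar> \<le> C"
  shows "integrable M (\<lambda>x. g x *\<^sub>R f x)"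
proof (rule Bochner_Integration.integrable_bound)
  show "integrable M (\<lambda>x. C *\<^sub>R norm (f x))" using assms(1) by auto
  show "(\<lambda>x. g x *\<^sub>R f x) \<in> borel_measurable M"
    using assms(1,2) by (intro borel_measurable_scaleR) auto
  have "0 \<le> C" using assms(3)[of undefined] by linarith
  then show "AE x in M. norm (g x *\<^sub>R f x) \<le> norm (C *\<^sub>R norm (f x))"
    using assms(3) by (auto intro!: mult_right_mono)
qed

lemma integrable_conv:
  fixes f :: "real^'n::finite \<Rightarrow> 'b::euclidean_space"
  assumes "kernel R \<eta>" "integrable lborel f"
  shows "integrable lborel (\<lambda>y. \<eta> (x - y) *\<^sub>R f y)"
proof -
  obtain C where "C > 0" "\<And>x. \<bar>\<eta> x\<bar> \<le> C" using kernel_bounded[OF assms(1)] by blast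
  moreover have "(\<lambda>y. \<eta> (x - y)) \<in> borel_measurable lborel"
    using kernel_borel[OF assms(1)] by measurable
  ultimately show ?thesis
    using integrable_bounded_scaleR[OF assms(2), of "\<lambda>y. \<eta> (x - y)" C] by blast
qed

lemma conv_nth:
  assumes "kernel R \<eta>" "integrable lborel (f :: _ \<Rightarrow> 'b::euclidean_space^'m::finite)"
  shows "conv \<eta> f x $ k = conv \<eta> (\<lambda>y. f y $ k) x"
  unfolding conv_def
  by (subst integral_bounded_linear[OF bounded_linear_vec_nth integrable_conv[OF assms], symmetric]) simp

lemma integrable_nth:
  "integrable M (f :: _ \<Rightarrow> 'b::euclidean_space^'m::finite) \<Longrightarrow> integrable M (\<lambda>y. f y $ k)"
  by (rule integrable_bounded_linear[OF bounded_linear_vec_nth])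

lemma continuous_grad: "smooth g \<Longrightarrow> continuous_on A (grad g)"
  unfolding grad_def by (intro continuous_intros smooth_continuous_on smooth_pd)

lemma kernel_grad:
  assumes "kernel R \<eta>"
  shows "continuous_on UNIV (grad \<eta>)" "\<And>x. norm x > R \<Longrightarrow> grad \<eta> x = 0"
  using assms kernel_pd[OF assms] by (auto simp: kernel_def grad_def vec_eq_iff intro!: continuous_grad[unfolded grad_def])

lemma integrable_conv_grad:
  fixes f :: "real^'n::finite \<Rightarrow> real"
  assumes \<eta>: "kernel R \<eta>" and f: "integrable lborel f"
  shows "integrable lborel (\<lambda>y. f y *\<^sub>R grad \<eta> (x - y))"
proof -
  obtain C where C: "C > 0" "\<And>x. norm (grad \<eta> x) \<le> C"
    using bounded_support_bounded[OF kernel_grad[OF \<eta>]] by blast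
  show ?thesis
  proof (rule Bochner_Integration.integrable_bound)
    show "integrable lborel (\<lambda>y. C * f y)" using f by simp
    show "(\<lambda>y. f y *\<^sub>R grad \<eta> (x - y)) \<in> borel_measurable lborel"
      using f borel_measurable_continuous_onI[OF kernel_grad(1)[OF \<eta>]] by measurable
    show "AE y in lborel. norm (f y *\<^sub>R grad \<eta> (x - y)) \<le> norm (C * f y)"
      using mult_right_mono[OF C(2) abs_ge_zero] C(1) by (simp add: abs_mult mult.commute)
  qed
qed

text \<open>The error of linearising \<open>\<eta>\<close> at \<open>x - z\<close> is small compared
  with |y - x| uniformly in z, because \<open>grad \<eta>\<close> is uniformly continuous.
  Integrating it against |f| differentiates under the integral sign for merely integrable
  \<open>f\<close>.\<close>

lemma has_derivative_conv:
  fixes f :: "real^'n::finite \<Rightarrow> real"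
  assumes \<eta>: "kernel R \<eta>" and f: "integrable lborel f"
  shows "(conv \<eta> f has_derivative (\<lambda>h. (\<integral>y. f y *\<^sub>R grad \<eta> (x - y) \<partial>lborel) \<bullet> h)) (at x)"
proof -
  have sm: "smooth \<eta>" using \<eta> by (simp add: kernel_def)
  note gc = kernel_grad(1)[OF \<eta>] and gz = kernel_grad(2)[OF \<eta>]
  note gi = integrable_conv_grad[OF \<eta> f]
  \<comment> \<open>The L1 norm of \<open>f\<close>; the modulus below uses I + 1 to avoid division
    by 0.\<close>
  define I where "I = (\<integral>y. \<bar>f y\<bar> \<partial>lborel)"
  have I: "I \<ge> 0" by (simp add: I_def)
  show ?thesis
    unfolding has_derivative_at_alt
  proof (intro conjI allI impI)
    show "bounded_linear (\<lambda>h. (\<integral>y. f y *\<^sub>R grad \<eta> (x - y) \<partial>lborel) \<bullet> h)"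
      by (rule bounded_linear_inner_right)
    fix e :: real assume "e > 0"
    then have "e / (I + 1) > 0" using I by simp
    then obtain d where d: "d > 0"
      "\<And>x y. norm (x - y) < d \<Longrightarrow> norm (grad \<eta> x - grad \<eta> y) < e / (I + 1)"
      using bounded_support_uniformly_continuous[OF gc gz] by metis
    have lin: "\<bar>\<eta> b - \<eta> a - grad \<eta> a \<bullet> (b - a)\<bar> \<le> norm (b - a) * (e / (I + 1))"
      if "norm (b - a) < d" for a b
    proof -
      have "norm (\<eta> b - \<eta> a - (\<lambda>h. grad \<eta> a \<bullet> h) (b - a)) \<le> norm (b - a) * (e / (I + 1))"
      proof (rule differentiable_bound_linearization[where S = "ball a d" and f' = "\<lambda>x h. grad \<eta> x \<bullet> h"])
        show "a + t *\<^sub>R (b - a) \<in> ball a d" if "t \<in> {0..1}" for t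
          using that \<open>norm (b - a) < d\<close> mult_right_mono[of t 1 "norm (b - a)"]
          by (auto simp: dist_norm)
        show "(\<eta> has_derivative (\<lambda>h. grad \<eta> x \<bullet> h)) (at x within ball a d)" for x
          by (rule has_derivative_at_withinI[OF smooth_has_derivative[OF sm]])
        show "onorm ((\<lambda>h. grad \<eta> x \<bullet> h) - (\<lambda>h. grad \<eta> a \<bullet> h)) \<le> e / (I + 1)" if "x \<in> ball a d" for x
        proof (rule onorm_le)
          fix h
          have "norm (((\<lambda>h. grad \<eta> x \<bullet> h) - (\<lambda>h. grad \<eta> a \<bullet> h)) h) = \<bar>(grad \<eta> x - grad \<eta> a) \<bullet> h\<bar>"
            by (simp add: inner_diff_left)
          also have "\<dots> \<le> norm (grad \<eta> x - grad \<eta> a) * norm h"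
            by (rule Cauchy_Schwarz_ineq2)
          also have "\<dots> \<le> e / (I + 1) * norm h"
            using d(2)[of x a] that by (intro mult_right_mono) (auto simp: dist_norm norm_minus_commute)
          finally show "norm (((\<lambda>h. grad \<eta> x \<bullet> h) - (\<lambda>h. grad \<eta> a \<bullet> h)) h) \<le> e / (I + 1) * norm h" .
        qed
        show "a \<in> ball a d" using d(1) by simp
      qed
      then show ?thesis by simp
    qed
    have "norm (conv \<eta> f y - conv \<eta> f x - (\<integral>y. f y *\<^sub>R grad \<eta> (x - y) \<partial>lborel) \<bullet> (y - x)) \<le> e * norm (y - x)"
      if "norm (y - x) < d" for y
    proof -
      have i1: "integrable lborel (\<lambda>z. (f z *\<^sub>R grad \<eta> (x - z)) \<bullet> (y - x))"
        by (rule integrable_inner_left) (rule gi)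
      have "conv \<eta> f y - conv \<eta> f x - (\<integral>y. f y *\<^sub>R grad \<eta> (x - y) \<partial>lborel) \<bullet> (y - x) =
          (\<integral>z. \<eta> (y - z) *\<^sub>R f z - \<eta> (x - z) *\<^sub>R f z - (f z *\<^sub>R grad \<eta> (x - z)) \<bullet> (y - x) \<partial>lborel)"
        using integrable_conv[OF \<eta> f] i1
        by (simp only: conv_def integral_inner_left[OF gi[of x], symmetric] Bochner_Integration.integral_diff
            Bochner_Integration.integrable_diff)
      also have "norm \<dots> \<le> (\<integral>z. norm (y - x) * (e / (I + 1)) * \<bar>f z\<bar> \<partial>lborel)"
      proof (rule norm_integral_le)
        show "integrable lborel (\<lambda>z. \<eta> (y - z) *\<^sub>R f z - \<eta> (x - z) *\<^sub>R f z - (f z *\<^sub>R grad \<eta> (x - z)) \<bullet> (y - x))"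
          using integrable_conv[OF \<eta> f] i1 by auto
        show "integrable lborel (\<lambda>z. norm (y - x) * (e / (I + 1)) * \<bar>f z\<bar>)" using f by auto
        fix z
        have "\<eta> (y - z) *\<^sub>R f z - \<eta> (x - z) *\<^sub>R f z - (f z *\<^sub>R grad \<eta> (x - z)) \<bullet> (y - x) =
            (\<eta> (y - z) - \<eta> (x - z) - grad \<eta> (x - z) \<bullet> ((y - z) - (x - z))) * f z"
          by (simp add: algebra_simps)
        then show "norm (\<eta> (y - z) *\<^sub>R f z - \<eta> (x - z) *\<^sub>R f z - (f z *\<^sub>R grad \<eta> (x - z)) \<bullet> (y - x))
            \<le> norm (y - x) * (e / (I + 1)) * \<bar>f z\<bar>"
          using mult_right_mono[OF lin[of "y - z" "x - z"], of "\<bar>f z\<bar>"] that by (simp only: real_norm_def abs_mult) simp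
      qed
      also have "\<dots> = norm (y - x) * (e / (I + 1)) * I"
        using f by (simp add: I_def)
      also have "\<dots> = norm (y - x) * e * (I / (I + 1))" by simp
      also have "\<dots> \<le> norm (y - x) * e * 1"
        using I \<open>e > 0\<close> by (intro mult_left_mono) auto
      finally show ?thesis by (simp add: mult.commute)
    qed
    then show "\<exists>d>0. \<forall>y. norm (y - x) < d \<longrightarrow>
        norm (conv \<eta> f y - conv \<eta> f x - (\<integral>y. f y *\<^sub>R grad \<eta> (x - y) \<partial>lborel) \<bullet> (y - x)) \<le> e * norm (y - x)"
      using d(1) by blast
  qed
qed

lemma pd_conv:
  fixes f :: "real^'n::finite \<Rightarrow> real"
  assumes \<eta>: "kernel R \<eta>" and f: "integrable lborel f"
  shows "pd j (conv \<eta> f) x = conv (pd j \<eta>) f x"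
proof -
  note gi = integrable_conv_grad[OF \<eta> f]
  have "pd j (conv \<eta> f) x = (\<integral>y. f y *\<^sub>R grad \<eta> (x - y) \<partial>lborel) $ j"
    by (subst pd_eqI[OF has_derivative_conv[OF \<eta> f]]) (simp add: inner_axis)
  also have "\<dots> = (\<integral>y. (f y *\<^sub>R grad \<eta> (x - y)) $ j \<partial>lborel)"
    using integral_bounded_linear[OF bounded_linear_vec_nth gi] by simp
  also have "\<dots> = conv (pd j \<eta>) f x"
    by (simp add: conv_def grad_def mult.commute)
  finally show ?thesis .
qed

lemma smooth_conv:
  fixes f :: "real^'n::finite \<Rightarrow> real"
  assumes \<eta>: "kernel R \<eta>" and f: "integrable lborel f"
  shows "smooth (conv \<eta> f)"
proof (rule smooth_coinduct[where A = "{conv \<eta> f |\<eta>. kernel R \<eta>}"])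
  show "conv \<eta> f \<in> {conv \<eta> f |\<eta>. kernel R \<eta>}" using \<eta> by auto
  show "g differentiable (at x)" if "g \<in> {conv \<eta> f |\<eta>. kernel R \<eta>}" for g x
    using that has_derivative_conv[OF _ f] by (auto simp: differentiable_def)
  show "pd j g \<in> {conv \<eta> f |\<eta>. kernel R \<eta>}" if "g \<in> {conv \<eta> f |\<eta>. kernel R \<eta>}" for g j
  proof -
    obtain \<eta>' where "g = conv \<eta>' f" "kernel R \<eta>'" using \<open>g \<in> _\<close> by auto
    then have "pd j g = conv (pd j \<eta>') f" "kernel R (pd j \<eta>')"
      using pd_conv[OF _ f] kernel_pd by blast+
    then show ?thesis by auto
  qed
qed

lemma smooth_conv_nth:
  "kernel R \<eta> \<Longrightarrow> integrable lborel f \<Longrightarrow> smooth (\<lambda>x. conv \<eta> f x $ k)"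
  for f :: "real^'n::finite \<Rightarrow> real^'m::finite"
  using smooth_conv[OF _ integrable_nth, of R \<eta> f k] by (simp add: conv_nth)

lemma continuous_conv_mat:
  fixes G :: "real^'n::finite \<Rightarrow> real^'k::finite^'m::finite"
  assumes "kernel R \<eta>" "integrable lborel G"
  shows "continuous_on A (conv \<eta> G)"
proof -
  have "conv \<eta> G = (\<lambda>x. \<chi> k j. conv \<eta> (\<lambda>y. G y $ k $ j) x)"
    using assms by (simp add: fun_eq_iff vec_eq_iff conv_nth integrable_nth)
  then show ?thesis
    using smooth_continuous_on[OF smooth_conv[OF assms(1) integrable_nth[OF integrable_nth[OF assms(2)]]]]
    by (simp add: continuous_on_vec_lambda)
qed

lemma conv_diff:
  assumes "kernel R \<eta>" "integrable lborel f" "integrable lborel g"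
  shows "conv \<eta> (\<lambda>y. f y - g y) x = conv \<eta> f x - conv \<eta> g x"
  unfolding conv_def using integrable_conv[OF assms(1,2)] integrable_conv[OF assms(1,3)]
  by (simp add: scaleR_diff_right)

subsection \<open>Reflections and translations\<close>

lemma lborel_distr_reflect: "distr lborel borel (\<lambda>y. a - y) = (lborel :: 'a::euclidean_space measure)"
proof -
  have T: "(\<lambda>x. a + (\<Sum>j\<in>Basis. ((-1) * (x \<bullet> j)) *\<^sub>R j)) = (\<lambda>y. a - y)"
    by (simp add: fun_eq_iff sum_negf euclidean_representation)
  have "(lborel :: 'a measure) = density (distr lborel borel (\<lambda>y. a - y)) (\<lambda>_. (\<Prod>j\<in>Basis. \<bar>- 1 :: real\<bar>))"
    using lborel_affine_euclidean[of "\<lambda>_::'a. - 1" a, unfolded T] by simp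
  then show ?thesis by (simp add: density_1)
qed

lemma nn_integral_translate:
  fixes f :: "'a::euclidean_space \<Rightarrow> ennreal"
  assumes "f \<in> borel_measurable borel"
  shows "(\<integral>\<^sup>+x. f (x - t) \<partial>lborel) = (\<integral>\<^sup>+x. f x \<partial>lborel)"
  by (subst lborel_distr_plus[of "- t", symmetric], subst nn_integral_distr) (use assms in auto)

lemma integral_reflect_diff:
  fixes f :: "'a::euclidean_space \<Rightarrow> 'b::{banach,second_countable_topology}"
  assumes "f \<in> borel_measurable borel"
  shows "(\<integral>x. f (t - x) \<partial>lborel) = (\<integral>x. f x \<partial>lborel)"
  by (subst (2) lborel_distr_reflect[of t, symmetric], subst integral_distr) (use assms in auto)

lemma integrable_reflect:
  fixes f :: "'a::euclidean_space \<Rightarrow> 'b::{banach,second_countable_topology}"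
  assumes "f \<in> borel_measurable borel"
  shows "integrable lborel (\<lambda>x. f (t - x)) \<longleftrightarrow> integrable lborel f"
  by (subst (2) lborel_distr_reflect[of t, symmetric], subst integrable_distr_eq) (use assms in auto)

lemma conv_commute:
  assumes \<eta>: "kernel R \<eta>" and f: "integrable lborel f"
  shows "conv \<eta> f x = (\<integral>y. \<eta> y *\<^sub>R f (x - y) \<partial>lborel)"
    and "integrable lborel (\<lambda>y. \<eta> y *\<^sub>R f (x - y))"
proof -
  have [measurable]: "\<eta> \<in> borel_measurable borel" "f \<in> borel_measurable borel"
    using kernel_borel[OF \<eta>] f by auto
  have "(\<lambda>y. \<eta> (x - y) *\<^sub>R f y) \<in> borel_measurable borel" by measurable
  from integral_reflect_diff[OF this, of x] integrable_reflect[OF this, of x] integrable_conv[OF \<eta> f, of x]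
  show "conv \<eta> f x = (\<integral>y. \<eta> y *\<^sub>R f (x - y) \<partial>lborel)"
    "integrable lborel (\<lambda>y. \<eta> y *\<^sub>R f (x - y))"
    by (simp_all add: conv_def)
qed

subsection \<open>Young's inequality and averages of translates\<close>

lemma young:
  assumes "p > 1" "a \<ge> 0" "b \<ge> (0::real)"
  shows "a powr (p - 1) * b \<le> (1 - 1 / p) * a powr p + b powr p / p"
proof -
  have q: "p / (p - 1) > 1" "1 / (p / (p - 1)) + 1 / p = 1" "1 / (p / (p - 1)) = 1 - 1 / p"
    using assms by (auto simp: field_simps)
  have "a powr (p - 1) * b \<le> (a powr (p - 1)) powr (p / (p - 1)) / (p / (p - 1)) + b powr p / p"
    using assms q by (intro Youngs_inequality) auto
  also have "(a powr (p - 1)) powr (p / (p - 1)) = a powr p"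
    using assms by (simp add: powr_powr)
  finally show ?thesis using q(3) by (simp add: mult.commute divide_inverse)
qed

text \<open>Young's inequality multiplied by p is the convexity of t^p in tangent form, obtained
  without differentiating at 0.\<close>

lemma powr_tangent:
  assumes "p \<ge> 1" "a \<ge> 0" "b \<ge> (0::real)"
  shows "a powr p + p * a powr (p - 1) * (b - a) \<le> b powr p"
proof (cases "p = 1")
  case True
  then show ?thesis using assms by (cases "a = 0") auto
next
  case False
  with assms have p: "p > 1" by simp
  have "a powr (p - 1) * a = a powr p"
    using assms p by (cases "a = 0") (auto simp: powr_diff)
  then show ?thesis
    using young[OF p assms(2,3)] p by (simp add: field_simps)
qed

text \<open>Jensen's inequality: integrate the tangent at the mean, whose linear term has
  expectation 0.\<close>

lemma (in prob_space) powr_expectation_le: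
  fixes h :: "'a \<Rightarrow> real"
  assumes "p \<ge> 1" "\<And>x. 0 \<le> h x" "integrable M h" "integrable M (\<lambda>x. h x powr p)"
  shows "expectation h powr p \<le> expectation (\<lambda>x. h x powr p)"
proof -
  let ?m = "expectation h"
  have "?m \<ge> 0" using assms(2) by (rule Bochner_Integration.integral_nonneg)
  have "?m powr p = expectation (\<lambda>x. ?m powr p + p * ?m powr (p - 1) * (h x - ?m))"
    using assms(3) by (simp add: prob_space)
  also have "\<dots> \<le> expectation (\<lambda>x. h x powr p)"
    using assms \<open>?m \<ge> 0\<close> by (intro integral_mono powr_tangent) auto
  finally show ?thesis .
qed

text \<open>Jensen inside, then Tonelli and translation invariance. The random shift
  \<open>\<tau>\<close> is abstract because it is used twice: as \<open>y\<close> for convolution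
  and as \<open>s y\<close> for averages over segments in the Poincare estimate.\<close>

lemma average_contraction:
  fixes h :: "'a::euclidean_space \<Rightarrow> real"
  assumes M: "prob_space M" and \<tau>[measurable]: "\<tau> \<in> borel_measurable M"
    and h[measurable]: "h \<in> borel_measurable borel" and nn: "\<And>x. 0 \<le> h x" and p: "p \<ge> 1"
    and i1: "\<And>x. integrable M (\<lambda>w. h (x - \<tau> w))"
    and i2: "\<And>x. integrable M (\<lambda>w. h (x - \<tau> w) powr p)"
  shows "(\<integral>\<^sup>+x. ennreal ((\<integral>w. h (x - \<tau> w) \<partial>M) powr p) \<partial>lborel) \<le> (\<integral>\<^sup>+x. ennreal (h x powr p) \<partial>lborel)"
proof -
  interpret M: prob_space M by fact
  interpret pair_sigma_finite lborel M ..
  have "(\<integral>\<^sup>+x. ennreal ((\<integral>w. h (x - \<tau> w) \<partial>M) powr p) \<partial>lborel)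
      \<le> (\<integral>\<^sup>+x. \<integral>\<^sup>+w. ennreal (h (x - \<tau> w) powr p) \<partial>M \<partial>lborel)"
  proof (rule nn_integral_mono)
    fix x
    have "ennreal ((\<integral>w. h (x - \<tau> w) \<partial>M) powr p) \<le> ennreal (\<integral>w. h (x - \<tau> w) powr p \<partial>M)"
      using M.powr_expectation_le[OF p nn i1 i2] by (intro ennreal_leI)
    also have "\<dots> = (\<integral>\<^sup>+w. ennreal (h (x - \<tau> w) powr p) \<partial>M)"
      using i2 by (intro nn_integral_eq_integral[symmetric]) auto
    finally show "ennreal ((\<integral>w. h (x - \<tau> w) \<partial>M) powr p) \<le> \<dots>" .
  qed
  also have "\<dots> = (\<integral>\<^sup>+w. \<integral>\<^sup>+x. ennreal (h (x - \<tau> w) powr p) \<partial>lborel \<partial>M)"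
    by (rule Fubini'[symmetric]) measurable
  also have "\<dots> = (\<integral>\<^sup>+w. \<integral>\<^sup>+x. ennreal (h x powr p) \<partial>lborel \<partial>M)"
    by (intro nn_integral_cong nn_integral_translate[of "\<lambda>x. ennreal (h x powr p)"]) measurable
  also have "\<dots> = (\<integral>\<^sup>+x. ennreal (h x powr p) \<partial>lborel)"
    by (simp add: M.emeasure_space_1)
  finally show ?thesis .
qed

subsection \<open>Density of continuous functions in the space of integrable functions\<close>

text \<open>Outer regularity of A and of its complement gives open sets U and V; the Urysohn
  function for the complements of V and U differs from the indicator at most on \<open>U - A\<close>
  and \<open>V - (- A)\<close>, both of small measure.\<close>

lemma approx_indicator_continuous:
  fixes M :: "'a::euclidean_space measure"
  assumes "finite_measure M" and sets: "sets M = sets borel" and A: "A \<in> sets borel" and e: "e > 0"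
  obtains g :: "'a \<Rightarrow> real" where "continuous_on UNIV g" "\<And>x. 0 \<le> g x" "\<And>x. g x \<le> 1"
    "(\<integral>x. \<bar>indicator A x - g x\<bar> \<partial>M) < e"
proof -
  interpret finite_measure M by fact
  have space: "space M = UNIV" using sets by (simp add: sets_eq_imp_space_eq)
  have outer: "\<exists>U. B \<subseteq> U \<and> open U \<and> measure M (U - B) < e / 2" if B: "B \<in> sets borel" for B
  proof -
    have "emeasure M B < emeasure M B + ennreal (e / 2)"
      using e by (simp add: emeasure_eq_measure ennreal_plus[symmetric] ennreal_less_iff del: ennreal_plus)
    then have "(INF U \<in> {U. B \<subseteq> U \<and> open U}. emeasure M U) < emeasure M B + ennreal (e / 2)"
      using outer_regular[OF sets _ B] by simp
    then obtain U where U: "B \<subseteq> U" "open U" "emeasure M U < emeasure M B + ennreal (e / 2)"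
      by (auto simp: INF_less_iff)
    then have "measure M U < measure M B + e / 2"
      using e by (simp add: emeasure_eq_measure ennreal_plus[symmetric] ennreal_less_iff del: ennreal_plus)
    moreover have "measure M (U - B) = measure M U - measure M B"
      using U B sets by (intro finite_measure_Diff) auto
    ultimately show ?thesis using U by (intro exI[of _ U]) auto
  qed
  obtain U where U: "A \<subseteq> U" "open U" "measure M (U - A) < e / 2" using outer[OF A] by blast
  obtain V where V: "- A \<subseteq> V" "open V" "measure M (V - (- A)) < e / 2" using outer[of "- A"] A by auto
  obtain g :: "'a \<Rightarrow> real" where g: "continuous_on UNIV g" "\<And>x. g x \<in> closed_segment 1 0"
    "\<And>x. x \<in> - V \<Longrightarrow> g x = 1" "\<And>x. x \<in> - U \<Longrightarrow> g x = 0"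
    using Urysohn[of "- V" "- U" 1 0] U V by blast
  have g01: "0 \<le> g x" "g x \<le> 1" for x using g(2)[of x] by (auto simp: closed_segment_eq_real_ivl)
  have "(\<integral>x. \<bar>indicator A x - g x\<bar> \<partial>M) \<le> (\<integral>x. indicator (U - A) x + indicator (V - (- A)) x \<partial>M)"
  proof (rule integral_mono)
    have gm: "g \<in> borel_measurable M"
      using borel_measurable_continuous_onI[OF g(1)] sets by (simp cong: measurable_cong_sets)
    show "integrable M (\<lambda>x. \<bar>indicator A x - g x\<bar>)"
    proof (rule integrable_const_bound[of _ 1])
      show "AE x in M. norm \<bar>indicator A x - g x\<bar> \<le> 1"
        using g01 by (auto simp: indicator_def)
      show "(\<lambda>x. \<bar>indicator A x - g x\<bar>) \<in> borel_measurable M"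
        using gm A sets by measurable
    qed
    show "integrable M (\<lambda>x. indicator (U - A) x + indicator (V - (- A)) x :: real)"
      using U V A sets by (intro Bochner_Integration.integrable_add integrable_real_indicator)
        (auto simp: emeasure_eq_measure)
    fix x
    show "\<bar>indicator A x - g x\<bar> \<le> indicator (U - A) x + indicator (V - (- A)) x"
      using g01[of x] g(3,4)[of x] U(1) V(1) by (auto simp: indicator_def)
  qed
  also have "\<dots> = measure M (U - A) + measure M (V - (- A))"
    using U V A sets by (subst Bochner_Integration.integral_add)
      (auto simp: emeasure_eq_measure space intro!: integrable_real_indicator)
  also have "\<dots> < e" using U V by simp
  finally show ?thesis using that g(1) g01 by blast
qed

text \<open>Stated for arbitrary finite Borel measures because it serves both Lebesgue measure on a
  ball and the mass measure of a current on a compact set.\<close>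

lemma dense_continuous_L1:
  fixes M :: "'a::euclidean_space measure" and f :: "'a \<Rightarrow> 'b::euclidean_space"
  assumes fin: "finite_measure M" and sets: "sets M = sets borel" and f: "integrable M f" and e: "e > 0"
  obtains g where "continuous_on UNIV g" "integrable M g" "(\<integral>x. norm (f x - g x) \<partial>M) < e"
proof -
  interpret finite_measure M by fact
  have "\<forall>e>0. \<exists>g. continuous_on UNIV g \<and> integrable M g \<and> (\<integral>x. norm (f x - g x) \<partial>M) < e"
    using f
  proof (induction rule: integrable_induct)
    case (base A c)
    show ?case
    proof (intro allI impI)
      fix e :: real assume "e > 0"
      then have "e / (norm c + 1) > 0" by (simp add: add_nonneg_pos)
      moreover have "A \<in> sets borel" using base sets by simp
      ultimately obtain g :: "'a \<Rightarrow> real" where g: "continuous_on UNIV g" "\<And>x. 0 \<le> g x" "\<And>x. g x \<le> 1"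
        "(\<integral>x. \<bar>indicator A x - g x\<bar> \<partial>M) < e / (norm c + 1)"
        using approx_indicator_continuous[OF fin sets] by blast
      have gm: "g \<in> borel_measurable M"
        using borel_measurable_continuous_onI[OF g(1)] sets by (simp cong: measurable_cong_sets)
      have "integrable M g"
        using g gm by (intro integrable_const_bound[of _ 1]) auto
      moreover have "(\<integral>x. norm (indicator A x *\<^sub>R c - g x *\<^sub>R c) \<partial>M) < e"
      proof -
        have "(\<integral>x. norm (indicator A x *\<^sub>R c - g x *\<^sub>R c) \<partial>M) = norm c * (\<integral>x. \<bar>indicator A x - g x\<bar> \<partial>M)"
          by (simp add: scaleR_diff_left[symmetric] mult.commute)
        also have "\<dots> \<le> norm c * (e / (norm c + 1))"
          using g(4) by (intro mult_left_mono) auto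
        also have "\<dots> < e"
          using \<open>e > 0\<close> by (simp add: divide_less_eq add_nonneg_pos distrib_left mult.commute[of e])
        finally show ?thesis .
      qed
      ultimately show "\<exists>g. continuous_on UNIV g \<and> integrable M g \<and>
          (\<integral>x. norm (indicator A x *\<^sub>R c - g x) \<partial>M) < e"
        using g(1) by (intro exI[of _ "\<lambda>x. g x *\<^sub>R c"]) (auto intro: continuous_intros)
    qed
  next
    case (add f1 f2)
    show ?case
    proof (intro allI impI)
      fix e :: real assume "e > 0"
      then have "e / 2 > 0" by simp
      with add.IH obtain g1 g2 where g: "continuous_on UNIV g1" "integrable M g1"
        "(\<integral>x. norm (f1 x - g1 x) \<partial>M) < e / 2"
        "continuous_on UNIV g2" "integrable M g2" "(\<integral>x. norm (f2 x - g2 x) \<partial>M) < e / 2"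
        by blast
      have "(\<integral>x. norm (f1 x + f2 x - (g1 x + g2 x)) \<partial>M) \<le>
          (\<integral>x. norm (f1 x - g1 x) + norm (f2 x - g2 x) \<partial>M)"
        using g add by (intro integral_mono) (auto simp: add_diff_add intro: norm_triangle_ineq)
      also have "\<dots> < e" using g add by simp
      finally show "\<exists>g. continuous_on UNIV g \<and> integrable M g \<and> (\<integral>x. norm (f1 x + f2 x - g x) \<partial>M) < e"
        using g by (intro exI[of _ "\<lambda>x. g1 x + g2 x"]) (auto intro: continuous_intros)
    qed
  next
    case (lim f s)
    show ?case
    proof (intro allI impI)
      fix e :: real assume "e > 0"
      have "(\<lambda>i. \<integral>x. norm (f x - s i x) \<partial>M) \<longlonglongrightarrow> (\<integral>x. 0 \<partial>M)"
      proof (rule integral_dominated_convergence[where w = "\<lambda>x. 3 * norm (f x)"])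
        show "AE x in M. (\<lambda>i. norm (f x - s i x)) \<longlonglongrightarrow> 0"
        proof (rule AE_I2)
          fix x assume "x \<in> space M"
          then show "(\<lambda>i. norm (f x - s i x)) \<longlonglongrightarrow> 0"
            using tendsto_norm[OF tendsto_diff[OF tendsto_const[of "f x"] lim.hyps(2)[of x]]] by simp
        qed
        show "AE x in M. norm (norm (f x - s i x)) \<le> 3 * norm (f x)" for i
        proof (rule AE_I2)
          fix x assume "x \<in> space M"
          then show "norm (norm (f x - s i x)) \<le> 3 * norm (f x)"
            using lim.hyps(3)[of x i] norm_triangle_ineq4[of "f x" "s i x"] by simp
        qed
      qed (use lim in auto)
      then have "\<forall>\<^sub>F i in sequentially. (\<integral>x. norm (f x - s i x) \<partial>M) < e / 2"
        using \<open>e > 0\<close> by (intro order_tendstoD(2)[of _ "\<integral>x. 0 \<partial>M"]) auto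
      then obtain i where i: "(\<integral>x. norm (f x - s i x) \<partial>M) < e / 2"
        by (auto simp: eventually_sequentially)
      obtain g where g: "continuous_on UNIV g" "integrable M g" "(\<integral>x. norm (s i x - g x) \<partial>M) < e / 2"
        using lim.IH[of i] \<open>e > 0\<close> half_gt_zero by blast
      have "(\<integral>x. norm (f x - g x) \<partial>M) \<le> (\<integral>x. norm (f x - s i x) + norm (s i x - g x) \<partial>M)"
        using g lim by (intro integral_mono) (auto intro: norm_diff_triangle_le[OF order_refl order_refl])
      also have "\<dots> < e" using g i lim by simp
      finally show "\<exists>g. continuous_on UNIV g \<and> integrable M g \<and> (\<integral>x. norm (f x - g x) \<partial>M) < e"
        using g by blast
    qed
  qed
  with e that show ?thesis by blast
qed

text \<open>Projecting an approximation onto the ball of radius B does not increase its distance to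
  \<open>f\<close>: the projection is 1-Lipschitz and fixes the values of \<open>f\<close>.\<close>

lemma dense_continuous_L1_bounded:
  fixes M :: "'a::euclidean_space measure" and f :: "'a \<Rightarrow> 'b::euclidean_space"
  assumes fin: "finite_measure M" and sets: "sets M = sets borel" and f: "integrable M f" and e: "e > 0"
    and B: "AE x in M. norm (f x) \<le> B" "B \<ge> 0"
  obtains g where "continuous_on UNIV g" "\<And>x. norm (g x) \<le> B" "(\<integral>x. norm (f x - g x) \<partial>M) < e"
proof -
  interpret finite_measure M by fact
  obtain g where g: "continuous_on UNIV g" "integrable M g" "(\<integral>x. norm (f x - g x) \<partial>M) < e"
    using dense_continuous_L1[OF fin sets f e] by blast
  let ?P = "closest_point (cball (0::'b) B)"
  have ne: "convex (cball (0::'b) B)" "closed (cball (0::'b) B)" "cball (0::'b) B \<noteq> {}" using B(2) by auto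
  have Pc: "continuous_on UNIV (\<lambda>x. ?P (g x))"
    by (rule continuous_on_compose2[OF continuous_on_closest_point[OF ne, of UNIV] g(1)]) auto
  have Pm: "(\<lambda>x. ?P (g x)) \<in> borel_measurable M"
    using borel_measurable_continuous_onI[OF Pc] sets by (simp cong: measurable_cong_sets)
  have PB: "norm (?P y) \<le> B" for y using closest_point_in_set[OF ne(2,3)] by simp
  have Pi: "integrable M (\<lambda>x. ?P (g x))"
    using Pm PB by (intro integrable_const_bound[of _ B]) auto
  have "(\<integral>x. norm (f x - ?P (g x)) \<partial>M) \<le> (\<integral>x. norm (f x - g x) \<partial>M)"
  proof (rule integral_mono_AE)
    show "AE x in M. norm (f x - ?P (g x)) \<le> norm (f x - g x)"
      using B(1)
    proof eventually_elim
      case (elim x)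
      then have "?P (f x) = f x" by (intro closest_point_self) simp
      then show ?case
        using closest_point_lipschitz[OF ne, of "f x" "g x"] by (simp add: dist_norm)
    qed
  qed (use f g Pi in auto)
  with Pc PB g(3) that show ?thesis by (meson order.strict_trans1)
qed

subsection \<open>Mollification\<close>

lemma prob_space_mollifier:
  assumes "mollifier \<epsilon> \<eta>"
  shows "prob_space (density lborel (\<lambda>x. ennreal (\<eta> x)))"
proof
  have "emeasure (density lborel (\<lambda>x. ennreal (\<eta> x))) (space lborel) = (\<integral>\<^sup>+x. ennreal (\<eta> x) \<partial>lborel)"
    using kernel_borel[OF mollifier_kernel[OF assms]] by (subst emeasure_density) auto
  also have "\<dots> = 1"
    using assms by (subst nn_integral_eq_integral) (auto simp: mollifier_def)
  finally show "emeasure (density lborel (\<lambda>x. ennreal (\<eta> x)))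
      (space (density lborel (\<lambda>x. ennreal (\<eta> x)))) = 1" by simp
qed

lemma integral_mollifier:
  fixes f :: "_ \<Rightarrow> 'b::{banach,second_countable_topology}"
  assumes "mollifier \<epsilon> \<eta>" "f \<in> borel_measurable borel"
  shows "(\<integral>y. f y \<partial>density lborel (\<lambda>x. ennreal (\<eta> x))) = (\<integral>y. \<eta> y *\<^sub>R f y \<partial>lborel)"
    and "integrable (density lborel (\<lambda>x. ennreal (\<eta> x))) f \<longleftrightarrow> integrable lborel (\<lambda>y. \<eta> y *\<^sub>R f y)"
  using assms kernel_borel[OF mollifier_kernel[OF assms(1)]]
  by (auto simp: mollifier_def integral_density integrable_density)

lemma borel_measurable_conv:
  assumes "kernel R \<eta>" "integrable lborel f"
  shows "conv \<eta> f \<in> borel_measurable borel"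
proof -
  have [measurable]: "\<eta> \<in> borel_measurable borel" "f \<in> borel_measurable borel"
    using kernel_borel[OF assms(1)] assms(2) by auto
  show ?thesis unfolding conv_def by measurable
qed

lemma norm_conv_le:
  assumes \<eta>: "mollifier \<epsilon> \<eta>" and f: "integrable lborel f"
  shows "norm (conv \<eta> f x) \<le> (\<integral>y. \<eta> y * norm (f (x - y)) \<partial>lborel)"
proof -
  have "norm (conv \<eta> f x) \<le> (\<integral>y. norm (\<eta> y *\<^sub>R f (x - y)) \<partial>lborel)"
    unfolding conv_commute(1)[OF mollifier_kernel[OF \<eta>] f] by (rule integral_norm_bound)
  also have "\<dots> = (\<integral>y. \<eta> y * norm (f (x - y)) \<partial>lborel)"
    using \<eta> by (simp add: mollifier_def)
  finally show ?thesis .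
qed

text \<open>\<open>conv \<eta> f\<close> is an average of translates of \<open>f\<close> with
  probability density \<open>\<eta>\<close>, so \<open>average_contraction\<close> applies.\<close>

lemma conv_powr_le:
  fixes f :: "real^'n::finite \<Rightarrow> 'b::euclidean_space"
  assumes \<eta>: "mollifier \<epsilon> \<eta>" and f: "integrable lborel f" and p: "p \<ge> 1"
    and fp: "integrable lborel (\<lambda>x. norm (f x) powr p)"
  shows "integrable lborel (\<lambda>x. norm (conv \<eta> f x) powr p)"
    and "(\<integral>x. norm (conv \<eta> f x) powr p \<partial>lborel) \<le> (\<integral>x. norm (f x) powr p \<partial>lborel)"
proof -
  note k = mollifier_kernel[OF \<eta>]
  have [measurable]: "\<eta> \<in> borel_measurable borel" "f \<in> borel_measurable borel"
      "conv \<eta> f \<in> borel_measurable borel"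
    using kernel_borel[OF k] f borel_measurable_conv[OF k f] by auto
  let ?M = "density lborel (\<lambda>x. ennreal (\<eta> x))"
  have fn: "integrable lborel (\<lambda>x. norm (f x))" using f by simp
  have "(\<integral>\<^sup>+x. ennreal (norm (conv \<eta> f x) powr p) \<partial>lborel) \<le>
      (\<integral>\<^sup>+x. ennreal ((\<integral>y. norm (f (x - y)) \<partial>?M) powr p) \<partial>lborel)"
    using norm_conv_le[OF \<eta> f] p
    by (intro nn_integral_mono ennreal_leI powr_mono2) (auto simp: integral_mollifier[OF \<eta>])
  also have "\<dots> \<le> (\<integral>\<^sup>+x. ennreal (norm (f x) powr p) \<partial>lborel)"
  proof (rule average_contraction[OF prob_space_mollifier[OF \<eta>], where \<tau> = "\<lambda>y. y"])
    show "integrable ?M (\<lambda>y. norm (f (x - y)))" for x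
      by (subst integral_mollifier(2)[OF \<eta>], measurable) (rule conv_commute(2)[OF k fn])
    show "integrable ?M (\<lambda>y. norm (f (x - y)) powr p)" for x
      by (subst integral_mollifier(2)[OF \<eta>], measurable) (rule conv_commute(2)[OF k fp])
  qed (use p in auto)
  also have "\<dots> = ennreal (\<integral>x. norm (f x) powr p \<partial>lborel)"
    by (rule nn_integral_eq_integral[OF fp]) auto
  finally have le: "(\<integral>\<^sup>+x. ennreal (norm (conv \<eta> f x) powr p) \<partial>lborel) \<le> ennreal (\<integral>x. norm (f x) powr p \<partial>lborel)" .
  show i: "integrable lborel (\<lambda>x. norm (conv \<eta> f x) powr p)"
    using le_less_trans[OF le ennreal_less_top] by (intro integrableI_bounded) auto
  show "(\<integral>x. norm (conv \<eta> f x) powr p \<partial>lborel) \<le> (\<integral>x. norm (f x) powr p \<partial>lborel)"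
    using le nn_integral_eq_integral[OF i] by (simp add: ennreal_le_iff)
qed

lemma conv_L1_le:
  fixes f :: "real^'n::finite \<Rightarrow> 'b::euclidean_space"
  assumes \<eta>: "mollifier \<epsilon> \<eta>" and f: "integrable lborel f"
  shows "integrable lborel (conv \<eta> f)"
    and "(\<integral>x. norm (conv \<eta> f x) \<partial>lborel) \<le> (\<integral>x. norm (f x) \<partial>lborel)"
  using conv_powr_le[OF \<eta> f, of 1] f borel_measurable_conv[OF mollifier_kernel[OF \<eta>] f]
  by (simp_all add: integrable_norm_iff)

lemma mollify_uniform:
  fixes f :: "real^'n::finite \<Rightarrow> 'b::euclidean_space"
  assumes f: "continuous_on UNIV f" "\<And>x. norm x > R \<Longrightarrow> f x = 0" and e: "e > 0"
  obtains d where "d > 0" "\<And>\<delta> \<eta> x. \<delta> < d \<Longrightarrow> mollifier \<delta> \<eta> \<Longrightarrow> norm (conv \<eta> f x - f x) \<le> e"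
proof -
  obtain d where d: "d > 0" "\<And>x y. norm (x - y) < d \<Longrightarrow> norm (f x - f y) < e"
    using bounded_support_uniformly_continuous[OF f e] by metis
  have fi: "integrable lborel f" using f by (rule integrable_continuous_bounded_support)
  have "norm (conv \<eta> f x - f x) \<le> e" if "\<delta> < d" and \<eta>: "mollifier \<delta> \<eta>" for \<delta> \<eta> x
  proof -
    note c = conv_commute[OF mollifier_kernel[OF \<eta>] fi, of x]
    have \<eta>': "integrable lborel \<eta>" "(\<integral>y. \<eta> y \<partial>lborel) = 1" "\<And>y. 0 \<le> \<eta> y" "\<And>y. norm y > \<delta> \<Longrightarrow> \<eta> y = 0"
      using \<eta> by (auto simp: mollifier_def)
    have "conv \<eta> f x - f x = (\<integral>y. \<eta> y *\<^sub>R f (x - y) - \<eta> y *\<^sub>R f x \<partial>lborel)"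
      using c \<eta>' by (subst Bochner_Integration.integral_diff) auto
    also have "norm \<dots> \<le> (\<integral>y. e * \<eta> y \<partial>lborel)"
    proof (rule norm_integral_le)
      fix y
      show "norm (\<eta> y *\<^sub>R f (x - y) - \<eta> y *\<^sub>R f x) \<le> e * \<eta> y"
      proof (cases "norm y > \<delta>")
        case False
        then have "norm (f (x - y) - f x) \<le> e" using d(2)[of "x - y" x] \<open>\<delta> < d\<close> by simp
        then show ?thesis
          using mult_left_mono[OF _ \<eta>'(3)[of y], of "norm (f (x - y) - f x)" e] \<eta>'(3)[of y]
          by (simp add: scaleR_diff_right[symmetric] mult.commute[of e])
      qed (simp add: \<eta>')
    qed (use c \<eta>' in auto)
    also have "\<dots> = e" using \<eta>' by simp
    finally show ?thesis .
  qed
  with d(1) that show ?thesis by blast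
qed

text \<open>Three parts of size e/3: replace \<open>f\<close> by a continuous \<open>h\<close> of
  bounded support, mollify \<open>h\<close> uniformly, and control the mollification of
  \<open>f - h\<close> by the L1 contraction property.\<close>

lemma mollify_L1:
  fixes f :: "real^'n::finite \<Rightarrow> 'b::euclidean_space"
  assumes f: "integrable lborel f" "\<And>x. norm x > R \<Longrightarrow> f x = 0" and R: "R > 0" and e: "e > 0"
  obtains d where "d > 0"
    "\<And>\<delta> \<eta>. \<delta> < d \<Longrightarrow> mollifier \<delta> \<eta> \<Longrightarrow> (\<integral>x. norm (conv \<eta> f x - f x) \<partial>lborel) < e"
proof -
  let ?C = "cball (0::real^'n) (R + 1)"
  define M where "M = density lborel (\<lambda>x. ennreal (indicator ?C x))"
  have Cm: "(indicator ?C :: _ \<Rightarrow> real) \<in> borel_measurable borel"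
    by (intro borel_measurable_indicator) auto
  have "emeasure M (space M) = emeasure lborel ?C"
    unfolding M_def using Cm by (subst emeasure_density) (auto simp: ennreal_indicator intro!: borel_measurable_indicator)
  then have fM: "finite_measure M"
    using emeasure_lborel_cball_finite[of "0::real^'n" "R + 1"] by (intro finite_measureI) auto
  have sM: "sets M = sets borel" by (simp add: M_def)
  have iM: "integrable M g \<longleftrightarrow> integrable lborel (\<lambda>x. indicator ?C x *\<^sub>R g x)"
      "(\<integral>x. g x \<partial>M) = (\<integral>x. indicator ?C x *\<^sub>R g x \<partial>lborel)"
    if "g \<in> borel_measurable borel" for g :: "real^'n \<Rightarrow> 'c::euclidean_space"
    using that Cm integrable_density[of g lborel "indicator ?C"] integral_density[of g lborel "indicator ?C"]
    by (simp_all add: M_def)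
  have f_ind: "(\<lambda>x. indicator ?C x *\<^sub>R f x) = f"
    using f(2) by (auto simp: indicator_def fun_eq_iff)
  have fi: "integrable M f" using f(1) by (subst iM) (auto simp: f_ind)
  obtain g where g: "continuous_on UNIV g" "integrable M g" "(\<integral>x. norm (f x - g x) \<partial>M) < e / 3"
    using dense_continuous_L1[OF fM sM fi, of "e / 3"] e by auto
  \<comment> \<open>The cutoff gives the approximation bounded support. It is 1 where
    \<open>f\<close> may be nonzero, and elsewhere it only shrinks the error.\<close>
  obtain c :: "real^'n \<Rightarrow> real" where c: "continuous_on UNIV c" "\<And>x. c x \<in> closed_segment 1 0"
    "\<And>x. x \<in> cball 0 R \<Longrightarrow> c x = 1" "\<And>x. x \<in> - ball 0 (R + 1) \<Longrightarrow> c x = 0"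
    by (rule Urysohn[of "cball 0 R" "- ball 0 (R + 1)" 1 0]) (auto simp: subset_iff)
  have c01: "0 \<le> c x" "c x \<le> 1" for x using c(2)[of x] by (auto simp: closed_segment_eq_real_ivl)
  define h where "h x = c x *\<^sub>R g x" for x
  have h: "continuous_on UNIV h" unfolding h_def by (intro continuous_intros c g)
  have h0: "h x = 0" if "norm x > R + 1" for x using c(4)[of x] that by (simp add: h_def)
  have hi: "integrable lborel h" using h h0 by (rule integrable_continuous_bounded_support)
  have gm: "g \<in> borel_measurable borel" by (rule borel_measurable_continuous_onI[OF g(1)])
  have fh: "(\<integral>x. norm (f x - h x) \<partial>lborel) < e / 3"
  proof -
    have "(\<integral>x. norm (f x - h x) \<partial>lborel) \<le> (\<integral>x. indicator ?C x *\<^sub>R norm (f x - g x) \<partial>lborel)"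
    proof (rule integral_mono)
      show "integrable lborel (\<lambda>x. indicator ?C x *\<^sub>R norm (f x - g x))"
        using iM(1)[of "\<lambda>x. norm (f x - g x)"] gm f fi g(2) by auto
      fix x
      show "norm (f x - h x) \<le> indicator ?C x *\<^sub>R norm (f x - g x)"
        using c(3)[of x] f(2)[of x] h0[of x] c01[of x] mult_right_mono[of "c x" 1 "norm (g x)"]
        by (cases "norm x \<le> R"; cases "norm x \<le> R + 1") (auto simp: h_def)
    qed (use f hi in auto)
    also have "\<dots> < e / 3" using g(3) iM(2)[of "\<lambda>x. norm (f x - g x)"] gm f by auto
    finally show ?thesis .
  qed
  \<comment> \<open>For radii below 1 the mollification of \<open>h\<close> lives in the ball of
    radius R + 2, over which the uniform error is integrated; adding 1 keeps the denominator
    positive.\<close>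
  define V where "V = measure lborel (cball (0::real^'n) (R + 2)) + 1"
  have V: "V > 0" by (simp add: V_def add_nonneg_pos)
  then have "e / (3 * V) > 0" using e by simp
  then obtain d where d: "d > 0"
    "\<And>\<delta> \<eta> x. \<delta> < d \<Longrightarrow> mollifier \<delta> \<eta> \<Longrightarrow> norm (conv \<eta> h x - h x) \<le> e / (3 * V)"
    using mollify_uniform[OF h h0] by metis
  have "(\<integral>x. norm (conv \<eta> f x - f x) \<partial>lborel) < e" if \<delta>: "\<delta> < min d 1" and \<eta>: "mollifier \<delta> \<eta>" for \<delta> \<eta>
  proof -
    note k = mollifier_kernel[OF \<eta>]
    have i: "integrable lborel (\<lambda>x. f x - h x)" using f hi by auto
    have cz: "conv \<eta> h x = 0" if "norm x > R + 2" for x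
    proof -
      have "\<eta> (x - y) *\<^sub>R h y = 0" for y
      proof (cases "norm y > R + 1")
        case False
        then have "norm (x - y) > \<delta>" using that \<delta> norm_triangle_ineq2[of x y] by auto
        then show ?thesis using \<eta> by (simp add: mollifier_def)
      qed (simp add: h0)
      then show ?thesis
        unfolding conv_def by (simp only: Bochner_Integration.integral_zero)
    qed
    have ih: "integrable lborel (\<lambda>x. norm (conv \<eta> h x - h x))"
      using conv_L1_le(1)[OF \<eta> hi] hi by auto
    have "(\<integral>x. norm (conv \<eta> h x - h x) \<partial>lborel) \<le> (\<integral>x. e / (3 * V) * indicator (cball (0::real^'n) (R + 2)) x \<partial>lborel)"
    proof (rule integral_mono)
      show "integrable lborel (\<lambda>x. norm (conv \<eta> h x - h x))" by (rule ih)
      show "integrable lborel (\<lambda>x. e / (3 * V) * indicator (cball (0::real^'n) (R + 2)) x)"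
        by (intro integrable_mult_right integrable_real_indicator)
          (simp_all add: emeasure_lborel_cball_finite[unfolded infinity_ennreal_def])
      fix x
      show "norm (conv \<eta> h x - h x) \<le> e / (3 * V) * indicator (cball 0 (R + 2)) x"
        using d(2)[of \<delta> \<eta> x] \<delta> \<eta> cz[of x] h0[of x] by (auto simp: indicator_def)
    qed
    also have "\<dots> = e / (3 * V) * measure lborel (cball (0::real^'n) (R + 2))" by simp
    also have "\<dots> < e / 3"
      using e V by (simp add: V_def field_simps)
    finally have ch: "(\<integral>x. norm (conv \<eta> h x - h x) \<partial>lborel) < e / 3" .
    have "(\<integral>x. norm (conv \<eta> f x - f x) \<partial>lborel) \<le>
        (\<integral>x. norm (conv \<eta> (\<lambda>y. f y - h y) x) + norm (conv \<eta> h x - h x) + norm (f x - h x) \<partial>lborel)"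
    proof (rule integral_mono)
      show "integrable lborel (\<lambda>x. norm (conv \<eta> f x - f x))"
        using conv_L1_le(1)[OF \<eta> f(1)] f by auto
      show "integrable lborel (\<lambda>x. norm (conv \<eta> (\<lambda>y. f y - h y) x) + norm (conv \<eta> h x - h x) + norm (f x - h x))"
        using conv_L1_le(1)[OF \<eta> i] ih i by auto
      fix x
      have eq: "conv \<eta> f x - f x = conv \<eta> (\<lambda>y. f y - h y) x + (conv \<eta> h x - h x) - (f x - h x)"
        using conv_diff[OF k f(1) hi, of x] by simp
      show "norm (conv \<eta> f x - f x) \<le> norm (conv \<eta> (\<lambda>y. f y - h y) x) + norm (conv \<eta> h x - h x) + norm (f x - h x)"
        unfolding eq
        using norm_triangle_ineq4[of "conv \<eta> (\<lambda>y. f y - h y) x + (conv \<eta> h x - h x)" "f x - h x"]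
          norm_triangle_ineq[of "conv \<eta> (\<lambda>y. f y - h y) x" "conv \<eta> h x - h x"] by linarith
    qed
    also have "\<dots> = (\<integral>x. norm (conv \<eta> (\<lambda>y. f y - h y) x) \<partial>lborel) + (\<integral>x. norm (conv \<eta> h x - h x) \<partial>lborel)
        + (\<integral>x. norm (f x - h x) \<partial>lborel)"
      using conv_L1_le(1)[OF \<eta> i] ih i by simp
    also have "\<dots> < e"
      using conv_L1_le(2)[OF \<eta> i] fh ch by linarith
    finally show ?thesis .
  qed
  with d(1) that[of "min d 1"] show ?thesis by auto
qed

subsection \<open>Cutoff functions and integration by parts\<close>

lemma smooth_reflect:
  assumes "smooth g" shows "smooth (\<lambda>y. g (x - y))" "pd j (\<lambda>y. g (x - y)) y = - pd j g (x - y)"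
proof -
  have D: "((\<lambda>y. c * g (x - y)) has_derivative (\<lambda>h. c * (grad g (x - y) \<bullet> (- h)))) (at y)"
    if "smooth g" for g c y
  proof -
    have "((\<lambda>y. x - y) has_derivative (\<lambda>h. - h)) (at y)"
      by (auto intro!: derivative_eq_intros)
    from has_derivative_compose[OF this smooth_has_derivative[OF that]]
    show ?thesis by (rule has_derivative_mult_right)
  qed
  have P: "pd j (\<lambda>y. c * g (x - y)) y = (- c) * pd j g (x - y)" if "smooth g" for g c y j
    by (subst pd_eqI[OF D[OF that]]) (simp add: grad_def inner_axis)
  show "pd j (\<lambda>y. g (x - y)) y = - pd j g (x - y)"
    using P[OF assms, of j 1] by simp
  show "smooth (\<lambda>y. g (x - y))"
  \<comment> \<open>The scalar factor absorbs the sign that each differentiation of the reflection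
    produces.\<close>
  proof (rule smooth_coinduct[where A = "{\<lambda>y. c * g (x - y) | c g. smooth g}"])
    show "(\<lambda>y. g (x - y)) \<in> {\<lambda>y. c * g (x - y) | c g. smooth g}"
      using assms by (auto intro!: exI[of _ 1] exI[of _ g])
    show "f differentiable (at y)" if "f \<in> {\<lambda>y. c * g (x - y) | c g. smooth g}" for f y
      using that D by (auto simp: differentiable_def)
    show "pd j f \<in> {\<lambda>y. c * g (x - y) | c g. smooth g}"
      if f: "f \<in> {\<lambda>y. c * g (x - y) | c g. smooth g}" for f j
    proof -
      obtain c g where g: "f = (\<lambda>y. c * g (x - y))" "smooth g" using f by blast
      have "pd j f = (\<lambda>y. (- c) * pd j g (x - y))"
        unfolding g(1) using P[OF g(2)] by blast
      then show ?thesis using smooth_pd[OF g(2)] by blast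
    qed
  qed
qed

lemma smooth_kernelI:
  assumes "smooth f" "compact (supp f)"
  obtains R where "R > 0" "kernel R f"
proof -
  obtain R where "R > 0" "\<forall>x\<in>supp f. norm x \<le> R"
    using compact_imp_bounded[OF assms(2)] by (auto simp: bounded_pos)
  then have "kernel R f" using assms(1) not_in_supp[of _ f] by (force simp: kernel_def)
  with \<open>R > 0\<close> that show ?thesis by blast
qed

lemma kernel_integrable: "kernel R f \<Longrightarrow> integrable lborel f"
  by (rule integrable_continuous_bounded_support[OF kernel_cont]) (auto simp: kernel_def)

text \<open>Convolving \<open>g\<close> with the indicator of a larger ball gives, near 0, the
  constant with value the integral of \<open>g\<close>. Its derivative at 0 is 0, but also the
  integral of \<open>pd j g\<close>.\<close>

lemma integral_pd_zero:
  fixes g :: "real^'n::finite \<Rightarrow> real"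
  assumes g: "kernel R g"
  shows "(\<integral>x. pd j g x \<partial>lborel) = 0"
proof -
  define f :: "real^'n \<Rightarrow> real" where "f = indicator (cball 0 (R + 1))"
  have fi: "integrable lborel f"
    unfolding f_def by (intro integrable_real_indicator)
      (simp_all add: emeasure_lborel_cball_finite[unfolded infinity_ennreal_def])
  have *: "conv h f x = (\<integral>y. h y \<partial>lborel)" if h: "kernel R h" and x: "x \<in> ball 0 1" for h x
  proof -
    have "conv h f x = (\<integral>y. h y *\<^sub>R f (x - y) \<partial>lborel)"
      by (rule conv_commute[OF h fi])
    also have "(\<lambda>y. h y *\<^sub>R f (x - y)) = h"
    proof
      fix y
      show "h y *\<^sub>R f (x - y) = h y"
        using x h norm_triangle_ineq4[of x y] by (cases "norm y > R") (auto simp: kernel_def f_def indicator_def)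
    qed
    finally show ?thesis .
  qed
  have "pd j (conv g f) 0 = pd j (\<lambda>_. \<integral>y. g y \<partial>lborel) 0"
    by (rule pd_cong_open[of "ball 0 1"]) (auto simp: *[OF g])
  then show ?thesis
    using pd_conv[OF g fi, of j 0] *[OF kernel_pd[OF g], of 0 j] by (simp add: pd_const)
qed

lemma kernel_mult: "smooth f \<Longrightarrow> kernel R g \<Longrightarrow> kernel R (\<lambda>x. f x * g x)"
  by (auto simp: kernel_def smooth_mult)

lemma integral_by_parts_smooth:
  assumes f: "smooth f" and g: "kernel R g"
  shows "(\<integral>x. f x * pd j g x \<partial>lborel) = - (\<integral>x. pd j f x * g x \<partial>lborel)"
proof -
  have "(\<integral>x. pd j (\<lambda>x. f x * g x) x \<partial>lborel) = (\<integral>x. f x * pd j g x + pd j f x * g x \<partial>lborel)"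
    using f g by (intro Bochner_Integration.integral_cong pd_mult)
      (auto intro: smooth_differentiable simp: kernel_def)
  also have "\<dots> = (\<integral>x. f x * pd j g x \<partial>lborel) + (\<integral>x. pd j f x * g x \<partial>lborel)"
    by (intro Bochner_Integration.integral_add kernel_integrable[where R = R] kernel_mult f g smooth_pd kernel_pd)
  finally show ?thesis
    using integral_pd_zero[OF kernel_mult[OF f g], of j] by simp
qed

lemma smooth_cutoff:
  fixes K :: "(real^'n::finite) set"
  assumes K: "compact K" and U: "open U" "K \<subseteq> U"
  obtains \<theta> V where "test_fn U \<theta>" "\<And>x. 0 \<le> \<theta> x" "\<And>x. \<theta> x \<le> 1"
    "open V" "K \<subseteq> V" "\<And>x. x \<in> V \<Longrightarrow> \<theta> x = 1"
proof -
  obtain e where e: "e > 0" "(\<Union>x\<in>K. cball x e) \<subseteq> U"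
    using compact_subset_open_imp_cball_epsilon_subset[OF K U] by blast
  \<comment> \<open>Mollifying at scale d the indicator of the 2d-neighbourhood of K gives 1 on the
    d-neighbourhood and 0 beyond distance 3d = e.\<close>
  define d where "d = e / 3"
  have d: "d > 0" using e by (simp add: d_def)
  obtain \<eta> :: "real^'n \<Rightarrow> real" where \<eta>: "mollifier d \<eta>" using ex_mollifier[OF d] by blast
  note k = mollifier_kernel[OF \<eta>]
  define W where "W = (\<Union>x\<in>K. ball x (2 * d))"
  define S where "S = {x + y |x y. x \<in> K \<and> y \<in> cball 0 e}"
  have S: "compact S" unfolding S_def by (intro compact_sums K compact_cball)
  have SI: "x \<in> S" if "k \<in> K" "norm (x - k) \<le> e" for x k
  proof -
    have "x = k + (x - k)" "x - k \<in> cball 0 e" using that by auto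
    with that(1) show ?thesis unfolding S_def by blast
  qed
  have SU: "S \<subseteq> U"
  proof
    fix z assume "z \<in> S"
    then obtain x y where "z = x + y" "x \<in> K" "norm y \<le> e" by (auto simp: S_def)
    then have "z \<in> cball x e" by (simp add: dist_norm)
    with \<open>x \<in> K\<close> e(2) show "z \<in> U" by blast
  qed
  have "W \<subseteq> S"
  proof
    fix x assume "x \<in> W"
    then obtain k where "k \<in> K" "norm (x - k) < 2 * d"
      by (auto simp: W_def dist_norm norm_minus_commute)
    then show "x \<in> S" using d by (intro SI[of k]) (auto simp: d_def)
  qed
  then have "bounded W" using S compact_imp_bounded bounded_subset by blast
  moreover have Wo: "open W" unfolding W_def by auto
  ultimately have fi: "integrable lborel (indicator W :: real^'n \<Rightarrow> real)"
    using emeasure_bounded_finite[of W] by (intro integrable_real_indicator) auto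
  define \<theta> where "\<theta> = conv \<eta> (indicator W :: real^'n \<Rightarrow> real)"
  have c: "\<theta> x = (\<integral>y. \<eta> y *\<^sub>R indicator W (x - y) \<partial>lborel)"
      "integrable lborel (\<lambda>y. \<eta> y *\<^sub>R indicator W (x - y) :: real)" for x
    unfolding \<theta>_def using conv_commute[OF k fi] by auto
  have \<eta>': "integrable lborel \<eta>" "(\<integral>y. \<eta> y \<partial>lborel) = 1" "\<And>y. 0 \<le> \<eta> y" "\<And>y. norm y > d \<Longrightarrow> \<eta> y = 0"
    using \<eta> by (auto simp: mollifier_def)
  have sm: "smooth \<theta>" unfolding \<theta>_def by (rule smooth_conv[OF k fi])
  have "\<theta> x = 0" if "x \<notin> S" for x
  proof -
    have "\<eta> y *\<^sub>R indicator W (x - y) = (0::real)" for y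
    proof (rule ccontr)
      assume "\<not> ?thesis"
      then have "norm y \<le> d" "x - y \<in> W" using \<eta>'(4)[of y] by (auto simp: indicator_def not_less[symmetric])
      then obtain k where "k \<in> K" "norm (x - y - k) < 2 * d"
        by (auto simp: W_def dist_norm norm_minus_commute)
      moreover have "norm (x - k) \<le> norm (x - y - k) + norm y"
        using norm_triangle_ineq[of "x - y - k" y] by (simp add: algebra_simps)
      ultimately have "x \<in> S" using \<open>norm y \<le> d\<close> by (intro SI[of k]) (auto simp: d_def)
      with that show False by simp
    qed
    then show ?thesis unfolding c(1) by (simp only: Bochner_Integration.integral_zero)
  qed
  then have sS: "supp \<theta> \<subseteq> S" using compact_imp_closed[OF S] by (intro supp_subset) auto
  then have tf: "test_fn U \<theta>"
    unfolding test_fn_def using sm SU compact_supp_subset[OF S] by blast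
  have c0: "0 \<le> \<theta> x" for x unfolding c(1) using \<eta>'(3) by (intro Bochner_Integration.integral_nonneg) auto
  have "\<theta> x \<le> (\<integral>y. \<eta> y \<partial>lborel)" for x
    unfolding c(1) using \<eta>' c(2) by (intro integral_mono) (auto simp: indicator_def)
  then have c1: "\<theta> x \<le> 1" for x using \<eta>' by simp
  define V where "V = (\<Union>x\<in>K. ball x d)"
  have V1: "\<theta> x = 1" if xV: "x \<in> V" for x
  proof -
    obtain k where k: "k \<in> K" "norm (x - k) < d" using xV by (auto simp: V_def dist_norm norm_minus_commute[of _ x])
    have "\<eta> y *\<^sub>R indicator W (x - y) = \<eta> y" for y
    proof (cases "norm y > d")
      case False
      have "norm (x - y - k) \<le> norm (x - k) + norm y"
        using norm_triangle_ineq4[of "x - k" y] by (simp add: algebra_simps)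
      then have "x - y \<in> W"
        using False k by (auto simp: W_def dist_norm norm_minus_commute intro!: bexI[of _ k])
      then show ?thesis by simp
    qed (simp add: \<eta>')
    then show ?thesis unfolding c(1) by (simp only: \<eta>'(2))
  qed
  have "open V" "K \<subseteq> V" using d by (auto simp: V_def)
  with tf c0 c1 V1 that show ?thesis by blast
qed

subsection \<open>Jacobians and weak gradients\<close>

lemma jac_nth: "jac f x $ k $ j = pd j (\<lambda>y. f y $ k) x"
  by (simp add: jac_def)

lemma continuous_jac: "(\<And>k. smooth (\<lambda>x. f x $ k)) \<Longrightarrow> continuous_on A (jac f)"
  unfolding jac_def by (intro continuous_on_vec_lambda smooth_continuous_on smooth_pd)

lemma jac_cong_open:
  assumes "open A" "x \<in> A" "\<And>y. y \<in> A \<Longrightarrow> f y = g y"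
  shows "jac f x = jac g x"
  unfolding vec_eq_iff jac_nth using pd_cong_open[OF assms(1,2)] assms(3) by metis

lemma jac_zero: "jac (\<lambda>x. 0) x = 0"
  by (simp add: vec_eq_iff jac_nth pd_const)

lemma jac_not_in_supp: "x \<notin> supp f \<Longrightarrow> jac f x = 0"
  using jac_cong_open[of "- supp f" x f "\<lambda>_. 0"] open_Compl[OF closed_supp, of f]
  by (auto simp: not_in_supp jac_zero)

text \<open>The tensor product of two vectors; it is the term of the product rule in which the
  cutoff is differentiated.\<close>

definition outer :: "real^'m::finite \<Rightarrow> real^'n::finite \<Rightarrow> real^'n^'m" where
  "outer v z = (\<chi> k. v $ k *\<^sub>R z)"

lemma norm_outer: "norm (outer v z) = norm v * norm z"
proof -
  have "norm (outer v z) = sqrt (\<Sum>k\<in>UNIV. (norm z)\<^sup>2 * (v $ k)\<^sup>2)"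
    by (simp add: outer_def norm_vec_def[of "\<chi> k. v $ k *\<^sub>R z"] L2_set_def power_mult_distrib mult.commute)
  also have "\<dots> = sqrt ((norm z)\<^sup>2 * (norm v)\<^sup>2)"
    by (simp add: sum_distrib_left[symmetric] norm_vec_def[of v] L2_set_def sum_nonneg)
  finally show ?thesis by (simp add: real_sqrt_mult mult.commute)
qed

lemma jac_scaleR:
  assumes "smooth \<zeta>" "\<And>k. smooth (\<lambda>x. v x $ k)"
  shows "jac (\<lambda>x. \<zeta> x *\<^sub>R v x) x = \<zeta> x *\<^sub>R jac v x + outer (v x) (grad \<zeta> x)"
  unfolding vec_eq_iff
  by (simp add: jac_nth outer_def grad_def pd_mult smooth_differentiable assms algebra_simps)

lemma jac_diff:
  assumes "\<And>k. smooth (\<lambda>x. v x $ k)" "\<And>k. smooth (\<lambda>x. w x $ k)"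
  shows "jac (\<lambda>x. v x - w x) x = jac v x - jac w x"
  unfolding vec_eq_iff by (simp add: jac_nth pd_smooth_diff assms)

lemma test_vec_scaleR:
  assumes "test_fn \<Omega> \<zeta>" "\<And>k. smooth (\<lambda>x. v x $ k)"
  shows "test_vec \<Omega> (\<lambda>x. \<zeta> x *\<^sub>R v x)"
proof -
  have "supp (\<lambda>x. \<zeta> x *\<^sub>R v x) \<subseteq> supp \<zeta>"
    by (rule supp_subset) (auto simp: not_in_supp)
  then show ?thesis
    using assms compact_supp_subset[of "supp \<zeta>"] by (auto simp: test_vec_def test_fn_def intro: smooth_mult)
qed

text \<open>The whole-space counterpart of \<open>weak_grad\<close>, meant for Borel representatives
  extended by 0. Test functions still live in \<Omega>, so a jump of the extension at the boundary
  does not enter.\<close>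

definition wgrad :: "(real^'n::finite) set \<Rightarrow> (real^'n \<Rightarrow> real^'m::finite) \<Rightarrow> (real^'n \<Rightarrow> real^'n^'m) \<Rightarrow> bool" where
  "wgrad \<Omega> w G \<longleftrightarrow> integrable lborel w \<and> integrable lborel G \<and>
     (\<forall>\<phi> k j. test_fn \<Omega> \<phi> \<longrightarrow> (\<integral>x. w x $ k * pd j \<phi> x \<partial>lborel) = - (\<integral>x. G x $ k $ j * \<phi> x \<partial>lborel))"

text \<open>As long as the ball around x stays in \<Omega>, the reflected kernel
  \<open>\<eta> (x - y)\<close> is an admissible test function of y, and the weak equation for it is
  the claim.\<close>

lemma jac_conv:
  fixes w :: "real^'n::finite \<Rightarrow> real^'m::finite"
  assumes \<eta>: "kernel \<epsilon> \<eta>" and w: "wgrad \<Omega> w G" and x: "cball x \<epsilon> \<subseteq> \<Omega>"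
  shows "jac (conv \<eta> w) x = conv \<eta> G x"
proof -
  have i: "integrable lborel w" "integrable lborel G" using w by (auto simp: wgrad_def)
  have \<eta>s: "smooth \<eta>" using \<eta> by (simp add: kernel_def)
  have "supp (\<lambda>y. \<eta> (x - y)) \<subseteq> cball x \<epsilon>"
    using \<eta> by (intro supp_subset) (auto simp: kernel_def dist_norm)
  then have tf: "test_fn \<Omega> (\<lambda>y. \<eta> (x - y))"
    unfolding test_fn_def using smooth_reflect(1)[OF \<eta>s] x compact_supp_subset[OF compact_cball] by blast
  have "jac (conv \<eta> w) x $ k $ j = conv \<eta> G x $ k $ j" for k j
  proof -
    have "jac (conv \<eta> w) x $ k $ j = pd j (conv \<eta> (\<lambda>y. w y $ k)) x"
      by (simp add: jac_nth conv_nth[OF \<eta> i(1)])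
    also have "\<dots> = (\<integral>y. pd j \<eta> (x - y) * w y $ k \<partial>lborel)"
      using pd_conv[OF \<eta> integrable_nth[OF i(1)]] by (simp add: conv_def)
    also have "\<dots> = - (\<integral>y. w y $ k * pd j (\<lambda>y. \<eta> (x - y)) y \<partial>lborel)"
      by (simp add: smooth_reflect(2)[OF \<eta>s] mult.commute)
    also have "\<dots> = (\<integral>y. G y $ k $ j * \<eta> (x - y) \<partial>lborel)"
      using w tf by (simp add: wgrad_def)
    also have "\<dots> = conv \<eta> G x $ k $ j"
      unfolding conv_nth[OF \<eta> i(2)] conv_nth[OF \<eta> integrable_nth[OF i(2)]]
      by (simp add: conv_def mult.commute)
    finally show ?thesis .
  qed
  then show ?thesis by (simp add: vec_eq_iff)
qed

subsection \<open>A Poincare inequality for mollification\<close>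

lemma norm_matrix_vector_le:
  fixes A :: "real^'n::finite^'m::finite"
  shows "norm (A *v y) \<le> norm A * norm y"
proof -
  have "norm (A *v y) \<le> L2_set (\<lambda>k. norm (A $ k) * norm y) UNIV"
    unfolding norm_vec_def[of "A *v y"]
    by (rule L2_set_mono) (auto simp: matrix_vector_mul_component Cauchy_Schwarz_ineq2)
  also have "\<dots> = norm A * norm y"
    by (simp add: L2_set_left_distrib norm_vec_def[of A])
  finally show ?thesis .
qed

lemma has_derivative_jac:
  fixes v :: "real^'n::finite \<Rightarrow> real^'m::finite"
  assumes "\<And>k. smooth (\<lambda>x. v x $ k)"
  shows "(v has_derivative (\<lambda>h. jac v x *v h)) (at x)"
proof (subst has_derivative_componentwise_within, intro ballI)
  fix b :: "real^'m" assume "b \<in> Basis"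
  then obtain k where b: "b = axis k 1" by (auto simp: Basis_vec_def)
  have "jac v x $ k = grad (\<lambda>x. v x $ k) x"
    by (simp add: vec_eq_iff jac_nth grad_def)
  then show "((\<lambda>x. v x \<bullet> b) has_derivative (\<lambda>h. (jac v x *v h) \<bullet> b)) (at x)"
    using smooth_has_derivative[OF assms, of k x]
    by (simp add: b inner_axis matrix_vector_mul_component)
qed

text \<open>The fundamental theorem of calculus along the segment from x to x - y.\<close>

lemma segment_bound:
  fixes v :: "real^'n::finite \<Rightarrow> real^'m::finite"
  assumes "\<And>k. smooth (\<lambda>x. v x $ k)"
  shows "norm (v x - v (x - y)) \<le> norm y * (\<integral>s. indicator {0..1} s * norm (jac v (x - s *\<^sub>R y)) \<partial>lborel)"
proof -
  have D: "((\<lambda>s. v (x - s *\<^sub>R y)) has_vector_derivative (jac v (x - s *\<^sub>R y) *v (- y))) (at s within {0..1})" for s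
  proof -
    have "((\<lambda>s. x - s *\<^sub>R y) has_derivative (\<lambda>h. - (h *\<^sub>R y))) (at s within {0..1})"
      by (auto intro!: derivative_eq_intros)
    from has_derivative_compose[OF this has_derivative_jac[OF assms]]
    show ?thesis
      by (simp add: has_vector_derivative_def matrix_vector_mult_scaleR scaleR_minus_right[symmetric] del: scaleR_minus_right)
  qed
  have Jc: "continuous_on {0..1} (\<lambda>s. jac v (x - s *\<^sub>R y))"
    by (rule continuous_on_compose2[OF continuous_jac[OF assms, of UNIV]]) (auto intro!: continuous_intros)
  have Vc: "continuous_on {0..1} (\<lambda>s. jac v (x - s *\<^sub>R y) *v (- y))"
    unfolding matrix_vector_mult_def
    by (intro continuous_on_vec_lambda continuous_intros Jc)
  have i1: "integrable lborel (\<lambda>s. indicator {0..1::real} s *\<^sub>R (jac v (x - s *\<^sub>R y) *v (- y)))"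
    by (rule borel_integrable_compact[OF compact_Icc Vc])
  have i2: "integrable lborel (\<lambda>s. indicator {0..1::real} s *\<^sub>R norm (jac v (x - s *\<^sub>R y)))"
    by (rule borel_integrable_compact[OF compact_Icc]) (intro continuous_intros Jc)
  have "v (x - y) - v x = (\<integral>s. indicator {0..1} s *\<^sub>R (jac v (x - s *\<^sub>R y) *v (- y)) \<partial>lborel)"
    using integral_FTC_atLeastAtMost[OF _ D Vc] by simp
  also have "norm \<dots> \<le> (\<integral>s. norm y * (indicator {0..1} s * norm (jac v (x - s *\<^sub>R y))) \<partial>lborel)"
  proof (rule norm_integral_le[OF i1])
    show "integrable lborel (\<lambda>s. norm y * (indicator {0..1::real} s * norm (jac v (x - s *\<^sub>R y))))"
      using i2 by simp
    show "norm (indicator {0..1} s *\<^sub>R (jac v (x - s *\<^sub>R y) *v (- y)))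
        \<le> norm y * (indicator {0..1} s * norm (jac v (x - s *\<^sub>R y)))" for s :: real
      using norm_matrix_vector_le[of "jac v (x - s *\<^sub>R y)" "- y"]
      by (auto simp: indicator_def mult.commute)
  qed
  finally show ?thesis by (simp add: norm_minus_commute)
qed

text \<open>The constant is independent of $p$, which allows $p \to \infty$ later without Morrey's inequality.\<close>
lemma poincare_mollifier:
  fixes v :: "real^'n::finite \<Rightarrow> real^'m::finite"
  assumes \<eta>: "mollifier \<epsilon> \<eta>" and v: "\<And>k. smooth (\<lambda>x. v x $ k)" "integrable lborel v" and p: "p \<ge> 1"
    and h[measurable]: "h \<in> borel_measurable borel" and h0: "\<And>x. 0 \<le> h x" and hB: "\<And>x. h x \<le> B"
    and N: "\<And>x. x \<in> A \<Longrightarrow> cball x \<epsilon> \<subseteq> N" "\<And>x. x \<in> N \<Longrightarrow> norm (jac v x) \<le> h x" and \<epsilon>: "\<epsilon> > 0"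
  shows "(\<integral>\<^sup>+x. ennreal ((indicator A x * norm (v x - conv \<eta> v x) / \<epsilon>) powr p) \<partial>lborel)
      \<le> (\<integral>\<^sup>+x. ennreal (h x powr p) \<partial>lborel)"
proof -
  \<comment> \<open>Draw y with density \<eta> and s uniformly from [0, 1]; the shift to be averaged
    over is s y.\<close>
  define M1 where "M1 = density lborel (\<lambda>x. ennreal (\<eta> x))"
  define M2 where "M2 = density lborel (\<lambda>s::real. ennreal (indicator {0..1} s))"
  have s12[measurable_cong]: "sets M1 = sets borel" "sets M2 = sets borel" by (auto simp: M1_def M2_def)
  interpret M1: prob_space M1 unfolding M1_def by (rule prob_space_mollifier[OF \<eta>])
  interpret M2: prob_space M2
  proof
    show "emeasure M2 (space M2) = 1"
      unfolding M2_def by (subst emeasure_density) (auto simp: ennreal_indicator)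
  qed
  interpret P: pair_prob_space M1 M2 ..
  define \<tau> :: "(real^'n) \<times> real \<Rightarrow> real^'n" where "\<tau> = (\<lambda>(y, s). s *\<^sub>R y)"
  have \<tau>m[measurable]: "\<tau> \<in> borel_measurable (M1 \<Otimes>\<^sub>M M2)"
    unfolding \<tau>_def by measurable
  have hi: "integrable (M1 \<Otimes>\<^sub>M M2) (\<lambda>w. h (x - \<tau> w))" for x
    using h0 hB by (intro P.P.integrable_const_bound[of _ B]) auto
  have hip: "integrable (M1 \<Otimes>\<^sub>M M2) (\<lambda>w. h (x - \<tau> w) powr p)" for x
    using h0 hB p by (intro P.P.integrable_const_bound[of _ "B powr p"]) (auto intro!: powr_mono2)
  note k = mollifier_kernel[OF \<eta>]
  have \<eta>': "integrable lborel \<eta>" "(\<integral>y. \<eta> y \<partial>lborel) = 1" "\<And>y. 0 \<le> \<eta> y" "\<And>y. norm y > \<epsilon> \<Longrightarrow> \<eta> y = 0"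
    using \<eta> by (auto simp: mollifier_def)
  have [measurable]: "\<eta> \<in> borel_measurable borel" by (rule kernel_borel[OF k])
  \<comment> \<open>The deviation of v from its average is the average of v x - v (x - y). Each
    difference is at most \<epsilon> times the mean of |jac v| over the segment, since |y| \<le>
    \<epsilon> wherever \<eta> is nonzero. What remains is the mean of \<open>h\<close> over the
    random shifts.\<close>
  have pt: "norm (v x - conv \<eta> v x) / \<epsilon> \<le> (\<integral>w. h (x - \<tau> w) \<partial>(M1 \<Otimes>\<^sub>M M2))" if x: "x \<in> A" for x
  proof -
    note c = conv_commute[OF k v(2), of x]
    define H where "H y = (\<integral>s. indicator {0..1} s * h (x - s *\<^sub>R y) \<partial>lborel)" for y
    have Hm[measurable]: "H \<in> borel_measurable borel" unfolding H_def by measurable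
    have hs: "integrable lborel (\<lambda>s. indicator {0..1::real} s * h (x - s *\<^sub>R y))" for y
    proof (rule Bochner_Integration.integrable_bound)
      show "integrable lborel (\<lambda>s::real. B * indicator {0..1} s)" by simp
      show "AE s in lborel. norm (indicator {0..1::real} s * h (x - s *\<^sub>R y)) \<le> norm (B * indicator {0..1} s)"
        using h0 hB by (auto simp: indicator_def intro!: AE_I2 order_trans[OF _ abs_ge_self])
    qed measurable
    have H2: "H y = (\<integral>s. h (x - s *\<^sub>R y) \<partial>M2)" for y
      unfolding H_def M2_def by (subst integral_density) auto
    have "H y \<le> B" "0 \<le> H y" for y
    proof -
      have "integrable lborel (\<lambda>s. B * indicator {0..1::real} s)" by simp
      then have "H y \<le> (\<integral>s. B * indicator {0..1::real} s \<partial>lborel)"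
        unfolding H_def using hB by (intro integral_mono hs) (simp_all split: split_indicator)
      then show "H y \<le> B" by simp
      show "0 \<le> H y" unfolding H_def using h0 by (intro Bochner_Integration.integral_nonneg) auto
    qed
    then have Hi: "integrable lborel (\<lambda>y. \<eta> y * H y)"
      using integrable_bounded_scaleR[OF \<eta>'(1), of H B] by (auto simp: mult.commute abs_of_nonneg)
    have "v x - conv \<eta> v x = (\<integral>y. \<eta> y *\<^sub>R v x - \<eta> y *\<^sub>R v (x - y) \<partial>lborel)"
      using c \<eta>' by (subst Bochner_Integration.integral_diff) auto
    also have "norm \<dots> \<le> (\<integral>y. \<epsilon> * (\<eta> y * H y) \<partial>lborel)"
    proof (rule norm_integral_le)
      show "integrable lborel (\<lambda>y. \<eta> y *\<^sub>R v x - \<eta> y *\<^sub>R v (x - y))" using c \<eta>' by auto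
      show "integrable lborel (\<lambda>y. \<epsilon> * (\<eta> y * H y))" using Hi by simp
      fix y
      show "norm (\<eta> y *\<^sub>R v x - \<eta> y *\<^sub>R v (x - y)) \<le> \<epsilon> * (\<eta> y * H y)"
      proof (cases "norm y > \<epsilon>")
        case False
        have "(\<integral>s. indicator {0..1} s * norm (jac v (x - s *\<^sub>R y)) \<partial>lborel) \<le> H y"
          unfolding H_def
        proof (rule integral_mono[OF _ hs])
          have "continuous_on {0..1} (\<lambda>s::real. norm (jac v (x - s *\<^sub>R y)))"
            by (intro continuous_on_norm continuous_on_compose2[OF continuous_jac[OF v(1), of UNIV]])
              (auto intro!: continuous_intros)
          from borel_integrable_compact[OF compact_Icc this]
          show "integrable lborel (\<lambda>s. indicator {0..1::real} s * norm (jac v (x - s *\<^sub>R y)))" by simp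
          fix s :: real
          show "indicator {0..1} s * norm (jac v (x - s *\<^sub>R y)) \<le> indicator {0..1} s * h (x - s *\<^sub>R y)"
          proof (cases "s \<in> {0..1}")
            case True
            then have "s * norm y \<le> 1 * \<epsilon>" using False by (intro mult_mono) auto
            then have "x - s *\<^sub>R y \<in> N" using True N(1)[OF x] by (auto simp: dist_norm subset_iff)
            then show ?thesis using N(2) by (auto simp: indicator_def)
          qed simp
        qed
        then have "norm (v x - v (x - y)) \<le> \<epsilon> * H y"
          using segment_bound[OF v(1), of x y] False \<epsilon> \<open>\<And>y. 0 \<le> H y\<close>[of y]
          by (meson order_trans mult_mono not_less norm_ge_zero mult_left_mono mult_right_mono)
        then show ?thesis
          using mult_left_mono[OF _ \<eta>'(3)[of y], of "norm (v x - v (x - y))" "\<epsilon> * H y"] \<eta>'(3)[of y]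
          by (simp add: scaleR_diff_right[symmetric] mult.left_commute[of \<epsilon>])
      qed (simp add: \<eta>')
    qed
    also have "\<dots> = \<epsilon> * (\<integral>y. H y \<partial>M1)"
      unfolding M1_def by (subst integral_mollifier(1)[OF \<eta>]) auto
    also have "(\<integral>y. H y \<partial>M1) = (\<integral>y. \<integral>s. h (x - \<tau> (y, s)) \<partial>M2 \<partial>M1)"
      by (simp add: H2 \<tau>_def)
    also have "\<dots> = (\<integral>w. h (x - \<tau> w) \<partial>(M1 \<Otimes>\<^sub>M M2))"
      by (rule P.integral_fst'[OF hi])
    finally show ?thesis using \<epsilon> by (simp add: divide_le_eq mult.commute)
  qed
  have "(\<integral>\<^sup>+x. ennreal ((indicator A x * norm (v x - conv \<eta> v x) / \<epsilon>) powr p) \<partial>lborel)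
      \<le> (\<integral>\<^sup>+x. ennreal ((\<integral>w. h (x - \<tau> w) \<partial>(M1 \<Otimes>\<^sub>M M2)) powr p) \<partial>lborel)"
  proof (intro nn_integral_mono ennreal_leI)
    fix x
    show "(indicator A x * norm (v x - conv \<eta> v x) / \<epsilon>) powr p \<le> (\<integral>w. h (x - \<tau> w) \<partial>(M1 \<Otimes>\<^sub>M M2)) powr p"
    proof (cases "x \<in> A")
      case True
      then show ?thesis using pt[OF True] p \<epsilon> by (intro powr_mono2) auto
    qed simp
  qed
  also have "\<dots> \<le> (\<integral>\<^sup>+x. ennreal (h x powr p) \<partial>lborel)"
    by (rule average_contraction[OF P.P.prob_space_axioms \<tau>m h h0 p hi hip])
  finally show ?thesis .
qed

subsection \<open>Weak convergence of mollified gradients\<close>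

lemma young_eps:
  assumes p: "p > 1" and \<mu>: "\<mu> > (0::real)"
  obtains C where "C \<ge> 0" "\<And>a b. a \<ge> 0 \<Longrightarrow> b \<ge> 0 \<Longrightarrow> a powr (p - 1) * b \<le> C * a powr p + \<mu> * b powr p"
proof -
  \<comment> \<open>Scaling a by n and b by m with n^(p-1) m = 1 leaves the left side unchanged,
    while m^p = \<mu> puts the prescribed weight on b^p.\<close>
  define m where "m = \<mu> powr (1 / p)"
  define n where "n = m powr (- 1 / (p - 1))"
  have m: "m > 0" "m powr p = \<mu>" and n: "n > 0" using p \<mu> by (auto simp: m_def n_def powr_powr)
  have nm: "n powr (p - 1) * m = 1" 
  proof -
    have "n powr (p - 1) = m powr (- 1)" unfolding n_def powr_powr using p by simp
    then show ?thesis using m(1) by (simp add: powr_minus)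
  qed
  have "a powr (p - 1) * b \<le> n powr p * a powr p + \<mu> * b powr p" if "a \<ge> 0" "b \<ge> 0" for a b
  proof -
    have "a powr (p - 1) * b = (n * a) powr (p - 1) * (m * b)"
      using that n nm by (simp add: powr_mult)
    also have "\<dots> \<le> (1 - 1 / p) * (n * a) powr p + (m * b) powr p / p"
      using young[OF p, of "n * a" "m * b"] that n m by simp
    also have "\<dots> \<le> 1 * (n * a) powr p + (m * b) powr p / 1"
      using p by (intro add_mono mult_right_mono divide_left_mono) auto
    also have "\<dots> = n powr p * a powr p + \<mu> * b powr p"
      using that n m by (simp add: powr_mult)
    finally show ?thesis .
  qed
  then show ?thesis using that[of "n powr p"] by auto
qed

text \<open>Mollifications of \<open>G\<close> converge in L1 and stay bounded in L^p. Where |G|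
  \<le> k the field \<open>f\<close> is bounded, so L1 convergence suffices; where |G| > k the tail
  of the integral of |G|^p is small, and the weighted Young inequality reduces everything to that
  tail and to small multiples of L^p bounds.\<close>

lemma mollify_weak:
  fixes G :: "real^'n::finite \<Rightarrow> 'b::euclidean_space"
  assumes G: "integrable lborel G" "\<And>x. norm x > R \<Longrightarrow> G x = 0" and R: "R > 0" and p: "p > 1"
    and Gp: "integrable lborel (\<lambda>x. norm (G x) powr p)"
    and f[measurable]: "f \<in> borel_measurable borel" and fG: "\<And>x. norm (f x) \<le> norm (G x) powr (p - 1)"
    and e: "e > 0"
  obtains d where "d > 0" "\<And>\<delta> \<eta>. \<delta> < d \<Longrightarrow> mollifier \<delta> \<eta> \<Longrightarrow>
    \<bar>(\<integral>x. f x \<bullet> conv \<eta> G x \<partial>lborel) - (\<integral>x. f x \<bullet> G x \<partial>lborel)\<bar> \<le> e"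
proof -
  have [measurable]: "G \<in> borel_measurable borel" using G(1) by simp
  define I where "I = (\<integral>x. norm (G x) powr p \<partial>lborel)"
  have I: "I \<ge> 0" by (simp add: I_def)
  define \<mu> where "\<mu> = e / (6 * (I + 1))"
  have \<mu>: "\<mu> > 0" "\<mu> * I \<le> e / 6" using e I by (auto simp: \<mu>_def field_simps)
  obtain C where C: "C \<ge> 0" "\<And>a b. a \<ge> 0 \<Longrightarrow> b \<ge> 0 \<Longrightarrow> a powr (p - 1) * b \<le> C * a powr p + \<mu> * b powr p"
    using young_eps[OF p \<mu>(1)] by blast
  define E where "E = (\<lambda>k::nat. {x. norm (G x) > real k})"
  have [measurable]: "E k \<in> sets borel" for k unfolding E_def by measurable
  have Ei: "integrable lborel (\<lambda>x. indicator (E k) x * norm (G x) powr p)" for k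
    by (rule Bochner_Integration.integrable_bound[OF Gp]) (auto simp: indicator_def)
  have "(\<lambda>k. \<integral>x. indicator (E k) x * norm (G x) powr p \<partial>lborel) \<longlonglongrightarrow> (\<integral>(x::real^'n). 0 \<partial>lborel)"
  proof (rule integral_dominated_convergence[where w = "\<lambda>x. norm (G x) powr p"])
    show "AE x in lborel. (\<lambda>k. indicator (E k) x * norm (G x) powr p) \<longlonglongrightarrow> 0"
    proof (intro AE_I2 tendsto_eventually)
      fix x
      obtain k0 :: nat where "norm (G x) < real k0" using reals_Archimedean2 by blast
      then have "\<forall>k\<ge>k0. indicator (E k) x * norm (G x) powr p = 0" by (auto simp: E_def indicator_def)
      then show "\<forall>\<^sub>F k in sequentially. indicator (E k) x * norm (G x) powr p = 0"
        by (auto simp: eventually_sequentially)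
    qed
  qed (use Gp in \<open>auto simp: indicator_def\<close>)
  then have "\<forall>\<^sub>F k in sequentially. (\<integral>x. indicator (E k) x * norm (G x) powr p \<partial>lborel) < e / (6 * (C + 1))"
    using e C(1) by (intro order_tendstoD(2)[of _ "\<integral>(x::real^'n). 0 \<partial>lborel"]) auto
  then obtain k where k: "(\<integral>x. indicator (E k) x * norm (G x) powr p \<partial>lborel) < e / (6 * (C + 1))"
    by (auto simp: eventually_sequentially)
  define J where "J = (\<integral>x. indicator (E k) x * norm (G x) powr p \<partial>lborel)"
  have J0: "J \<ge> 0" unfolding J_def by (intro Bochner_Integration.integral_nonneg) auto
  have J: "C * J \<le> e / 6"
  proof -
    have "C * J \<le> (C + 1) * (e / (6 * (C + 1)))"
      using k J0 C(1) unfolding J_def by (intro mult_mono) auto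
    also have "\<dots> = e / 6" using C(1) by (simp add: divide_simps)
    finally show ?thesis .
  qed
  define D where "D = real k powr (p - 1) + 1"
  have D: "D > 0" by (simp add: D_def add_nonneg_pos)
  obtain d where d: "d > 0"
    "\<And>\<delta> \<eta>. \<delta> < d \<Longrightarrow> mollifier \<delta> \<eta> \<Longrightarrow> (\<integral>x. norm (conv \<eta> G x - G x) \<partial>lborel) < e / (3 * D)"
    using mollify_L1[OF G R, of "e / (3 * D)"] e D by auto
  have "\<bar>(\<integral>x. f x \<bullet> conv \<eta> G x \<partial>lborel) - (\<integral>x. f x \<bullet> G x \<partial>lborel)\<bar> \<le> e"
    if \<delta>: "\<delta> < d" and \<eta>: "mollifier \<delta> \<eta>" for \<delta> \<eta>
  proof -
    have [measurable]: "conv \<eta> G \<in> borel_measurable borel"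
      by (rule borel_measurable_conv[OF mollifier_kernel[OF \<eta>] G(1)])
    note cp = conv_powr_le[OF \<eta> G(1) _ Gp] and c1 = conv_L1_le[OF \<eta> G(1)]
    have cpi: "integrable lborel (\<lambda>x. norm (conv \<eta> G x) powr p)"
      and cpl: "(\<integral>x. norm (conv \<eta> G x) powr p \<partial>lborel) \<le> I"
      using cp p by (auto simp: I_def)
    have fi: "integrable lborel (\<lambda>x. f x \<bullet> g x)"
      if [measurable]: "g \<in> borel_measurable borel" and gp: "integrable lborel (\<lambda>x. norm (g x) powr p)"
      for g :: "real^'n \<Rightarrow> 'b"
    proof (rule Bochner_Integration.integrable_bound)
      show "integrable lborel (\<lambda>x. C * norm (G x) powr p + \<mu> * norm (g x) powr p)"
        using Gp gp by auto
      show "AE x in lborel. norm (f x \<bullet> g x) \<le> norm (C * norm (G x) powr p + \<mu> * norm (g x) powr p)"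
      proof (rule AE_I2)
        fix x
        have "norm (f x \<bullet> g x) \<le> norm (f x) * norm (g x)" by (simp add: Cauchy_Schwarz_ineq2)
        also have "\<dots> \<le> norm (G x) powr (p - 1) * norm (g x)" using fG by (intro mult_right_mono) auto
        also have "\<dots> \<le> C * norm (G x) powr p + \<mu> * norm (g x) powr p" by (rule C) auto
        finally show "norm (f x \<bullet> g x) \<le> norm (C * norm (G x) powr p + \<mu> * norm (g x) powr p)"
          by (simp add: order_trans[OF _ abs_ge_self])
      qed
    qed measurable
    \<comment> \<open>The first term covers |G| \<le> k, the others |G| > k. Integrated, they
      contribute at most e/3, e/3, e/6 and e/6.\<close>
    let ?b = "\<lambda>x. D * norm (conv \<eta> G x - G x) + (2 * C * (indicator (E k) x * norm (G x) powr p)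
        + \<mu> * norm (conv \<eta> G x) powr p + \<mu> * norm (G x) powr p)"
    have pt: "norm (f x \<bullet> conv \<eta> G x - f x \<bullet> G x) \<le> ?b x" for x
    proof -
      have fb: "norm (f x \<bullet> conv \<eta> G x - f x \<bullet> G x) \<le> norm (G x) powr (p - 1) * norm (conv \<eta> G x - G x)"
        using Cauchy_Schwarz_ineq2[of "f x" "conv \<eta> G x - G x"] fG[of x]
        by (smt (verit) inner_diff_right mult_right_mono norm_ge_zero real_norm_def)
      show ?thesis
      proof (cases "x \<in> E k")
        case False
        then have "norm (G x) powr (p - 1) \<le> real k powr (p - 1)"
          using p by (intro powr_mono2) (auto simp: E_def)
        then have "norm (G x) powr (p - 1) * norm (conv \<eta> G x - G x) \<le> D * norm (conv \<eta> G x - G x)"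
          unfolding D_def by (intro mult_right_mono) auto
        moreover have "0 \<le> \<mu> * norm (conv \<eta> G x) powr p + \<mu> * norm (G x) powr p"
          using \<mu>(1) by simp
        ultimately show ?thesis using fb False by simp
      next
        case True
        have "norm (G x) powr (p - 1) * norm (conv \<eta> G x - G x)
            \<le> norm (G x) powr (p - 1) * (norm (conv \<eta> G x) + norm (G x))"
          by (intro mult_left_mono norm_triangle_ineq4) auto
        also have "\<dots> \<le> (C * norm (G x) powr p + \<mu> * norm (conv \<eta> G x) powr p)
            + (C * norm (G x) powr p + \<mu> * norm (G x) powr p)"
          unfolding distrib_left by (intro add_mono C) auto
        finally show ?thesis
          using fb True D by (simp add: add_increasing)
      qed
    qed
    have bi: "integrable lborel ?b"
      using c1(1) G(1) Ei[of k] cpi Gp by auto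
    have "\<bar>(\<integral>x. f x \<bullet> conv \<eta> G x \<partial>lborel) - (\<integral>x. f x \<bullet> G x \<partial>lborel)\<bar>
        = norm (\<integral>x. f x \<bullet> conv \<eta> G x - f x \<bullet> G x \<partial>lborel)"
      using fi[OF _ cpi] fi[OF _ Gp] by simp
    also have "\<dots> \<le> (\<integral>x. ?b x \<partial>lborel)"
      by (rule norm_integral_le[OF _ bi pt]) (use fi[OF _ cpi] fi[OF _ Gp] in simp)
    also have "\<dots> = D * (\<integral>x. norm (conv \<eta> G x - G x) \<partial>lborel) + (2 * C * J
        + \<mu> * (\<integral>x. norm (conv \<eta> G x) powr p \<partial>lborel) + \<mu> * I)"
      using c1(1) G(1) Ei[of k] cpi Gp by (simp add: J_def I_def)
    also have "\<dots> \<le> D * (e / (3 * D)) + (2 * (C * J) + \<mu> * I + \<mu> * I)"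
      using d(2)[OF \<delta> \<eta>] D \<mu>(1) cpl by (intro add_mono mult_left_mono) auto
    also have "\<dots> \<le> e / 3 + (2 * (e / 6) + e / 6 + e / 6)"
      using D J \<mu>(2) by (intro add_mono mult_left_mono) auto
    also have "\<dots> = e" by simp
    finally show ?thesis .
  qed
  with d(1) that show ?thesis by blast
qed

subsection \<open>The energy estimate for a single exponent\<close>

lemma powr_mult_self: "a \<ge> 0 \<Longrightarrow> a powr (p - 1) * a = a powr p" for a :: real
  by (cases "a = 0") (auto simp: powr_diff)

lemma powr_minus2_mult: "a \<ge> 0 \<Longrightarrow> a powr (p - 2) * a = a powr (p - 1)" for a :: real
  using powr_mult_self[of a "p - 1"] by simp

lemma powr_mult_le_add:
  assumes "p > 1" "a \<ge> 0" "b \<ge> (0::real)"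
  shows "a powr (p - 1) * b \<le> a powr p + b powr p"
proof -
  have "(1 - 1 / p) * a powr p \<le> 1 * a powr p" "1 / p * b powr p \<le> 1 * b powr p"
    using assms by (intro mult_right_mono; simp)+
  with young[OF assms] show ?thesis by simp
qed

text \<open>
  The Euler-Lagrange equation is tested with $\zeta (v - \Psi)$, where $v$ is a fine mollification
  of $w$ (so that the test function is smooth) and $\Psi$ is close to a coarse one.
\<close>
lemma energy_estimate:
  fixes w :: "real^'n::finite \<Rightarrow> real^'m::finite"
  assumes \<Omega>: "open \<Omega>" "bounded \<Omega>" and V: "V = measure lborel \<Omega>"
    and wG: "wgrad \<Omega> w G" and w0: "\<And>x. x \<notin> \<Omega> \<Longrightarrow> w x = 0" and G0: "\<And>x. x \<notin> \<Omega> \<Longrightarrow> G x = 0"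
    and p: "p > 2" and Gp: "integrable lborel (\<lambda>x. norm (G x) powr p)"
    and GV: "(\<integral>x. norm (G x) powr p \<partial>lborel) = V"
    and EL: "\<And>\<psi>. test_vec \<Omega> \<psi> \<Longrightarrow> (\<integral>x. norm (G x) powr (p - 2) * (G x \<bullet> jac \<psi> x) \<partial>lborel) = 0"
    and \<zeta>: "test_fn \<Omega> \<zeta>" "\<And>x. 0 \<le> \<zeta> x" "\<And>x. \<zeta> x \<le> 1" and Z: "\<And>x. norm (grad \<zeta> x) \<le> Z"
    and \<epsilon>: "\<epsilon> > 0" "\<And>x. x \<in> supp \<zeta> \<Longrightarrow> cball x (2 * \<epsilon>) \<subseteq> \<Omega>" and \<eta>: "mollifier \<epsilon> \<eta>"
    and \<Psi>: "\<And>k. smooth (\<lambda>x. \<Psi> x $ k)"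
    and s: "s \<ge> 0" "\<And>x. x \<in> supp \<zeta> \<Longrightarrow> norm (conv \<eta> w x - \<Psi> x) \<le> s"
    and \<phi>: "\<phi> \<in> borel_measurable borel" "\<And>x. norm (\<phi> x) \<le> \<zeta> x"
  shows "(\<integral>x. norm (G x) powr (p - 2) * (G x \<bullet> \<phi> x) \<partial>lborel)
    \<le> (\<integral>x. norm (G x) powr (p - 2) * (G x \<bullet> (\<zeta> x *\<^sub>R jac \<Psi> x)) \<partial>lborel) + V / p + Z * V * (2 * \<epsilon> + 2 * s)"
proof -
  have wi: "integrable lborel w" and Gi: "integrable lborel G" using wG by (auto simp: wgrad_def)
  have [measurable]: "G \<in> borel_measurable borel" "w \<in> borel_measurable borel" using wi Gi by auto
  have \<zeta>s: "smooth \<zeta>" and \<zeta>\<Omega>: "supp \<zeta> \<subseteq> \<Omega>" and \<zeta>c: "compact (supp \<zeta>)"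
    using \<zeta>(1) by (auto simp: test_fn_def)
  have [measurable]: "\<zeta> \<in> borel_measurable borel" by (rule smooth_borel[OF \<zeta>s])
  have \<zeta>z: "\<zeta> x = 0" if "x \<notin> supp \<zeta>" for x using not_in_supp[OF that] .
  have [measurable]: "\<Omega> \<in> sets borel" "supp \<zeta> \<in> sets borel" using \<Omega>(1) by auto
  obtain R where R: "R > 0" "\<And>x. x \<in> \<Omega> \<Longrightarrow> norm x \<le> R"
    using \<Omega>(2) by (auto simp: bounded_pos)
  have wR: "w x = 0" and GR: "G x = 0" if "norm x > R" for x
    using R(2)[of x] that w0[of x] G0[of x] by auto
  have V0: "V \<ge> 0" by (simp add: V)
  have Z0: "Z \<ge> 0" using Z[of 0] norm_ge_zero order_trans by blast
  have emO: "emeasure lborel \<Omega> < \<infinity>" by (rule emeasure_bounded_finite[OF \<Omega>(2)])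
  have iO: "integrable lborel (indicator \<Omega> :: _ \<Rightarrow> real)"
    using emO by (intro integrable_real_indicator) auto
  have IO: "(\<integral>x. indicator \<Omega> x \<partial>lborel) = V" by (simp add: V)
  have G1: "norm (G x) powr (p - 1) \<le> norm (G x) powr p + indicator \<Omega> x" for x
    using powr_mult_le_add[of p "norm (G x)" 1] p G0[of x] by (cases "x \<in> \<Omega>") auto
  have G1i: "integrable lborel (\<lambda>x. norm (G x) powr (p - 1))"
  proof (rule Bochner_Integration.integrable_bound)
    show "integrable lborel (\<lambda>x. norm (G x) powr p + indicator \<Omega> x)" using Gp iO by auto
    show "AE x in lborel. norm (norm (G x) powr (p - 1)) \<le> norm (norm (G x) powr p + indicator \<Omega> x :: real)"
      using G1 by (auto simp: abs_of_nonneg)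
  qed measurable
  define r where "r x = norm (G x) powr (p - 2)" for x
  have [measurable]: "r \<in> borel_measurable borel" unfolding r_def by measurable
  have r0: "r x \<ge> 0" for x by (simp add: r_def)
  have rG: "r x * norm (G x) = norm (G x) powr (p - 1)" for x
    unfolding r_def by (rule powr_minus2_mult) simp
  have rGG: "r x * (G x \<bullet> G x) = norm (G x) powr p" for x
    using rG[of x] powr_mult_self[of "norm (G x)" p]
    by (simp add: power2_norm_eq_inner[symmetric] power2_eq_square mult.assoc[symmetric])
  have rle: "\<bar>r x * (G x \<bullet> A)\<bar> \<le> norm (G x) powr (p - 1) * norm A" for x A
    using mult_left_mono[OF Cauchy_Schwarz_ineq2[of "G x" A] r0[of x]] r0[of x] rG[of x]
    by (simp add: abs_mult mult.assoc[symmetric])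
  have ri: "integrable lborel (\<lambda>x. r x * (G x \<bullet> g x))"
    if "g \<in> borel_measurable borel" "\<And>x. norm (g x) \<le> C" for g C
  proof (rule Bochner_Integration.integrable_bound)
    show "integrable lborel (\<lambda>x. norm (G x) powr (p - 1) * C)" using G1i by simp
    show "(\<lambda>x. r x * (G x \<bullet> g x)) \<in> borel_measurable lborel" using that(1) by measurable
    have "norm (r x * (G x \<bullet> g x)) \<le> norm (G x) powr (p - 1) * C" for x
      using rle[of x "g x"] mult_left_mono[OF that(2)[of x], of "norm (G x) powr (p - 1)"] by simp
    then show "AE x in lborel. norm (r x * (G x \<bullet> g x)) \<le> norm (norm (G x) powr (p - 1) * C)"
      by (auto intro: order_trans[OF _ abs_ge_self])
  qed
  have \<zeta>Gp: "integrable lborel (\<lambda>x. \<zeta> x * norm (G x) powr p)"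
    using integrable_bounded_scaleR[OF Gp, of \<zeta> 1] \<zeta> by auto
  \<comment> \<open>Young against the constant 1 gives t^(p-1) \<le> (1 - 1/p) t^p + 1/p, and the
    loss integrates to at most V/p.\<close>
  have step1: "(\<integral>x. r x * (G x \<bullet> \<phi> x) \<partial>lborel) \<le> (\<integral>x. \<zeta> x * norm (G x) powr p \<partial>lborel) + V / p"
  proof -
    have "(\<integral>x. r x * (G x \<bullet> \<phi> x) \<partial>lborel) \<le> (\<integral>x. \<zeta> x * norm (G x) powr p + indicator \<Omega> x / p \<partial>lborel)"
    proof (rule integral_mono)
      show "integrable lborel (\<lambda>x. r x * (G x \<bullet> \<phi> x))"
        using \<phi>(2) \<zeta>(3) by (intro ri[OF \<phi>(1), of 1]) (meson order_trans)
      show "integrable lborel (\<lambda>x. \<zeta> x * norm (G x) powr p + indicator \<Omega> x / p)"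
        using \<zeta>Gp iO by auto
      fix x
      have "r x * (G x \<bullet> \<phi> x) \<le> norm (G x) powr (p - 1) * \<zeta> x"
        using rle[of x "\<phi> x"] mult_left_mono[OF \<phi>(2)[of x], of "norm (G x) powr (p - 1)"] by simp
      also have "\<dots> \<le> ((1 - 1 / p) * norm (G x) powr p + indicator \<Omega> x / p) * \<zeta> x"
        using young[of p "norm (G x)" 1] p G0[of x] \<zeta>(2)[of x]
        by (intro mult_right_mono) (auto simp: indicator_def)
      also have "\<dots> \<le> (norm (G x) powr p + indicator \<Omega> x / p) * \<zeta> x"
        using p \<zeta>(2)[of x] by (intro mult_right_mono add_mono mult_left_le_one_le) auto
      also have "\<dots> \<le> \<zeta> x * norm (G x) powr p + indicator \<Omega> x / p"
        using p \<zeta>(2,3)[of x] by (auto simp: distrib_right mult.commute mult_left_le indicator_def field_simps)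
      finally show "r x * (G x \<bullet> \<phi> x) \<le> \<zeta> x * norm (G x) powr p + indicator \<Omega> x / p" .
    qed
    also have "\<dots> = (\<integral>x. \<zeta> x * norm (G x) powr p \<partial>lborel) + V / p"
      using \<zeta>Gp iO by (simp add: V)
    finally show ?thesis .
  qed
  note k = mollifier_kernel[OF \<eta>]
  obtain B where B: "B > 0" "\<And>x. \<bar>\<eta> x\<bar> \<le> B" using kernel_bounded[OF k] by blast
  let ?L = "\<integral>x. r x * (G x \<bullet> (\<zeta> x *\<^sub>R jac \<Psi> x)) \<partial>lborel"
  \<comment> \<open>The slack \<kappa> pays for the fine mollification at scale \<delta> and is
    removed at the end by \<open>field_le_epsilon\<close>.\<close>
  have step2: "(\<integral>x. \<zeta> x * norm (G x) powr p \<partial>lborel) \<le> ?L + Z * V * (2 * \<epsilon> + 2 * s) + \<kappa>" if \<kappa>: "\<kappa> > 0" for \<kappa>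
  proof -
    define \<kappa>1 where "\<kappa>1 = \<kappa> / (4 * (Z * V + 1))"
    have ZV: "Z * V \<ge> 0" using Z0 V0 by simp
    have \<kappa>1: "\<kappa>1 > 0" "2 * (Z * V) * \<kappa>1 \<le> \<kappa> / 2"
      using \<kappa> ZV by (auto simp: \<kappa>1_def field_simps add_pos_nonneg)
    \<comment> \<open>With this field, f . G is \<zeta> |G|^p, while f . conv \<theta> G is the
      leading term of the tested equation; \<open>mollify_weak\<close> compares the two.\<close>
    define f where "f x = (r x * \<zeta> x) *\<^sub>R G x" for x
    have fm: "f \<in> borel_measurable borel" unfolding f_def by measurable
    have fG: "norm (f x) \<le> norm (G x) powr (p - 1)" for x
    proof -
      have "norm (f x) = \<zeta> x * norm (G x) powr (p - 1)"
        using r0[of x] \<zeta>(2)[of x] rG[of x] by (simp add: f_def abs_mult ac_simps)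
      then show ?thesis using \<zeta>(2,3)[of x] by (simp add: mult_left_le_one_le)
    qed
    obtain d1 where d1: "d1 > 0" "\<And>\<delta> \<theta>. \<delta> < d1 \<Longrightarrow> mollifier \<delta> \<theta> \<Longrightarrow>
        \<bar>(\<integral>x. f x \<bullet> conv \<theta> G x \<partial>lborel) - (\<integral>x. f x \<bullet> G x \<partial>lborel)\<bar> \<le> \<kappa> / 2"
      using mollify_weak[OF Gi GR R(1) _ Gp fm fG, of "\<kappa> / 2"] p \<kappa> by auto
    \<comment> \<open>The coarse kernel is bounded by B, so L1 distance \<kappa>1 / B between
      \<open>v\<close> and \<open>w\<close> makes their coarse mollifications uniformly
      \<kappa>1-close.\<close>
    obtain d2 where d2: "d2 > 0" "\<And>\<delta> \<theta>. \<delta> < d2 \<Longrightarrow> mollifier \<delta> \<theta> \<Longrightarrow>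
        (\<integral>x. norm (conv \<theta> w x - w x) \<partial>lborel) < \<kappa>1 / B"
      using mollify_L1[OF wi wR R(1), of "\<kappa>1 / B"] \<kappa>1(1) B(1) by auto
    define \<delta> where "\<delta> = min (min d1 d2) \<epsilon> / 2"
    have \<delta>: "\<delta> > 0" "\<delta> < d1" "\<delta> < d2" "\<delta> < \<epsilon>" using d1(1) d2(1) \<epsilon>(1) by (auto simp: \<delta>_def)
    obtain \<theta> :: "real^'n \<Rightarrow> real" where \<theta>: "mollifier \<delta> \<theta>" using ex_mollifier[OF \<delta>(1)] by blast
    note k' = mollifier_kernel[OF \<theta>]
    define v where "v = conv \<theta> w"
    have vs: "smooth (\<lambda>x. v x $ k)" for k unfolding v_def by (rule smooth_conv_nth[OF k' wi])
    have vi: "integrable lborel v" unfolding v_def by (rule conv_L1_le(1)[OF \<theta> wi])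
    have vm[measurable]: "v \<in> borel_measurable borel" using vi by simp
    \<comment> \<open>On this set jac v = conv \<theta> G, because \<delta> < \<epsilon>. The margin
      2 \<epsilon> around supp \<zeta> places whole \<epsilon>-balls inside it, as the Poincare
      estimate requires.\<close>
    define N where "N = {x. cball x \<epsilon> \<subseteq> \<Omega>}"
    have jv: "jac v x = conv \<theta> G x" if "x \<in> N" for x
      unfolding v_def using that \<delta>(4) by (intro jac_conv[OF k' wG]) (auto simp: N_def subset_iff)
    have suppN: "cball x \<epsilon> \<subseteq> N" if "x \<in> supp \<zeta>" for x
    proof
      fix y assume y: "y \<in> cball x \<epsilon>"
      have "cball y \<epsilon> \<subseteq> cball x (2 * \<epsilon>)"
        using y by (intro cball_subset_cball_iff[THEN iffD2] disjI1) (auto simp: dist_commute)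
      then show "y \<in> N" using \<epsilon>(2)[OF that] by (auto simp: N_def)
    qed
    have supp_N: "supp \<zeta> \<subseteq> N" using suppN \<epsilon>(1) by (meson centre_in_cball less_imp_le subset_iff)
    let ?A = "supp \<zeta>"
    \<comment> \<open>The deviation of \<open>v\<close> from its coarse mollification, divided by
      \<epsilon>: the Poincare estimate and the L^p contraction of \<open>conv\<close> bound the
      integral of its p-th power by V.\<close>
    define b where "b x = indicator ?A x * norm (v x - conv \<eta> v x) / \<epsilon>" for x
    have [measurable]: "conv \<eta> v \<in> borel_measurable borel" "conv \<theta> G \<in> borel_measurable borel"
      by (rule borel_measurable_conv[OF k vi], rule borel_measurable_conv[OF k' Gi])
    have bm[measurable]: "b \<in> borel_measurable borel" unfolding b_def by measurable
    have b0: "b x \<ge> 0" for x unfolding b_def using \<epsilon>(1) by simp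
    have bi: "integrable lborel (\<lambda>x. b x powr p)" and bV: "(\<integral>x. b x powr p \<partial>lborel) \<le> V"
    proof -
      have "continuous_on UNIV (conv \<theta> G)" by (rule continuous_conv_mat[OF k' Gi])
      moreover have cz: "conv \<theta> G x = 0" if "norm x > R + \<delta>" for x
      proof -
        have "\<theta> (x - y) *\<^sub>R G y = 0" for y
        proof (cases "norm y > R")
          case False
          then have "norm (x - y) > \<delta>" using that norm_triangle_ineq2[of x y] by auto
          then show ?thesis using \<theta> by (simp add: mollifier_def)
        qed (simp add: GR)
        then show ?thesis unfolding conv_def by (simp only: Bochner_Integration.integral_zero)
      qed
      ultimately obtain C where C: "\<And>x. norm (conv \<theta> G x) \<le> C"
        using bounded_support_bounded[of "conv \<theta> G" "R + \<delta>"] by blast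
      have "(\<integral>\<^sup>+x. ennreal (b x powr p) \<partial>lborel) \<le> (\<integral>\<^sup>+x. ennreal (norm (conv \<theta> G x) powr p) \<partial>lborel)"
        unfolding b_def
        by (rule poincare_mollifier[OF \<eta> vs vi _ _ _ C, where N = N])
          (use p suppN jv \<epsilon>(1) in auto)
      also have "\<dots> = ennreal (\<integral>x. norm (conv \<theta> G x) powr p \<partial>lborel)"
        using conv_powr_le(1)[OF \<theta> Gi _ Gp] p by (intro nn_integral_eq_integral) auto
      also have "\<dots> \<le> ennreal V"
        using conv_powr_le(2)[OF \<theta> Gi _ Gp] p GV by (intro ennreal_leI) auto
      finally have le: "(\<integral>\<^sup>+x. ennreal (b x powr p) \<partial>lborel) \<le> ennreal V" .
      show i: "integrable lborel (\<lambda>x. b x powr p)"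
        using le_less_trans[OF le ennreal_less_top] by (intro integrableI_bounded) auto
      show "(\<integral>x. b x powr p \<partial>lborel) \<le> V"
        using le nn_integral_eq_integral[OF i] V0 by (simp add: ennreal_le_iff)
    qed
    have vw: "norm (conv \<eta> v x - conv \<eta> w x) \<le> \<kappa>1" for x
    proof -
      have "norm (conv \<eta> v x - conv \<eta> w x) = norm (\<integral>y. \<eta> (x - y) *\<^sub>R (v y - w y) \<partial>lborel)"
        using conv_diff[OF k vi wi, of x] by (simp add: conv_def)
      also have "\<dots> \<le> (\<integral>y. B * norm (v y - w y) \<partial>lborel)"
      proof (rule norm_integral_le)
        show "integrable lborel (\<lambda>y. \<eta> (x - y) *\<^sub>R (v y - w y))"
          by (rule integrable_conv[OF k]) (use vi wi in auto)
        show "norm (\<eta> (x - y) *\<^sub>R (v y - w y)) \<le> B * norm (v y - w y)" for y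
          using B(2)[of "x - y"] by (simp add: mult_right_mono)
      qed (use vi wi in auto)
      also have "\<dots> = B * (\<integral>y. norm (v y - w y) \<partial>lborel)" by simp
      also have "\<dots> \<le> B * (\<kappa>1 / B)"
        using d2(2)[OF \<delta>(3) \<theta>] B(1) unfolding v_def[symmetric] by (intro mult_left_mono) auto
      finally show ?thesis using B(1) by simp
    qed
    \<comment> \<open>The error term of the product rule, where \<zeta> is differentiated. Up to the
      factor Z it splits into the Poincare part \<epsilon> b and the uniform part \<kappa>1 +
      s.\<close>
    define q where "q x = outer (v x - \<Psi> x) (grad \<zeta> x)" for x
    have grad0: "grad \<zeta> x = 0" if "x \<notin> ?A" for x
      using pd_not_in_supp[OF that] by (simp add: grad_def vec_eq_iff)
    have qle: "norm (q x) \<le> Z * (\<epsilon> * b x + (\<kappa>1 + s) * indicator ?A x)" for x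
    proof (cases "x \<in> ?A")
      case True
      have "norm (v x - \<Psi> x) \<le> norm (v x - conv \<eta> v x) + norm (conv \<eta> v x - conv \<eta> w x) + norm (conv \<eta> w x - \<Psi> x)"
        by norm
      also have "\<dots> \<le> \<epsilon> * b x + (\<kappa>1 + s)"
        using vw[of x] s(2)[OF True] True \<epsilon>(1) by (simp add: b_def)
      finally have "norm (v x - \<Psi> x) * norm (grad \<zeta> x) \<le> (\<epsilon> * b x + (\<kappa>1 + s)) * Z"
        using Z[of x] by (intro mult_mono) (auto intro: order_trans[OF norm_ge_zero])
      then show ?thesis using True by (simp add: q_def norm_outer mult.commute)
    next
      case False
      then show ?thesis using b0[of x] \<epsilon>(1) Z0 by (simp add: q_def norm_outer grad0)
    qed
    have \<Psi>c: "continuous_on UNIV \<Psi>"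
    proof -
      have "continuous_on UNIV (\<lambda>x. \<chi> k. \<Psi> x $ k)"
        by (intro continuous_on_vec_lambda smooth_continuous_on \<Psi>)
      then show ?thesis by simp
    qed
    have vc: "continuous_on UNIV v"
    proof -
      have "continuous_on UNIV (\<lambda>x. \<chi> k. v x $ k)"
        by (intro continuous_on_vec_lambda smooth_continuous_on vs)
      then show ?thesis by simp
    qed
    have qc: "continuous_on UNIV q"
      unfolding q_def outer_def
      by (intro continuous_on_vec_lambda continuous_intros vc \<Psi>c continuous_grad[OF \<zeta>s])
    have qbd: "\<exists>C. \<forall>x. norm (q x) \<le> C"
    proof -
      have "q x = 0" if "norm x > R" for x
        using grad0[of x] \<zeta>\<Omega> R(2)[of x] that by (force simp: q_def outer_def vec_eq_iff)
      then show ?thesis using bounded_support_bounded[OF qc, of R] by blast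
    qed
    then obtain Cq where Cq: "\<And>x. norm (q x) \<le> Cq" by blast
    have qm[measurable]: "q \<in> borel_measurable borel" by (rule borel_measurable_continuous_onI[OF qc])
    have qi: "integrable lborel (\<lambda>x. r x * (G x \<bullet> q x))" by (rule ri[OF qm Cq])
    have jac_bd: "\<exists>C. \<forall>x. norm (\<zeta> x *\<^sub>R jac u x) \<le> C" and jac_m: "(\<lambda>x. \<zeta> x *\<^sub>R jac u x) \<in> borel_measurable borel"
      if u: "\<And>k. smooth (\<lambda>x. u x $ k)" for u :: "real^'n \<Rightarrow> real^'m"
    proof -
      have c: "continuous_on UNIV (\<lambda>x. \<zeta> x *\<^sub>R jac u x)"
        by (intro continuous_intros smooth_continuous_on[OF \<zeta>s] continuous_jac u)
      have "\<zeta> x *\<^sub>R jac u x = 0" if "norm x > R" for x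
        using \<zeta>z[of x] \<zeta>\<Omega> R(2)[of x] that by force
      then show "\<exists>C. \<forall>x. norm (\<zeta> x *\<^sub>R jac u x) \<le> C" using bounded_support_bounded[OF c, of R] by blast
      show "(\<lambda>x. \<zeta> x *\<^sub>R jac u x) \<in> borel_measurable borel"
        by (rule borel_measurable_continuous_onI[OF c])
    qed
    have vji: "integrable lborel (\<lambda>x. r x * (G x \<bullet> (\<zeta> x *\<^sub>R jac v x)))"
      using jac_bd[OF vs] ri[OF jac_m[OF vs]] by blast
    have \<Psi>ji: "integrable lborel (\<lambda>x. r x * (G x \<bullet> (\<zeta> x *\<^sub>R jac \<Psi> x)))"
      using jac_bd[OF \<Psi>] ri[OF jac_m[OF \<Psi>]] by blast
    have "test_vec \<Omega> (\<lambda>x. \<zeta> x *\<^sub>R (v x - \<Psi> x))"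
      by (rule test_vec_scaleR[OF \<zeta>(1)]) (simp add: smooth_diff vs \<Psi>)
    from EL[OF this] have "0 = (\<integral>x. r x * (G x \<bullet> jac (\<lambda>x. \<zeta> x *\<^sub>R (v x - \<Psi> x)) x) \<partial>lborel)"
      by (simp add: r_def)
    also have "\<dots> = (\<integral>x. r x * (G x \<bullet> (\<zeta> x *\<^sub>R jac v x)) - r x * (G x \<bullet> (\<zeta> x *\<^sub>R jac \<Psi> x)) + r x * (G x \<bullet> q x) \<partial>lborel)"
    proof (rule Bochner_Integration.integral_cong[OF refl])
      fix x
      have eq: "jac (\<lambda>x. \<zeta> x *\<^sub>R (v x - \<Psi> x)) x = \<zeta> x *\<^sub>R (jac v x - jac \<Psi> x) + q x"
        unfolding q_def using jac_scaleR[OF \<zeta>s, of "\<lambda>x. v x - \<Psi> x" x] jac_diff[of v \<Psi> x]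
        by (simp add: smooth_diff vs \<Psi>)
      show "r x * (G x \<bullet> jac (\<lambda>x. \<zeta> x *\<^sub>R (v x - \<Psi> x)) x) =
          r x * (G x \<bullet> (\<zeta> x *\<^sub>R jac v x)) - r x * (G x \<bullet> (\<zeta> x *\<^sub>R jac \<Psi> x)) + r x * (G x \<bullet> q x)"
        unfolding eq by (simp add: inner_add_right inner_diff_right algebra_simps)
    qed
    also have "\<dots> = (\<integral>x. r x * (G x \<bullet> (\<zeta> x *\<^sub>R jac v x)) \<partial>lborel) - ?L + (\<integral>x. r x * (G x \<bullet> q x) \<partial>lborel)"
      by (subst Bochner_Integration.integral_add[OF Bochner_Integration.integrable_diff[OF vji \<Psi>ji] qi],
          subst Bochner_Integration.integral_diff[OF vji \<Psi>ji]) (rule refl)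
    finally have E: "(\<integral>x. r x * (G x \<bullet> (\<zeta> x *\<^sub>R jac v x)) \<partial>lborel) = ?L - (\<integral>x. r x * (G x \<bullet> q x) \<partial>lborel)"
      by linarith
    have "(\<integral>x. r x * (G x \<bullet> (\<zeta> x *\<^sub>R jac v x)) \<partial>lborel) = (\<integral>x. f x \<bullet> conv \<theta> G x \<partial>lborel)"
    proof (rule Bochner_Integration.integral_cong[OF refl])
      fix x
      show "r x * (G x \<bullet> (\<zeta> x *\<^sub>R jac v x)) = f x \<bullet> conv \<theta> G x"
        using jv[of x] supp_N \<zeta>z[of x] by (cases "x \<in> ?A") (auto simp: f_def)
    qed
    moreover have "(\<integral>x. \<zeta> x * norm (G x) powr p \<partial>lborel) = (\<integral>x. f x \<bullet> G x \<partial>lborel)"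
      by (rule Bochner_Integration.integral_cong[OF refl]) (simp add: f_def rGG[symmetric])
    ultimately have E2: "(\<integral>x. \<zeta> x * norm (G x) powr p \<partial>lborel) \<le> ?L - (\<integral>x. r x * (G x \<bullet> q x) \<partial>lborel) + \<kappa> / 2"
      using d1(2)[OF \<delta>(2) \<theta>] E by linarith
    have "- (\<integral>x. r x * (G x \<bullet> q x) \<partial>lborel) = (\<integral>x. - (r x * (G x \<bullet> q x)) \<partial>lborel)" by simp
    \<comment> \<open>Both |G|^(p-1) b \<le> |G|^p + b^p and |G|^(p-1) \<le> |G|^p + 1 on \<Omega>
      have right sides of integral at most 2 V; hence the constants 2 \<epsilon> + 2 s and 2 Z V
      \<kappa>1.\<close>
    also have "\<dots> \<le> (\<integral>x. Z * (\<epsilon> * (norm (G x) powr p + b x powr p) + (\<kappa>1 + s) * (norm (G x) powr p + indicator \<Omega> x)) \<partial>lborel)"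
    proof (rule integral_mono)
      show "integrable lborel (\<lambda>x. - (r x * (G x \<bullet> q x)))" using qi by simp
      show "integrable lborel (\<lambda>x. Z * (\<epsilon> * (norm (G x) powr p + b x powr p) + (\<kappa>1 + s) * (norm (G x) powr p + indicator \<Omega> x)))"
        using Gp bi iO by auto
      fix x
      let ?g = "norm (G x) powr (p - 1)"
      have "- (r x * (G x \<bullet> q x)) \<le> ?g * norm (q x)" using rle[of x "q x"] by linarith
      also have "\<dots> \<le> ?g * (Z * (\<epsilon> * b x + (\<kappa>1 + s) * indicator ?A x))"
        using qle by (intro mult_left_mono) auto
      also have "\<dots> = Z * (\<epsilon> * (?g * b x) + (\<kappa>1 + s) * (?g * indicator ?A x))"
        by (simp add: algebra_simps)
      also have "\<dots> \<le> Z * (\<epsilon> * (norm (G x) powr p + b x powr p) + (\<kappa>1 + s) * (norm (G x) powr p + indicator \<Omega> x))"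
      proof (intro mult_left_mono add_mono)
        show "?g * b x \<le> norm (G x) powr p + b x powr p"
          using p b0 by (intro powr_mult_le_add) auto
        have "?g * indicator ?A x \<le> ?g" by (simp add: indicator_def)
        then show "?g * indicator ?A x \<le> norm (G x) powr p + indicator \<Omega> x" using G1[of x] by linarith
      qed (use \<epsilon>(1) \<kappa>1(1) s(1) Z0 in auto)
      finally show "- (r x * (G x \<bullet> q x)) \<le> \<dots>" .
    qed
    also have "\<dots> = Z * (\<epsilon> * (V + (\<integral>x. b x powr p \<partial>lborel)) + (\<kappa>1 + s) * (V + V))"
      using Gp bi iO by (simp add: GV V[symmetric])
    also have "\<dots> \<le> Z * (\<epsilon> * (V + V) + (\<kappa>1 + s) * (V + V))"
      using bV \<epsilon>(1) Z0 \<kappa>1(1) s(1) by (intro mult_left_mono add_mono) auto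
    also have "\<dots> = Z * V * (2 * \<epsilon> + 2 * s) + 2 * (Z * V) * \<kappa>1" by (simp add: algebra_simps)
    finally show ?thesis using E2 \<kappa>1(2) by linarith
  qed
  have "(\<integral>x. \<zeta> x * norm (G x) powr p \<partial>lborel) \<le> ?L + Z * V * (2 * \<epsilon> + 2 * s)"
    by (rule field_le_epsilon) (use step2 in auto)
  with step1 show ?thesis unfolding r_def by linarith
qed

subsection \<open>Passing to the limit of large exponents\<close>

lemma differentiable_bound_jac:
  fixes v :: "real^'n::finite \<Rightarrow> real^'m::finite"
  assumes v: "\<And>k. smooth (\<lambda>x. v x $ k)" and "convex S" "x \<in> S" "y \<in> S"
    and M: "\<And>z. z \<in> S \<Longrightarrow> norm (jac v z) \<le> M"
  shows "norm (v x - v y) \<le> M * norm (x - y)"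
proof (rule differentiable_bound[OF \<open>convex S\<close> _ _ \<open>x \<in> S\<close> \<open>y \<in> S\<close>])
  show "(v has_derivative (\<lambda>h. jac v z *v h)) (at z within S)" for z
    by (rule has_derivative_at_withinI[OF has_derivative_jac[OF v]])
  show "onorm (\<lambda>h. jac v z *v h) \<le> M" if "z \<in> S" for z
    by (rule onorm_le) (rule order_trans[OF norm_matrix_vector_le mult_right_mono[OF M[OF that]]], simp)
qed

lemma tuple_test_formI:
  assumes "\<And>k j. smooth (\<lambda>x. \<omega> x $ k $ j)" "compact C" "\<And>x. x \<notin> C \<Longrightarrow> \<omega> x = 0"
  shows "tuple_test_form \<omega>"
  unfolding tuple_test_form_def test_form_def
proof (intro allI conjI assms(1))
  fix k
  have "supp (\<lambda>x. \<omega> x $ k) \<subseteq> C"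
    using assms(3) compact_imp_closed[OF assms(2)] by (intro supp_subset) auto
  then show "compact (supp (\<lambda>x. \<omega> x $ k))" by (rule compact_supp_subset[OF assms(2)])
qed

lemma tuple_test_form_scaleR_jac:
  assumes "smooth \<zeta>" "test_vec \<Omega> \<Psi>"
  shows "tuple_test_form (\<lambda>x. \<zeta> x *\<^sub>R jac \<Psi> x)"
proof (rule tuple_test_formI)
  show "smooth (\<lambda>x. (\<zeta> x *\<^sub>R jac \<Psi> x) $ k $ j)" for k j
    using assms by (simp add: jac_nth test_vec_def smooth_mult smooth_pd)
  show "compact (supp \<Psi>)" using assms by (simp add: test_vec_def)
qed (simp add: jac_not_in_supp)

text \<open>Average t \<le> 1 + t^p / p with \<eta>. The first term keeps the exact constant 1; the
  second sees the height B of the kernel but is divided by p, so the bound becomes 1 as p tends to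
  infinity.\<close>

lemma norm_conv_le_of_energy:
  fixes G :: "real^'n::finite \<Rightarrow> 'b::euclidean_space"
  assumes \<eta>: "mollifier \<epsilon> \<eta>" and B: "\<And>x. \<bar>\<eta> x\<bar> \<le> B" and p: "p > 1" and G: "integrable lborel G"
    and Gp: "integrable lborel (\<lambda>x. norm (G x) powr p)"
  shows "norm (conv \<eta> G x) \<le> 1 + B * (\<integral>x. norm (G x) powr p \<partial>lborel) / p"
proof -
  note k = mollifier_kernel[OF \<eta>]
  have \<eta>0: "\<eta> y \<ge> 0" for y using \<eta> by (simp add: mollifier_def)
  have [measurable]: "\<eta> \<in> borel_measurable borel" by (rule kernel_borel[OF k])
  have i1: "integrable lborel (\<lambda>y. \<eta> (x - y))" and I1: "(\<integral>y. \<eta> (x - y) \<partial>lborel) = 1"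
    using \<eta> integral_reflect_diff[of \<eta> x] integrable_reflect[of \<eta> x] by (auto simp: mollifier_def)
  have "norm (conv \<eta> G x) \<le> (\<integral>y. \<eta> (x - y) + B / p * norm (G y) powr p \<partial>lborel)"
    unfolding conv_def
  proof (rule norm_integral_le[OF integrable_conv[OF k G]])
    show "integrable lborel (\<lambda>y. \<eta> (x - y) + B / p * norm (G y) powr p)" using i1 Gp by auto
    fix y
    have "norm (G y) \<le> 1 + norm (G y) powr p / p"
      using young[OF p, of 1 "norm (G y)"] p by simp (smt (verit) divide_nonneg_nonneg)
    then have "\<eta> (x - y) * norm (G y) \<le> \<eta> (x - y) * (1 + norm (G y) powr p / p)"
      using \<eta>0 by (rule mult_left_mono)
    also have "\<dots> = \<eta> (x - y) + \<eta> (x - y) * (norm (G y) powr p / p)" by (simp add: distrib_left)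
    also have "\<dots> \<le> \<eta> (x - y) + B * (norm (G y) powr p / p)"
      using B[of "x - y"] \<eta>0[of "x - y"] p by (intro add_left_mono mult_right_mono) auto
    finally show "norm (\<eta> (x - y) *\<^sub>R G y) \<le> \<eta> (x - y) + B / p * norm (G y) powr p"
      using \<eta>0 by simp
  qed
  also have "\<dots> = 1 + B * (\<integral>x. norm (G x) powr p \<partial>lborel) / p"
    using i1 Gp by (simp add: I1)
  finally show ?thesis .
qed

text \<open>Only fixed test forms pass to the limit, so the comparison map of
  \<open>energy_estimate\<close> must not depend on l. It is the mollified limit map times a cutoff,
  and s measures its distance to the mollified maps \<open>w l\<close>.\<close>

lemma calibration_exists:
  fixes w :: "nat \<Rightarrow> real^'n::finite \<Rightarrow> real^'m::finite"
  assumes \<Omega>: "open \<Omega>" "bounded \<Omega>" and V: "V = measure lborel \<Omega>"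
    and wG: "\<And>l. wgrad \<Omega> (w l) (G l)" and w0: "\<And>l x. x \<notin> \<Omega> \<Longrightarrow> w l x = 0"
    and G0: "\<And>l x. x \<notin> \<Omega> \<Longrightarrow> G l x = 0"
    and p: "\<And>l. p l > 2" "filterlim p at_top sequentially"
    and Gp: "\<And>l. integrable lborel (\<lambda>x. norm (G l x) powr p l)"
    and GV: "\<And>l. (\<integral>x. norm (G l x) powr p l \<partial>lborel) = V"
    and EL: "\<And>l \<psi>. test_vec \<Omega> \<psi> \<Longrightarrow> (\<integral>x. norm (G l x) powr (p l - 2) * (G l x \<bullet> jac \<psi> x) \<partial>lborel) = 0"
    and WH: "wgrad \<Omega> W H"
    and wW: "\<And>R \<eta> x. kernel R \<eta> \<Longrightarrow> (\<lambda>l. conv \<eta> (w l) x) \<longlonglongrightarrow> conv \<eta> W x"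
    and GH: "\<And>R \<eta> x. kernel R \<eta> \<Longrightarrow> (\<lambda>l. conv \<eta> (G l) x) \<longlonglongrightarrow> conv \<eta> H x"
    and T: "\<And>\<phi>. tuple_test_form \<phi> \<Longrightarrow>
      (\<lambda>l. \<integral>x. norm (G l x) powr (p l - 2) * (G l x \<bullet> \<phi> x) \<partial>lborel) \<longlonglongrightarrow> T \<phi>"
    and \<zeta>: "test_fn \<Omega> \<zeta>" "\<And>x. 0 \<le> \<zeta> x" "\<And>x. \<zeta> x \<le> 1" and \<kappa>: "\<kappa> > 0"
  obtains \<Psi> where "test_vec \<Omega> \<Psi>" "\<And>x. x \<in> supp \<zeta> \<Longrightarrow> norm (jac \<Psi> x) \<le> 1"
    "\<And>\<phi>. tuple_test_form \<phi> \<Longrightarrow> (\<And>x. norm (\<phi> x) \<le> \<zeta> x) \<Longrightarrow> T \<phi> \<le> T (\<lambda>x. \<zeta> x *\<^sub>R jac \<Psi> x) + \<kappa>"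
proof -
  have wi: "integrable lborel (w l)" and Gi: "integrable lborel (G l)" for l using wG by (auto simp: wgrad_def)
  have Wi: "integrable lborel W" and Hi: "integrable lborel H" using WH by (auto simp: wgrad_def)
  have \<zeta>s: "smooth \<zeta>" and \<zeta>c: "compact (supp \<zeta>)" and \<zeta>\<Omega>: "supp \<zeta> \<subseteq> \<Omega>"
    using \<zeta>(1) by (auto simp: test_fn_def)
  have V0: "V \<ge> 0" by (simp add: V)
  have p0: "(\<lambda>l. c / p l) \<longlonglongrightarrow> 0" for c
    using p(2) by (intro tendsto_divide_0[OF tendsto_const] filterlim_at_top_imp_at_infinity)
  obtain Rz where Rz: "Rz > 0" "kernel Rz \<zeta>" using smooth_kernelI[OF \<zeta>s \<zeta>c] by blast
  obtain Z where Z: "Z > 0" "\<And>x. norm (grad \<zeta> x) \<le> Z"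
    using bounded_support_bounded[OF kernel_grad[OF Rz(2)]] by blast
  obtain e0 where e0: "e0 > 0" "(\<Union>x\<in>supp \<zeta>. cball x e0) \<subseteq> \<Omega>"
    using compact_subset_open_imp_cball_epsilon_subset[OF \<zeta>c \<Omega>(1) \<zeta>\<Omega>] by blast
  \<comment> \<open>Together with \<epsilon> \<le> s this makes the error Z V (2 \<epsilon> + 2 s)
    of \<open>energy_estimate\<close> at most \<kappa>.\<close>
  define s where "s = \<kappa> / (4 * Z * (V + 1))"
  have s: "s > 0" "Z * V * (4 * s) \<le> \<kappa>"
  proof -
    show "s > 0" using \<kappa> Z(1) V0 by (simp add: s_def)
    then have "Z * V * (4 * s) \<le> Z * (V + 1) * (4 * s)" using Z(1) by (intro mult_right_mono mult_left_mono) auto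
    also have "\<dots> = \<kappa>" using Z(1) V0 by (simp add: s_def divide_simps)
    finally show "Z * V * (4 * s) \<le> \<kappa>" .
  qed
  define \<epsilon> where "\<epsilon> = min (e0 / 2) s"
  have \<epsilon>: "\<epsilon> > 0" "\<epsilon> \<le> s" using e0 s by (auto simp: \<epsilon>_def)
  have \<epsilon>\<Omega>: "cball x (2 * \<epsilon>) \<subseteq> \<Omega>" if "x \<in> supp \<zeta>" for x
  proof -
    have "cball x (2 * \<epsilon>) \<subseteq> cball x e0" by (rule subset_cball) (simp add: \<epsilon>_def)
    with e0(2) that show ?thesis by blast
  qed
  obtain \<eta> :: "real^'n \<Rightarrow> real" where \<eta>: "mollifier \<epsilon> \<eta>" using ex_mollifier[OF \<epsilon>(1)] by blast
  note k = mollifier_kernel[OF \<eta>]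
  obtain B where B: "B > 0" "\<And>x. \<bar>\<eta> x\<bar> \<le> B" using kernel_bounded[OF k] by blast
  have GB: "norm (conv \<eta> (G l) x) \<le> 1 + B * V / p l" for l x
    using norm_conv_le_of_energy[OF \<eta> B(2) _ Gi Gp, of l x] p(1)[of l] GV[of l] by simp
  have H1: "norm (conv \<eta> H x) \<le> 1" for x
  proof (rule LIMSEQ_le)
    show "(\<lambda>l. norm (conv \<eta> (G l) x)) \<longlonglongrightarrow> norm (conv \<eta> H x)"
      by (rule tendsto_norm[OF GH[OF k]])
    show "(\<lambda>l. 1 + B * V / p l) \<longlonglongrightarrow> 1"
      using tendsto_add[OF tendsto_const p0[of "B * V"], of 1] by simp
  qed (use GB in auto)
  \<comment> \<open>A bound on the mollified gradients for all l, hence a common Lipschitz constant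
    of the mollified maps on the \<epsilon>-balls around points of supp \<zeta>.\<close>
  define M where "M = 1 + B * V"
  have M: "M \<ge> 1" using B(1) V0 by (simp add: M_def)
  have GM: "norm (conv \<eta> (G l) x) \<le> M" for l x
  proof -
    have "B * V / p l \<le> B * V / 1"
      using p(1)[of l] B(1) V0 by (intro divide_left_mono) auto
    with GB[of l x] show ?thesis by (simp add: M_def)
  qed
  have lip: "norm (conv \<eta> u x - conv \<eta> u y) \<le> M * norm (x - y)"
    if u: "wgrad \<Omega> u g" and gM: "\<And>x. norm (conv \<eta> g x) \<le> M" and x: "x \<in> supp \<zeta>" and y: "y \<in> cball x \<epsilon>"
    for u :: "real^'n \<Rightarrow> real^'m" and g x y
  proof (rule differentiable_bound_jac[of _ "cball x \<epsilon>"])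
    show "smooth (\<lambda>x. conv \<eta> u x $ k)" for k
      using u by (intro smooth_conv_nth[OF k]) (simp add: wgrad_def)
    show "norm (jac (conv \<eta> u) z) \<le> M" if z: "z \<in> cball x \<epsilon>" for z
    proof -
      have "cball z \<epsilon> \<subseteq> cball x (2 * \<epsilon>)"
        using z by (intro cball_subset_cball_iff[THEN iffD2] disjI1) (auto simp: dist_commute)
      then have "cball z \<epsilon> \<subseteq> \<Omega>" using \<epsilon>\<Omega>[OF x] by blast
      from jac_conv[OF k u this] gM show ?thesis by simp
    qed
  qed (use \<epsilon>(1) y in auto)
  \<comment> \<open>The convergence in \<open>wW\<close> is only pointwise. A finite \<rho>-net of
    the compact support and the common Lipschitz constant make it uniform, with errors s/4, s/2 and
    s/4.\<close>
  have unif: "\<forall>\<^sub>F l in sequentially. \<forall>x\<in>supp \<zeta>. norm (conv \<eta> (w l) x - conv \<eta> W x) \<le> s"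
  proof -
    define \<rho> where "\<rho> = min \<epsilon> (s / (4 * M))"
    have \<rho>: "\<rho> > 0" "\<rho> \<le> \<epsilon>" "M * \<rho> \<le> s / 4"
    proof -
      show "\<rho> > 0" using \<epsilon> s M by (simp add: \<rho>_def)
      show "\<rho> \<le> \<epsilon>" by (simp add: \<rho>_def)
      have "M * \<rho> \<le> M * (s / (4 * M))" using M by (intro mult_left_mono) (auto simp: \<rho>_def)
      then show "M * \<rho> \<le> s / 4" using M by simp
    qed
    obtain F where F: "finite F" "F \<subseteq> supp \<zeta>" "supp \<zeta> \<subseteq> (\<Union>c\<in>F. ball c \<rho>)"
      using compactE_image[OF \<zeta>c, of "supp \<zeta>" "\<lambda>c. ball c \<rho>"] \<rho>(1) by (metis UN_I centre_in_ball open_ball subsetI)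
    have "\<forall>\<^sub>F l in sequentially. norm (conv \<eta> (w l) c - conv \<eta> W c) < s / 2" for c
      using tendstoD[OF wW[OF k], of "s / 2" c] s(1) by (simp add: dist_norm)
    then have "\<forall>\<^sub>F l in sequentially. \<forall>c\<in>F. norm (conv \<eta> (w l) c - conv \<eta> W c) < s / 2"
      by (intro eventually_ball_finite F(1)) auto
    then show ?thesis
    proof eventually_elim
      case (elim l)
      show ?case
      proof
        fix x assume "x \<in> supp \<zeta>"
        then obtain c where c: "c \<in> F" "x \<in> ball c \<rho>" using F(3) by blast
        then have cz: "c \<in> supp \<zeta>" "x \<in> cball c \<epsilon>" "norm (c - x) \<le> \<rho>"
          using F(2) \<rho>(2) by (auto simp: dist_norm)
        have Mx: "M * norm (c - x) \<le> s / 4"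
          using mult_left_mono[OF cz(3), of M] \<rho>(3) M by linarith
        have a: "norm (conv \<eta> (w l) c - conv \<eta> (w l) x) \<le> s / 4"
          using lip[OF wG GM cz(1,2)] Mx by (rule order_trans)
        have H1': "norm (conv \<eta> H x) \<le> M" for x using H1[of x] M by linarith
        have b: "norm (conv \<eta> W c - conv \<eta> W x) \<le> s / 4"
          using lip[OF WH H1' cz(1,2)] Mx by (rule order_trans)
        have "norm (conv \<eta> (w l) x - conv \<eta> W x) \<le> norm (conv \<eta> (w l) c - conv \<eta> (w l) x)
            + norm (conv \<eta> (w l) c - conv \<eta> W c) + norm (conv \<eta> W c - conv \<eta> W x)"
          by norm
        with a b elim c(1) show "norm (conv \<eta> (w l) x - conv \<eta> W x) \<le> s" by fastforce
      qed
    qed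
  qed
  \<comment> \<open>Since \<theta> is 1 on an open set around supp \<zeta>, the cutoff changes
    neither the map nor its Jacobian there.\<close>
  obtain \<theta> N where \<theta>: "test_fn \<Omega> \<theta>" "open N" "supp \<zeta> \<subseteq> N" "\<And>x. x \<in> N \<Longrightarrow> \<theta> x = 1"
    using smooth_cutoff[OF \<zeta>c \<Omega>(1) \<zeta>\<Omega>] by metis
  define \<Psi> where "\<Psi> x = \<theta> x *\<^sub>R conv \<eta> W x" for x
  have \<Psi>t: "test_vec \<Omega> \<Psi>"
    unfolding \<Psi>_def by (intro test_vec_scaleR \<theta> smooth_conv_nth[OF k Wi])
  then have \<Psi>s: "smooth (\<lambda>x. \<Psi> x $ k)" for k by (simp add: test_vec_def)
  have \<Psi>z: "\<Psi> x = conv \<eta> W x" if "x \<in> supp \<zeta>" for x using \<theta> that by (auto simp: \<Psi>_def)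
  have \<Psi>1: "norm (jac \<Psi> x) \<le> 1" if "x \<in> supp \<zeta>" for x
  proof -
    have "jac \<Psi> x = jac (conv \<eta> W) x"
      using \<theta> that by (intro jac_cong_open[of N]) (auto simp: \<Psi>_def)
    moreover have "cball x \<epsilon> \<subseteq> \<Omega>"
      using \<epsilon>\<Omega>[OF that] subset_cball[of \<epsilon> "2 * \<epsilon>" x] \<epsilon>(1) by auto
    ultimately show ?thesis using jac_conv[OF k WH] H1 by simp
  qed
  have "T \<phi> \<le> T (\<lambda>x. \<zeta> x *\<^sub>R jac \<Psi> x) + \<kappa>"
    if \<phi>: "tuple_test_form \<phi>" "\<And>x. norm (\<phi> x) \<le> \<zeta> x" for \<phi>
  proof (rule tendsto_le)
    let ?L = "\<lambda>l \<phi>. \<integral>x. norm (G l x) powr (p l - 2) * (G l x \<bullet> \<phi> x) \<partial>lborel"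
    show "(\<lambda>l. ?L l \<phi>) \<longlonglongrightarrow> T \<phi>" by (rule T[OF \<phi>(1)])
    show "(\<lambda>l. ?L l (\<lambda>x. \<zeta> x *\<^sub>R jac \<Psi> x) + V / p l + \<kappa>) \<longlonglongrightarrow> T (\<lambda>x. \<zeta> x *\<^sub>R jac \<Psi> x) + \<kappa>"
      using tendsto_add[OF tendsto_add[OF T[OF tuple_test_form_scaleR_jac[OF \<zeta>s \<Psi>t]] p0[of V]] tendsto_const[of \<kappa>]]
      by simp
    have \<phi>m: "\<phi> \<in> borel_measurable borel"
    proof -
      have "continuous_on UNIV (\<lambda>x. \<chi> k j. \<phi> x $ k $ j)"
        using \<phi>(1) by (intro continuous_on_vec_lambda smooth_continuous_on) (auto simp: tuple_test_form_def test_form_def)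
      then show ?thesis by (intro borel_measurable_continuous_onI) simp
    qed
    show "\<forall>\<^sub>F l in sequentially. ?L l \<phi> \<le> ?L l (\<lambda>x. \<zeta> x *\<^sub>R jac \<Psi> x) + V / p l + \<kappa>"
      using unif
    proof eventually_elim
      case (elim l)
      have "?L l \<phi> \<le> ?L l (\<lambda>x. \<zeta> x *\<^sub>R jac \<Psi> x) + V / p l + Z * V * (2 * \<epsilon> + 2 * s)"
        by (rule energy_estimate[OF \<Omega> V wG w0 G0 p(1) Gp GV EL \<zeta> Z(2) \<epsilon>(1) \<epsilon>\<Omega> \<eta> \<Psi>s _ _ \<phi>m \<phi>(2)])
          (use s(1) elim \<Psi>z in auto)
      moreover have "Z * V * (2 * \<epsilon> + 2 * s) \<le> Z * V * (4 * s)"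
        using \<epsilon>(2) Z(1) V0 by (intro mult_left_mono) auto
      ultimately show ?case using s(2) by linarith
    qed
  qed simp
  with \<Psi>t \<Psi>1 that show ?thesis by blast
qed

subsection \<open>Currents represented by integration\<close>

lemma mass_rep_norm:
  fixes V :: "real^'n::finite \<Rightarrow> real^'n^'m::finite"
  assumes "mass_rep S \<nu> V"
  shows "AE x in \<nu>. norm (V x) = 1"
proof -
  have "norm A = 1" if "(\<Sum>k\<in>UNIV. (norm (A $ k))\<^sup>2) = 1" for A :: "real^'n^'m"
    using that by (simp add: norm_vec_def[of A] L2_set_def)
  then show ?thesis using assms unfolding mass_rep_def by auto
qed

lemma mass_rep_apply:
  assumes "mass_rep S \<nu> V" "tuple_test_form \<omega>"
  shows "integrable \<nu> (\<lambda>x. \<omega> x \<bullet> V x)" "tuple_apply S \<omega> = (\<integral>x. \<omega> x \<bullet> V x \<partial>\<nu>)"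
proof -
  have *: "integrable \<nu> (\<lambda>x. \<omega> x $ k \<bullet> V x $ k)" "S k (\<lambda>x. \<omega> x $ k) = (\<integral>x. \<omega> x $ k \<bullet> V x $ k \<partial>\<nu>)" for k
    using assms by (auto simp: mass_rep_def tuple_test_form_def)
  show "integrable \<nu> (\<lambda>x. \<omega> x \<bullet> V x)"
    unfolding inner_vec_def[of "\<omega> _"] using * by (intro Bochner_Integration.integrable_sum) auto
  show "tuple_apply S \<omega> = (\<integral>x. \<omega> x \<bullet> V x \<partial>\<nu>)"
    unfolding inner_vec_def[of "\<omega> _"] tuple_apply_def using *
    by (subst Bochner_Integration.integral_sum) auto
qed

lemma radon_integrable_indicator:
  "radon \<nu> \<Longrightarrow> compact C \<Longrightarrow> integrable \<nu> (indicator C :: _ \<Rightarrow> real)"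
  by (intro integrable_real_indicator) (auto simp: radon_def compact_imp_closed borel_closed)

text \<open>
  Instead of a partition of unity, $\sigma$ is split step by step as $\theta\sigma + (1-\theta)\sigma$;
  the product of all the factors $1-\theta$ vanishes on the support of $\sigma$.
\<close>
lemma local_zero_imp_zero:
  fixes D :: "(real^'n::finite \<Rightarrow> real) \<Rightarrow> real"
  assumes add: "\<And>f g. test_fn UNIV f \<Longrightarrow> test_fn UNIV g \<Longrightarrow> D (\<lambda>x. f x + g x) = D f + D g"
    and \<sigma>: "test_fn \<Omega> \<sigma>" and loc: "\<And>x. x \<in> \<Omega> \<Longrightarrow> x \<notin> supp0 D"
  shows "D \<sigma> = 0"
proof -
  \<comment> \<open>Cutoffs supported where \<open>D\<close> vanishes: \<open>D\<close> annihilates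
    every smooth multiple of them.\<close>
  define good where "good = {\<theta>. smooth \<theta> \<and> (\<exists>U. compact (supp \<theta>) \<and> supp \<theta> \<subseteq> U \<and> (\<forall>\<tau>. test_fn U \<tau> \<longrightarrow> D \<tau> = 0))}"
  have step: "finite F \<Longrightarrow> F \<subseteq> good \<Longrightarrow> test_fn UNIV \<tau> \<Longrightarrow> (\<And>x. \<tau> x \<noteq> 0 \<Longrightarrow> \<exists>\<theta>\<in>F. \<theta> x = 1) \<Longrightarrow> D \<tau> = 0" for F \<tau>
  proof (induction F arbitrary: \<tau> rule: finite_induct)
    case empty
    then have "\<tau> = (\<lambda>x. 0)" by auto
    \<comment> \<open>For the zero function additivity reads D 0 = D 0 + D 0.\<close>
    then show ?case using add[of \<tau> \<tau>] empty by simp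
  next
    case (insert \<theta> F)
    then have "\<theta> \<in> good" by simp
    then obtain U where \<theta>: "smooth \<theta>" "compact (supp \<theta>)" "supp \<theta> \<subseteq> U" "\<And>\<tau>. test_fn U \<tau> \<Longrightarrow> D \<tau> = 0"
      unfolding good_def by blast
    have \<tau>: "smooth \<tau>" "compact (supp \<tau>)" using insert.prems by (auto simp: test_fn_def)
    have s1: "supp (\<lambda>x. \<theta> x * \<tau> x) \<subseteq> supp \<theta>" by (rule supp_subset) (auto simp: not_in_supp)
    have s2: "supp (\<lambda>x. (1 - \<theta> x) * \<tau> x) \<subseteq> supp \<tau>" by (rule supp_subset) (auto simp: not_in_supp)
    have t1: "test_fn U (\<lambda>x. \<theta> x * \<tau> x)"
      using \<theta> \<tau> s1 compact_supp_subset[OF \<theta>(2) s1] by (auto simp: test_fn_def smooth_mult)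
    have t2: "test_fn UNIV (\<lambda>x. (1 - \<theta> x) * \<tau> x)"
      using \<theta> \<tau> compact_supp_subset[OF \<tau>(2) s2] by (auto simp: test_fn_def smooth_mult smooth_diff)
    have "D (\<lambda>x. (1 - \<theta> x) * \<tau> x) = 0"
    proof (rule insert.IH[OF _ t2])
      show "F \<subseteq> good" using insert.prems by auto
      fix x assume "(1 - \<theta> x) * \<tau> x \<noteq> 0"
      then have "\<tau> x \<noteq> 0" "\<theta> x \<noteq> 1" by auto
      then show "\<exists>\<theta>\<in>F. \<theta> x = 1" using insert.prems(3)[of x] by auto
    qed
    moreover have "D (\<lambda>x. \<theta> x * \<tau> x) = 0" by (rule \<theta>(4)[OF t1])
    moreover have "D (\<lambda>x. \<theta> x * \<tau> x + (1 - \<theta> x) * \<tau> x) = D (\<lambda>x. \<theta> x * \<tau> x) + D (\<lambda>x. (1 - \<theta> x) * \<tau> x)"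
      using t1 by (intro add t2) (auto simp: test_fn_def)
    moreover have "(\<lambda>x. \<theta> x * \<tau> x + (1 - \<theta> x) * \<tau> x) = \<tau>" by (simp add: fun_eq_iff algebra_simps)
    ultimately show ?case by simp
  qed
  have "\<exists>\<theta> V. \<theta> \<in> good \<and> open V \<and> x \<in> V \<and> (\<forall>y\<in>V. \<theta> y = 1)" if "x \<in> supp \<sigma>" for x
  proof -
    have "x \<in> \<Omega>" using \<sigma> that by (auto simp: test_fn_def)
    then obtain U where U: "open U" "x \<in> U" "\<And>\<tau>. test_fn U \<tau> \<Longrightarrow> D \<tau> = 0"
      using loc[of x] by (auto simp: supp0_def)
    obtain \<theta> V where \<theta>: "test_fn U \<theta>" "open V" "{x} \<subseteq> V" "\<And>y. y \<in> V \<Longrightarrow> \<theta> y = 1"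
      using smooth_cutoff[of "{x}" U] U by (metis compact_sing empty_subsetI insert_subset)
    have "\<theta> \<in> good" using \<theta>(1) U(3) unfolding good_def test_fn_def by blast
    with \<theta> show ?thesis by blast
  qed
  then obtain \<theta> V where \<theta>: "\<And>x. x \<in> supp \<sigma> \<Longrightarrow> \<theta> x \<in> good \<and> open (V x) \<and> x \<in> V x \<and> (\<forall>y\<in>V x. \<theta> x y = 1)"
    by metis
  have "compact (supp \<sigma>)" using \<sigma> by (simp add: test_fn_def)
  then obtain C where C: "C \<subseteq> supp \<sigma>" "finite C" "supp \<sigma> \<subseteq> (\<Union>c\<in>C. V c)"
    by (rule compactE_image[of _ "supp \<sigma>" V]) (use \<theta> in auto)
  show ?thesis
  proof (rule step[of "\<theta> ` C"])
    show "finite (\<theta> ` C)" "\<theta> ` C \<subseteq> good" using C \<theta> by auto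
    show "test_fn UNIV \<sigma>" using \<sigma> by (simp add: test_fn_def)
    fix x assume "\<sigma> x \<noteq> 0"
    then have "x \<in> supp \<sigma>" using not_in_supp by blast
    then obtain c where "c \<in> C" "x \<in> V c" using C(3) by blast
    then show "\<exists>\<theta>\<in>\<theta> ` C. \<theta> x = 1" using \<theta> C(1) by blast
  qed
qed

lemma test_form_grad: "test_fn U f \<Longrightarrow> test_form (grad f)"
proof -
  assume f: "test_fn U f"
  have "supp (grad f) \<subseteq> supp f"
    by (rule supp_subset) (auto simp: grad_def vec_eq_iff pd_not_in_supp)
  then have "compact (supp (grad f))"
    using f compact_supp_subset[of "supp f" "grad f"] by (auto simp: test_fn_def)
  then show ?thesis
    using f by (auto simp: test_form_def grad_def test_fn_def smooth_pd)
qed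

text \<open>The rows of \<open>jac \<Psi>\<close> are the differentials of the components of \<Psi>,
  so S sees them only through its boundary. The boundary vanishes near each point of \<Omega>;
  additivity, taken from the integral representation, makes this global.\<close>

lemma tuple_apply_jac_eq_0:
  fixes S :: "'m::finite \<Rightarrow> (real^'n::finite \<Rightarrow> real^'n) \<Rightarrow> real"
  assumes rep: "mass_rep S \<nu> V" and bd: "supp_bd S \<inter> \<Omega> = {}" and \<Psi>: "test_vec \<Omega> \<Psi>"
  shows "tuple_apply S (jac \<Psi>) = 0"
proof -
  have "S k (\<lambda>x. jac \<Psi> x $ k) = 0" for k
  proof -
    have "supp (\<lambda>x. \<Psi> x $ k) \<subseteq> supp \<Psi>" by (rule supp_subset) (auto simp: not_in_supp)
    then have t: "test_fn \<Omega> (\<lambda>x. \<Psi> x $ k)"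
      using \<Psi> compact_supp_subset[of "supp \<Psi>"] by (auto simp: test_fn_def test_vec_def)
    have "bd (S k) (\<lambda>x. \<Psi> x $ k) = 0"
    proof (rule local_zero_imp_zero[OF _ t])
      fix f g :: "real^'n \<Rightarrow> real" assume fg: "test_fn UNIV f" "test_fn UNIV g"
      have fg': "f differentiable at x" "g differentiable at x" for x
        using fg by (auto simp: test_fn_def smooth_differentiable)
      have sum: "test_fn UNIV (\<lambda>x. f x + g x)"
      proof -
        have "supp (\<lambda>x. f x + g x) \<subseteq> supp f \<union> supp g"
          by (rule supp_subset) (auto simp: not_in_supp)
        then show ?thesis
          using fg compact_supp_subset[of "supp f \<union> supp g"] by (auto simp: test_fn_def smooth_add compact_Un)
      qed
      have gr: "grad (\<lambda>x. f x + g x) x = grad f x + grad g x" for x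
        using fg' by (simp add: grad_def vec_eq_iff pd_add)
      note i = fg[THEN test_form_grad]
      show "bd (S k) (\<lambda>x. f x + g x) = bd (S k) f + bd (S k) g"
        using rep i test_form_grad[OF sum] unfolding bd_def mass_rep_def
        by (simp add: gr inner_add_left)
    qed (use bd in \<open>auto simp: supp_bd_def\<close>)
    moreover have "(\<lambda>x. jac \<Psi> x $ k) = grad (\<lambda>x. \<Psi> x $ k)"
      by (simp add: fun_eq_iff vec_eq_iff jac_nth grad_def)
    ultimately show ?thesis by (simp add: bd_def)
  qed
  then show ?thesis by (simp add: tuple_apply_def)
qed

section \<open>Mass as a supremum over smooth test forms\<close>

lemma norm_conv_le_bound:
  fixes f :: "real^'n::finite \<Rightarrow> 'b::euclidean_space"
  assumes \<eta>: "mollifier \<epsilon> \<eta>" and f: "integrable lborel f" "\<And>x. norm (f x) \<le> B"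
  shows "norm (conv \<eta> f x) \<le> B"
proof -
  have \<eta>': "integrable lborel \<eta>" "(\<integral>y. \<eta> y \<partial>lborel) = 1" "\<And>y. 0 \<le> \<eta> y"
    using \<eta> by (auto simp: mollifier_def)
  have "norm (conv \<eta> f x) \<le> (\<integral>y. \<eta> y * norm (f (x - y)) \<partial>lborel)" by (rule norm_conv_le[OF \<eta> f(1)])
  also have "\<dots> \<le> (\<integral>y. \<eta> y * B \<partial>lborel)"
    using conv_commute(2)[OF mollifier_kernel[OF \<eta>] integrable_norm[OF f(1)], of x] \<eta>' f(2)
    by (intro integral_mono mult_left_mono) auto
  also have "\<dots> = B" using \<eta>' by simp
  finally show ?thesis .
qed

text \<open>Since |V| = 1, the ideal form would be \<zeta> V itself. It is replaced by \<zeta> c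
  with a smooth field c of norm at most 1; the loss \<zeta> (V - c) . V is at most |V - c| on supp
  \<zeta>.\<close>

lemma mass_approx:
  fixes V :: "real^'n::finite \<Rightarrow> real^'n^'m::finite"
  assumes \<nu>: "radon \<nu>" and Vm: "V \<in> borel_measurable borel" and V1: "AE x in \<nu>. norm (V x) = 1"
    and \<zeta>: "test_fn \<Omega> \<zeta>" "\<And>x. 0 \<le> \<zeta> x" "\<And>x. \<zeta> x \<le> 1" and \<kappa>: "\<kappa> > 0"
  obtains \<phi> where "tuple_test_form \<phi>" "\<And>x. norm (\<phi> x) \<le> \<zeta> x" "(\<integral>x. \<zeta> x \<partial>\<nu>) \<le> (\<integral>x. \<phi> x \<bullet> V x \<partial>\<nu>) + \<kappa>"
proof -
  have sets\<nu>[measurable_cong]: "sets \<nu> = sets borel" using \<nu> by (simp add: radon_def)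
  have [measurable]: "V \<in> borel_measurable borel" by fact
  define A where "A = supp \<zeta>"
  have \<zeta>s: "smooth \<zeta>" and Ac: "compact A" using \<zeta>(1) by (auto simp: test_fn_def A_def)
  have [measurable]: "\<zeta> \<in> borel_measurable borel" by (rule smooth_borel[OF \<zeta>s])
  have [measurable]: "A \<in> sets borel" using compact_imp_closed[OF Ac] by simp
  have iA: "integrable \<nu> (indicator A :: _ \<Rightarrow> real)" by (rule radon_integrable_indicator[OF \<nu> Ac])
  have \<zeta>A: "\<zeta> x \<le> indicator A x" for x
    using \<zeta>(3) not_in_supp[of x \<zeta>] by (auto simp: A_def indicator_def)
  define M where "M = density \<nu> (\<lambda>x. ennreal (indicator A x))"
  have sM: "sets M = sets borel" by (simp add: M_def sets\<nu>)
  have fM: "finite_measure M"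
  proof (rule finite_measureI)
    have "emeasure M (space M) = emeasure \<nu> A"
      unfolding M_def using sets\<nu> by (subst emeasure_density) (auto simp: ennreal_indicator sets_eq_imp_space_eq)
    moreover have "emeasure \<nu> A < \<infinity>" using \<nu> Ac by (simp add: radon_def)
    ultimately show "emeasure M (space M) \<noteq> \<infinity>" by simp
  qed
  interpret M: finite_measure M by fact
  have VM: "AE x in M. norm (V x) \<le> 1"
    using V1 unfolding M_def by (subst AE_density) (auto elim!: eventually_mono)
  have Vi: "integrable M V"
    using VM by (rule M.integrable_const_bound) (simp add: sM cong: measurable_cong_sets)
  obtain g where g: "continuous_on UNIV g" "\<And>x. norm (g x) \<le> 1" "(\<integral>x. norm (V x - g x) \<partial>M) < \<kappa> / 2"
    using dense_continuous_L1_bounded[OF fM sM Vi _ VM, of "\<kappa> / 2"] \<kappa> by auto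
  have [measurable]: "g \<in> borel_measurable borel" by (rule borel_measurable_continuous_onI[OF g(1)])
  obtain \<theta> N where \<theta>: "test_fn UNIV \<theta>" "\<And>x. 0 \<le> \<theta> x" "\<And>x. \<theta> x \<le> 1" "A \<subseteq> N" "\<And>x. x \<in> N \<Longrightarrow> \<theta> x = 1"
    using smooth_cutoff[OF Ac open_UNIV] by (metis subset_UNIV)
  have \<theta>1: "\<theta> x = 1" if "x \<in> A" for x using \<theta> that by auto
  obtain R where R: "R > 0" "kernel R \<theta>" using smooth_kernelI \<theta>(1) unfolding test_fn_def by blast
  \<comment> \<open>The cutoff only makes \<open>g\<close> fit for mollification; on A, where the
    error is measured, h = g.\<close>
  define h where "h x = \<theta> x *\<^sub>R g x" for x
  have hc: "continuous_on UNIV h" unfolding h_def by (intro continuous_intros kernel_cont[OF R(2)] g)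
  have h0: "h x = 0" if "norm x > R" for x using R(2) that by (simp add: h_def kernel_def)
  have h1: "norm (h x) \<le> 1" for x
    using mult_mono[of "\<theta> x" 1 "norm (g x)" 1] \<theta>(2,3)[of x] g(2)[of x] by (simp add: h_def)
  have hi: "integrable lborel h" using hc h0 by (rule integrable_continuous_bounded_support)
  \<comment> \<open>The uniform mollification error \<kappa> / (2 m), integrated over A, costs at
    most \<kappa>/2; the L1 distance of \<open>g\<close> to \<open>V\<close> costs the other
    half.\<close>
  define m where "m = measure \<nu> A + 1"
  have m: "m > 0" by (simp add: m_def add_nonneg_pos)
  obtain d where d: "d > 0" "\<And>\<delta> \<eta> x. \<delta> < d \<Longrightarrow> mollifier \<delta> \<eta> \<Longrightarrow> norm (conv \<eta> h x - h x) \<le> \<kappa> / (2 * m)"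
    using mollify_uniform[OF hc h0, where e = "\<kappa> / (2 * m)"] \<kappa> m by auto
  obtain \<eta> :: "real^'n \<Rightarrow> real" where \<eta>: "mollifier (d / 2) \<eta>" using ex_mollifier[of "d / 2"] d(1) by auto
  note k = mollifier_kernel[OF \<eta>]
  define c where "c = conv \<eta> h"
  have ch: "norm (c x - h x) \<le> \<kappa> / (2 * m)" for x unfolding c_def using d(2)[of "d / 2" \<eta> x] d(1) \<eta> by simp
  have c1: "norm (c x) \<le> 1" for x unfolding c_def by (rule norm_conv_le_bound[OF \<eta> hi h1])
  have [measurable]: "c \<in> borel_measurable borel" unfolding c_def by (rule borel_measurable_conv[OF k hi])
  have cs: "smooth (\<lambda>x. c x $ i $ j)" for i j
    unfolding c_def conv_nth[OF k hi] by (rule smooth_conv_nth[OF k integrable_nth[OF hi]])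
  define \<phi> where "\<phi> x = \<zeta> x *\<^sub>R c x" for x
  have "tuple_test_form \<phi>"
    by (rule tuple_test_formI[OF _ Ac]) (auto simp: \<phi>_def A_def not_in_supp intro: smooth_mult \<zeta>s cs)
  moreover have \<phi>le: "norm (\<phi> x) \<le> \<zeta> x" for x
    using mult_left_mono[OF c1[of x] \<zeta>(2)[of x]] \<zeta>(2)[of x] by (simp add: \<phi>_def)
  moreover have "(\<integral>x. \<zeta> x \<partial>\<nu>) \<le> (\<integral>x. \<phi> x \<bullet> V x \<partial>\<nu>) + \<kappa>"
  proof -
    have \<zeta>i: "integrable \<nu> \<zeta>"
      using \<zeta> \<zeta>A by (intro Bochner_Integration.integrable_bound[OF iA]) (auto intro!: AE_I2 simp: sets\<nu> cong: measurable_cong_sets)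
    have \<phi>i: "integrable \<nu> (\<lambda>x. \<phi> x \<bullet> V x)"
    proof (rule Bochner_Integration.integrable_bound[OF \<zeta>i])
      show "(\<lambda>x. \<phi> x \<bullet> V x) \<in> borel_measurable \<nu>" unfolding \<phi>_def by measurable
      show "AE x in \<nu>. norm (\<phi> x \<bullet> V x) \<le> norm (\<zeta> x)"
        using V1
      proof eventually_elim
        case (elim x)
        then show ?case using Cauchy_Schwarz_ineq2[of "\<phi> x" "V x"] \<phi>le[of x] by simp
      qed
    qed
    have Vgi: "integrable \<nu> (\<lambda>x. indicator A x * norm (V x - g x))"
    proof (rule Bochner_Integration.integrable_bound)
      show "integrable \<nu> (\<lambda>x. 2 * indicator A x :: real)" using iA by simp
      show "AE x in \<nu>. norm (indicator A x * norm (V x - g x)) \<le> norm (2 * indicator A x :: real)"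
        using V1
      proof eventually_elim
        case (elim x)
        then show ?case using norm_triangle_ineq4[of "V x" "g x"] g(2)[of x] by (auto simp: indicator_def)
      qed
    qed measurable
    have "(\<integral>x. \<zeta> x \<partial>\<nu>) - (\<integral>x. \<phi> x \<bullet> V x \<partial>\<nu>) = (\<integral>x. \<zeta> x - \<phi> x \<bullet> V x \<partial>\<nu>)" using \<zeta>i \<phi>i by simp
    also have "\<dots> \<le> (\<integral>x. indicator A x * norm (V x - g x) + \<kappa> / (2 * m) * indicator A x \<partial>\<nu>)"
    proof (rule integral_mono_AE)
      show "AE x in \<nu>. \<zeta> x - \<phi> x \<bullet> V x \<le> indicator A x * norm (V x - g x) + \<kappa> / (2 * m) * indicator A x"
        using V1
      proof eventually_elim
        case (elim x)
        show ?case
        proof (cases "x \<in> A")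
          case True
          then have hg: "h x = g x" using \<theta>1 by (simp add: h_def)
          have VV: "V x \<bullet> V x = 1" using elim by (simp add: power2_norm_eq_inner[symmetric])
          then have "\<zeta> x - \<phi> x \<bullet> V x = \<zeta> x * ((V x - c x) \<bullet> V x)"
            by (simp add: \<phi>_def inner_diff_left algebra_simps)
          also have "\<dots> \<le> \<zeta> x * norm (V x - c x)"
            using Cauchy_Schwarz_ineq2[of "V x - c x" "V x"] elim \<zeta>(2)[of x] by (intro mult_left_mono) auto
          also have "\<dots> \<le> norm (V x - c x)" using \<zeta>(2,3)[of x] by (intro mult_left_le_one_le) auto
          also have "\<dots> \<le> norm (V x - g x) + norm (c x - h x)" unfolding hg by norm
          finally show ?thesis using ch[of x] True by simp
        next
          case False
          then show ?thesis using not_in_supp[of x \<zeta>] by (simp add: A_def \<phi>_def)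
        qed
      qed
    qed (use \<zeta>i \<phi>i Vgi iA in auto)
    also have "\<dots> = (\<integral>x. indicator A x * norm (V x - g x) \<partial>\<nu>) + \<kappa> / (2 * m) * measure \<nu> A"
      using Vgi iA sets_eq_imp_space_eq[OF sets\<nu>] by simp
    also have "(\<integral>x. indicator A x * norm (V x - g x) \<partial>\<nu>) = (\<integral>x. norm (V x - g x) \<partial>M)"
      unfolding M_def by (subst integral_density) auto
    also have "\<kappa> / (2 * m) * measure \<nu> A \<le> \<kappa> / (2 * m) * m" using \<kappa> m by (intro mult_left_mono) (auto simp: m_def)
    also have "\<kappa> / (2 * m) * m = \<kappa> / 2" using m by simp
    finally show ?thesis using g(3) by linarith
  qed
  ultimately show ?thesis using that by blast
qed

section \<open>Restriction of currents to a compact set through shrinking cutoffs\<close>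

lemma tuple_test_form_mult:
  assumes "smooth f" "tuple_test_form \<omega>"
  shows "tuple_test_form (\<lambda>x. f x *\<^sub>R \<omega> x)"
proof -
  have "supp (\<lambda>x. f x *\<^sub>R \<omega> x $ k) \<subseteq> supp (\<lambda>x. \<omega> x $ k)" for k
    by (rule supp_subset) (auto dest: not_in_supp)
  then have "compact (supp (\<lambda>x. f x *\<^sub>R \<omega> x $ k))" for k
    using assms(2) by (intro compact_supp_subset[of "supp (\<lambda>x. \<omega> x $ k)" "\<lambda>x. f x *\<^sub>R \<omega> x $ k"])
      (auto simp: tuple_test_form_def test_form_def)
  then show ?thesis
    using assms by (auto simp: tuple_test_form_def test_form_def intro: smooth_mult)
qed

lemma shrinking_cutoffs:
  fixes K :: "(real^'n::finite) set"
  assumes K: "compact K" "K \<noteq> {}" and U: "open U" "K \<subseteq> U"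
  obtains \<theta> :: "nat \<Rightarrow> real^'n \<Rightarrow> real" where "\<And>i. test_fn U (\<theta> i)" "\<And>i x. 0 \<le> \<theta> i x" "\<And>i x. \<theta> i x \<le> 1"
    "\<And>i x. x \<in> K \<Longrightarrow> \<theta> i x = 1" "\<And>x. (\<lambda>i. \<theta> i x) \<longlonglongrightarrow> indicator K x"
proof -
  \<comment> \<open>Neighbourhoods decreasing to K: a point off K has positive distance to it and so
    lies outside all but finitely many. Since \<open>infdist\<close> to the empty set is 0, K is
    assumed nonempty.\<close>
  define W where "W i = U \<inter> {x. infdist x K < 1 / real (Suc i)}" for i
  have "open (W i)" for i
    unfolding W_def by (intro open_Int U open_Collect_less continuous_intros)
  moreover have "K \<subseteq> W i" for i using U by (auto simp: W_def)
  ultimately have "\<exists>\<theta>. test_fn (W i) \<theta> \<and> (\<forall>x. 0 \<le> \<theta> x) \<and> (\<forall>x. \<theta> x \<le> 1) \<and> (\<forall>x\<in>K. \<theta> x = 1)" for i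
    using smooth_cutoff[OF K(1), of "W i"] by (metis subsetD)
  then obtain \<theta> where \<theta>: "\<And>i. test_fn (W i) (\<theta> i)" "\<And>i x. 0 \<le> \<theta> i x" "\<And>i x. \<theta> i x \<le> 1"
    "\<And>i x. x \<in> K \<Longrightarrow> \<theta> i x = 1" by metis
  have "(\<lambda>i. \<theta> i x) \<longlonglongrightarrow> indicator K x" for x
  proof (cases "x \<in> K")
    case False
    then have "infdist x K > 0"
      using in_closed_iff_infdist_zero[OF compact_imp_closed[OF K(1)] K(2), of x] infdist_nonneg[of x K] by linarith
    then obtain i0 where i0: "1 / real (Suc i0) < infdist x K" using nat_approx_posE by blast
    have "\<theta> i x = 0" if "i \<ge> i0" for i
    proof -
      have "1 / real (Suc i) \<le> 1 / real (Suc i0)" using that by (intro divide_left_mono) auto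
      then have "x \<notin> W i" using i0 by (auto simp: W_def)
      then have "x \<notin> supp (\<theta> i)" using \<theta>(1)[of i] by (auto simp: test_fn_def)
      then show ?thesis by (rule not_in_supp)
    qed
    then have "(\<lambda>i. \<theta> i x) \<longlonglongrightarrow> 0"
      by (intro tendsto_eventually) (auto simp: eventually_sequentially)
    with False show ?thesis by simp
  qed (simp add: \<theta>)
  moreover have "test_fn U (\<theta> i)" for i using \<theta>(1)[of i] by (auto simp: test_fn_def W_def)
  ultimately show ?thesis using that \<theta> by blast
qed

lemma mass_rep_cutoff_limit:
  assumes rep: "mass_rep S \<nu> V" and X: "tuple_test_form X" and K: "compact K"
    and \<theta>: "\<And>i. smooth (\<theta> i)" "\<And>i x. 0 \<le> \<theta> i x" "\<And>i x. \<theta> i x \<le> (1::real)"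
      "\<And>x. (\<lambda>i. \<theta> i x) \<longlonglongrightarrow> indicator K x"
  shows "(\<lambda>i. tuple_apply S (\<lambda>x. \<theta> i x *\<^sub>R X x)) \<longlonglongrightarrow> (\<integral>x. indicator K x * (X x \<bullet> V x) \<partial>\<nu>)"
proof -
  have s[measurable_cong]: "sets \<nu> = sets borel" using rep by (simp add: mass_rep_def radon_def)
  have [measurable]: "K \<in> sets borel" using compact_imp_closed[OF K] by simp
  have i: "integrable \<nu> (\<lambda>x. X x \<bullet> V x)" by (rule mass_rep_apply[OF rep X])
  have "(\<lambda>i. \<integral>x. (\<theta> i x *\<^sub>R X x) \<bullet> V x \<partial>\<nu>) \<longlonglongrightarrow> (\<integral>x. indicator K x * (X x \<bullet> V x) \<partial>\<nu>)"
  proof (rule integral_dominated_convergence[where w = "\<lambda>x. norm (X x \<bullet> V x)"])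
    show "(\<lambda>x. indicator K x * (X x \<bullet> V x)) \<in> borel_measurable \<nu>"
      using i by measurable
    show "(\<lambda>x. (\<theta> i x *\<^sub>R X x) \<bullet> V x) \<in> borel_measurable \<nu>" for i
      using mass_rep_apply(1)[OF rep tuple_test_form_mult[OF \<theta>(1) X], of i] by auto
    show "integrable \<nu> (\<lambda>x. norm (X x \<bullet> V x))" using i by simp
    show "AE x in \<nu>. (\<lambda>i. (\<theta> i x *\<^sub>R X x) \<bullet> V x) \<longlonglongrightarrow> indicator K x * (X x \<bullet> V x)"
      using tendsto_mult[OF \<theta>(4) tendsto_const] by (intro AE_I2) simp
    show "AE x in \<nu>. norm ((\<theta> i x *\<^sub>R X x) \<bullet> V x) \<le> norm (X x \<bullet> V x)" for i
      using \<theta>(2,3) by (intro AE_I2) (simp add: abs_mult mult_left_le_one_le)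
  qed
  then show ?thesis
    by (simp only: mass_rep_apply(2)[OF rep tuple_test_form_mult[OF \<theta>(1) X]])
qed

text \<open>The variational origin of T enters only through \<open>Tjac\<close>, the absence of
  boundary, and \<open>cal\<close>, the almost calibration. The error 2 \<kappa> in the proof has
  two sources: one \<kappa> for replacing the mass by the value on a test form, one for replacing
  that form by the calibration.\<close>

lemma calibrated_mass_le:
  fixes S T :: "'m::finite \<Rightarrow> (real^'n::finite \<Rightarrow> real^'n) \<Rightarrow> real"
  assumes \<Omega>: "open \<Omega>" and K: "compact K" "K \<subseteq> \<Omega>"
    and repS: "mass_rep S \<nu>S VS" and repT: "mass_rep T \<nu>T VT"
    and bdS: "supp_bd S \<inter> \<Omega> = {}"
    and eq: "\<And>\<omega>. tuple_test_form \<omega> \<Longrightarrow> (\<And>k. supp (\<lambda>x. \<omega> x $ k) \<subseteq> \<Omega>) \<Longrightarrow> (\<And>x. x \<in> K \<Longrightarrow> \<omega> x = 0) \<Longrightarrow>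
        tuple_apply S \<omega> = tuple_apply T \<omega>"
    and Tjac: "\<And>\<Psi>. test_vec \<Omega> \<Psi> \<Longrightarrow> tuple_apply T (jac \<Psi>) = 0"
    and cal: "\<And>\<zeta> \<kappa>. test_fn \<Omega> \<zeta> \<Longrightarrow> (\<And>x. 0 \<le> \<zeta> x) \<Longrightarrow> (\<And>x. \<zeta> x \<le> 1) \<Longrightarrow> \<kappa> > 0 \<Longrightarrow>
      \<exists>\<Psi>. test_vec \<Omega> \<Psi> \<and> (\<forall>x\<in>supp \<zeta>. norm (jac \<Psi> x) \<le> 1) \<and>
        (\<forall>\<phi>. tuple_test_form \<phi> \<and> (\<forall>x. norm (\<phi> x) \<le> \<zeta> x) \<longrightarrow>
          tuple_apply T \<phi> \<le> tuple_apply T (\<lambda>x. \<zeta> x *\<^sub>R jac \<Psi> x) + \<kappa>)"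
  shows "emeasure \<nu>T K \<le> emeasure \<nu>S K"
proof (cases "K = {}")
  case False
  have rS: "radon \<nu>S" and rT: "radon \<nu>T" and VTm: "VT \<in> borel_measurable borel"
    using repS repT by (auto simp: mass_rep_def)
  have sets[measurable_cong]: "sets \<nu>S = sets borel" "sets \<nu>T = sets borel" using rS rT by (auto simp: radon_def)
  have [measurable]: "K \<in> sets borel" using compact_imp_closed[OF K(1)] by simp
  have iKS: "integrable \<nu>S (indicator K :: _ \<Rightarrow> real)" and iKT: "integrable \<nu>T (indicator K :: _ \<Rightarrow> real)"
    using radon_integrable_indicator[OF _ K(1)] rS rT by auto
  note VS1 = mass_rep_norm[OF repS] and VT1 = mass_rep_norm[OF repT]
  obtain \<zeta> N where \<zeta>: "test_fn \<Omega> \<zeta>" "\<And>x. 0 \<le> \<zeta> x" "\<And>x. \<zeta> x \<le> 1" "K \<subseteq> N" "\<And>x. x \<in> N \<Longrightarrow> \<zeta> x = 1"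
    using smooth_cutoff[OF K(1) \<Omega> K(2)] by metis
  have \<zeta>s: "smooth \<zeta>" and \<zeta>c: "compact (supp \<zeta>)" using \<zeta>(1) by (auto simp: test_fn_def)
  have \<zeta>K: "\<zeta> x = 1" "x \<in> supp \<zeta>" if "x \<in> K" for x
    using \<zeta>(4,5) that not_in_supp[of x \<zeta>] by (auto, metis subsetD zero_neq_one)
  have [measurable]: "\<zeta> \<in> borel_measurable borel" by (rule smooth_borel[OF \<zeta>s])
  have i\<zeta>: "integrable \<nu>T \<zeta>"
  proof (rule Bochner_Integration.integrable_bound[OF radon_integrable_indicator[OF rT \<zeta>c]])
    show "AE x in \<nu>T. norm (\<zeta> x) \<le> norm (indicator (supp \<zeta>) x :: real)"
      using \<zeta>(2,3) not_in_supp[of _ \<zeta>] by (intro AE_I2) (auto simp: indicator_def)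
  qed measurable
  have main: "measure \<nu>T K \<le> measure \<nu>S K + 2 * \<kappa>" if \<kappa>: "\<kappa> > 0" for \<kappa>
  proof -
    obtain \<Psi> where \<Psi>: "test_vec \<Omega> \<Psi>" "\<And>x. x \<in> supp \<zeta> \<Longrightarrow> norm (jac \<Psi> x) \<le> 1"
      "\<And>\<phi>. tuple_test_form \<phi> \<Longrightarrow> (\<And>x. norm (\<phi> x) \<le> \<zeta> x) \<Longrightarrow>
        tuple_apply T \<phi> \<le> tuple_apply T (\<lambda>x. \<zeta> x *\<^sub>R jac \<Psi> x) + \<kappa>"
      using cal[OF \<zeta>(1-3) \<kappa>] by blast
    define X where "X = jac \<Psi>"
    have X: "tuple_test_form X"
      using tuple_test_form_scaleR_jac[OF smooth_const[of 1] \<Psi>(1)] by (simp add: X_def)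
    have Xsupp: "supp X \<subseteq> \<Omega>"
    proof -
      have "supp X \<subseteq> supp \<Psi>" unfolding X_def by (rule supp_subset) (auto simp: jac_not_in_supp)
      then show ?thesis using \<Psi>(1) by (auto simp: test_vec_def)
    qed
    note XS = mass_rep_apply[OF repS X] and XT = mass_rep_apply[OF repT X]
    obtain \<theta> :: "nat \<Rightarrow> real^'n \<Rightarrow> real" where \<theta>: "\<And>i. test_fn \<Omega> (\<theta> i)" "\<And>i x. 0 \<le> \<theta> i x" "\<And>i x. \<theta> i x \<le> 1"
      "\<And>i x. x \<in> K \<Longrightarrow> \<theta> i x = 1" "\<And>x. (\<lambda>i. \<theta> i x) \<longlonglongrightarrow> indicator K x"
      using shrinking_cutoffs[OF K(1) False \<Omega> K(2)] by blast
    have \<theta>s: "smooth (\<theta> i)" for i using \<theta>(1) by (simp add: test_fn_def)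
    \<comment> \<open>\<open>?Z\<close> vanishes on K, so the hypothesis on S and T applies to it.
      Both currents vanish on the sum X of \<open>?Y\<close> and \<open>?Z\<close>, so agreement
      passes from \<open>?Z\<close> to \<open>?Y\<close>.\<close>
    have "tuple_apply S (\<lambda>x. \<theta> i x *\<^sub>R X x) = tuple_apply T (\<lambda>x. \<theta> i x *\<^sub>R X x)" for i
    proof -
      let ?Y = "\<lambda>x. \<theta> i x *\<^sub>R X x" and ?Z = "\<lambda>x. (1 - \<theta> i x) *\<^sub>R X x"
      have Y: "tuple_test_form ?Y" and Z: "tuple_test_form ?Z"
        by (intro tuple_test_form_mult smooth_diff smooth_const \<theta>s X)+
      have "tuple_apply S ?Z = tuple_apply T ?Z"
      proof (rule eq[OF Z])
        show "supp (\<lambda>x. ?Z x $ k) \<subseteq> \<Omega>" for k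
          by (rule order_trans[OF supp_subset[OF _ closed_supp] Xsupp]) (auto simp: not_in_supp)
      qed (simp add: \<theta>)
      moreover have "tuple_apply S X = 0" "tuple_apply T X = 0"
        unfolding X_def using tuple_apply_jac_eq_0[OF repS bdS \<Psi>(1)] Tjac[OF \<Psi>(1)] by auto
      moreover have "tuple_apply C X = tuple_apply C ?Y + tuple_apply C ?Z"
        if "mass_rep C \<nu> V" for C :: "'m \<Rightarrow> (real^'n \<Rightarrow> real^'n) \<Rightarrow> real" and \<nu> V
      proof -
        have "tuple_apply C X = (\<integral>x. ?Y x \<bullet> V x + ?Z x \<bullet> V x \<partial>\<nu>)"
          unfolding mass_rep_apply(2)[OF that X] by (simp add: algebra_simps)
        then show ?thesis
          using mass_rep_apply[OF that Y] mass_rep_apply[OF that Z] by simp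
      qed
      note this[OF repS] this[OF repT]
      ultimately show ?thesis by linarith
    qed
    then have KK: "(\<integral>x. indicator K x * (X x \<bullet> VS x) \<partial>\<nu>S) = (\<integral>x. indicator K x * (X x \<bullet> VT x) \<partial>\<nu>T)"
      using mass_rep_cutoff_limit[OF repS X K(1) \<theta>s \<theta>(2,3,5)] mass_rep_cutoff_limit[OF repT X K(1) \<theta>s \<theta>(2,3,5)]
      by (simp add: LIMSEQ_unique)
    have iXS: "integrable \<nu>S (\<lambda>x. indicator K x * (X x \<bullet> VS x))" and iXT: "integrable \<nu>T (\<lambda>x. indicator K x * (X x \<bullet> VT x))"
      using integrable_bounded_scaleR[OF XS(1), of "indicator K" 1] integrable_bounded_scaleR[OF XT(1), of "indicator K" 1]
      by (auto simp: sets indicator_def)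
    have S1: "(\<integral>x. indicator K x * (X x \<bullet> VS x) \<partial>\<nu>S) \<le> (\<integral>x. indicator K x \<partial>\<nu>S)"
    proof (rule integral_mono_AE[OF iXS iKS])
      show "AE x in \<nu>S. indicator K x * (X x \<bullet> VS x) \<le> (indicator K x :: real)"
        using VS1
      proof eventually_elim
        case (elim x)
        then show ?case
          using Cauchy_Schwarz_ineq2[of "X x" "VS x"] \<Psi>(2)[of x] \<zeta>K(2)[of x] by (auto simp: indicator_def X_def)
      qed
    qed
    obtain \<phi> where \<phi>: "tuple_test_form \<phi>" "\<And>x. norm (\<phi> x) \<le> \<zeta> x"
      "(\<integral>x. \<zeta> x \<partial>\<nu>T) \<le> (\<integral>x. \<phi> x \<bullet> VT x \<partial>\<nu>T) + \<kappa>"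
      using mass_approx[OF rT VTm VT1 \<zeta>(1-3) \<kappa>] by blast
    have \<zeta>X: "tuple_test_form (\<lambda>x. \<zeta> x *\<^sub>R X x)" by (rule tuple_test_form_mult[OF \<zeta>s X])
    note \<zeta>XT = mass_rep_apply[OF repT \<zeta>X]
    have T1: "(\<integral>x. \<zeta> x \<partial>\<nu>T) \<le> (\<integral>x. (\<zeta> x *\<^sub>R X x) \<bullet> VT x \<partial>\<nu>T) + 2 * \<kappa>"
      using \<Psi>(3)[OF \<phi>(1,2)] \<phi>(3) mass_rep_apply(2)[OF repT \<phi>(1)] \<zeta>XT(2) by (simp add: X_def)
    \<comment> \<open>The defect \<zeta> (1 - X . VT) is nonnegative because |X| \<le> 1 on supp
      \<zeta>, so the part on K is controlled by the total defect, which is at most 2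
      \<kappa>.\<close>
    have "(\<integral>x. indicator K x - indicator K x * (X x \<bullet> VT x) \<partial>\<nu>T) \<le> (\<integral>x. \<zeta> x - (\<zeta> x *\<^sub>R X x) \<bullet> VT x \<partial>\<nu>T)"
    proof (rule integral_mono_AE)
      show "AE x in \<nu>T. indicator K x - indicator K x * (X x \<bullet> VT x) \<le> \<zeta> x - (\<zeta> x *\<^sub>R X x) \<bullet> VT x"
        using VT1
      proof eventually_elim
        case (elim x)
        show ?case
        proof (cases "x \<in> supp \<zeta>")
          case True
          then have "X x \<bullet> VT x \<le> 1"
            using Cauchy_Schwarz_ineq2[of "X x" "VT x"] \<Psi>(2)[of x] elim by (auto simp: X_def)
          then have "\<zeta> x * (1 - X x \<bullet> VT x) \<ge> 0" using \<zeta>(2)[of x] by simp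
          then show ?thesis using \<zeta>K(1)[of x] by (auto simp: indicator_def algebra_simps)
        next
          case False
          then show ?thesis using \<zeta>K(2)[of x] not_in_supp[OF False] by (auto simp: indicator_def)
        qed
      qed
    qed (use iKT iXT i\<zeta> \<zeta>XT(1) in auto)
    then have "(\<integral>x. indicator K x \<partial>\<nu>T) \<le> (\<integral>x. indicator K x * (X x \<bullet> VT x) \<partial>\<nu>T) + 2 * \<kappa>"
      using T1 iKT iXT i\<zeta> \<zeta>XT(1) by simp
    with S1 KK show ?thesis
      using sets_eq_imp_space_eq[OF sets(1)] sets_eq_imp_space_eq[OF sets(2)] by simp
  qed
  have "measure \<nu>T K \<le> measure \<nu>S K"
  proof (rule field_le_epsilon)
    show "measure \<nu>T K \<le> measure \<nu>S K + e" if "0 < e" for e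
      using main[of "e / 2"] that by simp
  qed
  moreover have "emeasure \<nu> K = ennreal (measure \<nu> K)" if "radon \<nu>" for \<nu> :: "(real^'n) measure"
    using that K(1) by (intro emeasure_eq_ennreal_measure) (auto simp: radon_def)
  ultimately show ?thesis using rS rT by (simp add: ennreal_leI)
qed simp

text \<open>By \<open>mass_approx\<close>, integrals of cutoffs against the mass are approximated by
  values on test forms, all of which are 0 here.\<close>

lemma mass_eq_0_of_zero:
  assumes K: "compact K" and rep: "mass_rep T \<nu> V" and zero: "\<And>\<phi>. tuple_test_form \<phi> \<Longrightarrow> tuple_apply T \<phi> = 0"
  shows "emeasure \<nu> K = 0"
proof -
  have r: "radon \<nu>" and Vm: "V \<in> borel_measurable borel" using rep by (auto simp: mass_rep_def)
  have sets[measurable_cong]: "sets \<nu> = sets borel" using r by (auto simp: radon_def)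
  obtain \<zeta> N where \<zeta>: "test_fn UNIV \<zeta>" "\<And>x. 0 \<le> \<zeta> x" "\<And>x. \<zeta> x \<le> 1" "K \<subseteq> N" "\<And>x. x \<in> N \<Longrightarrow> \<zeta> x = 1"
    using smooth_cutoff[OF K open_UNIV] by (metis subset_UNIV)
  have \<zeta>s: "smooth \<zeta>" and \<zeta>c: "compact (supp \<zeta>)" using \<zeta>(1) by (auto simp: test_fn_def)
  have [measurable]: "\<zeta> \<in> borel_measurable borel" by (rule smooth_borel[OF \<zeta>s])
  have i\<zeta>: "integrable \<nu> \<zeta>"
  proof (rule Bochner_Integration.integrable_bound[OF radon_integrable_indicator[OF r \<zeta>c]])
    show "AE x in \<nu>. norm (\<zeta> x) \<le> norm (indicator (supp \<zeta>) x :: real)"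
      using \<zeta>(2,3) not_in_supp[of _ \<zeta>] by (intro AE_I2) (auto simp: indicator_def)
  qed measurable
  have "measure \<nu> K \<le> 0 + \<kappa>" if \<kappa>: "\<kappa> > 0" for \<kappa>
  proof -
    obtain \<phi> where "tuple_test_form \<phi>" "(\<integral>x. \<zeta> x \<partial>\<nu>) \<le> (\<integral>x. \<phi> x \<bullet> V x \<partial>\<nu>) + \<kappa>"
      using mass_approx[OF r Vm mass_rep_norm[OF rep] \<zeta>(1-3) \<kappa>] by blast
    then have "(\<integral>x. \<zeta> x \<partial>\<nu>) \<le> \<kappa>" using mass_rep_apply(2)[OF rep] zero by simp
    moreover have "(\<integral>x. indicator K x \<partial>\<nu>) \<le> (\<integral>x. \<zeta> x \<partial>\<nu>)"
      using \<zeta> by (intro integral_mono radon_integrable_indicator[OF r K] i\<zeta>) (auto simp: indicator_def)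
    ultimately show ?thesis using sets_eq_imp_space_eq[OF sets] by simp
  qed
  then have "measure \<nu> K \<le> 0" by (rule field_le_epsilon)
  moreover have "emeasure \<nu> K = ennreal (measure \<nu> K)"
    using r K by (intro emeasure_eq_ennreal_measure) (auto simp: radon_def)
  ultimately show ?thesis by (simp add: ennreal_neg)
qed

subsection \<open>Borel representatives\<close>

lemma borel_measurable_vec_nth [measurable (raw)]:
  fixes f :: "'a \<Rightarrow> 'b::euclidean_space^'m::finite"
  assumes "f \<in> borel_measurable M"
  shows "(\<lambda>x. f x $ k) \<in> borel_measurable M"
  by (rule measurable_compose[OF assms borel_measurable_continuous_onI]) (intro continuous_intros)

text \<open>The definitions integrate Lebesgue measurable functions over \<Omega>, while convolution
  and Tonelli are carried out with Borel functions on the whole space. Extension of a Borel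
  representative by 0 translates between the two settings.\<close>

lemma lebesgue_on_transfer:
  fixes f g :: "real^'n::finite \<Rightarrow> 'b::euclidean_space"
  assumes \<Omega>: "\<Omega> \<in> sets borel" and g: "g \<in> borel_measurable borel" "\<And>x. x \<notin> \<Omega> \<Longrightarrow> g x = 0"
    and fg: "AE x in lborel. x \<in> \<Omega> \<longrightarrow> f x = g x"
  shows "f \<in> borel_measurable (lebesgue_on \<Omega>)"
    and "integrable (lebesgue_on \<Omega>) f \<longleftrightarrow> integrable lborel g"
    and "(\<integral>x. f x \<partial>lebesgue_on \<Omega>) = (\<integral>x. g x \<partial>lborel)"
proof -
  have \<Omega>': "\<Omega> \<inter> space lebesgue \<in> sets lebesgue" using \<Omega> by simp
  let ?F = "\<lambda>x. indicator \<Omega> x *\<^sub>R f x"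
  have gm: "g \<in> borel_measurable lebesgue" using g(1) by (intro measurable_completion) simp
  have ae: "AE x in lebesgue. g x = ?F x"
    using AE_completion[OF fg] by eventually_elim (use g(2) in \<open>auto simp: indicator_def\<close>)
  have Fm: "?F \<in> borel_measurable lebesgue" by (rule borel_measurable_AE[OF gm ae])
  have ae': "AE x in lebesgue. ?F x = g x" using ae by eventually_elim simp
  show "f \<in> borel_measurable (lebesgue_on \<Omega>)"
    using Fm borel_measurable_restrict_space_iff[OF \<Omega>', of f] by simp
  show "integrable (lebesgue_on \<Omega>) f \<longleftrightarrow> integrable lborel g"
    using integrable_restrict_space[OF \<Omega>', of f] integrable_cong_AE[OF Fm gm ae'] integrable_completion[of g lborel] g(1)
    by simp
  show "(\<integral>x. f x \<partial>lebesgue_on \<Omega>) = (\<integral>x. g x \<partial>lborel)"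
    using integral_restrict_space[OF \<Omega>', of f] integral_cong_AE[OF Fm gm ae'] integral_completion[of g lborel] g(1)
    by simp
qed

lemma ex_borel_rep:
  fixes f :: "real^'n::finite \<Rightarrow> 'b::euclidean_space"
  assumes \<Omega>: "\<Omega> \<in> sets borel" and f: "f \<in> borel_measurable (lebesgue_on \<Omega>)"
  obtains g where "g \<in> borel_measurable borel" "\<And>x. x \<notin> \<Omega> \<Longrightarrow> g x = 0" "AE x in lborel. x \<in> \<Omega> \<longrightarrow> f x = g x"
proof -
  let ?F = "\<lambda>x. if x \<in> \<Omega> then f x else 0"
  have Fm: "?F \<in> borel_measurable lebesgue" by (rule borel_measurable_if_I[OF f]) (use \<Omega> in simp)
  have "\<exists>h\<in>borel_measurable lborel. AE x in lborel. ?F x \<bullet> b = h x" for b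
    using Fm by (intro completion_ex_borel_measurable_real borel_measurable_inner) auto
  then have "\<exists>h. \<forall>b. h b \<in> borel_measurable lborel \<and> (AE x in lborel. ?F x \<bullet> b = h b x)"
    by (intro choice allI) blast
  then obtain h where h: "\<And>b. h b \<in> borel_measurable lborel" "\<And>b. AE x in lborel. ?F x \<bullet> b = h b x"
    by blast
  define g where "g x = indicator \<Omega> x *\<^sub>R (\<Sum>b\<in>Basis. h b x *\<^sub>R b)" for x
  have "g \<in> borel_measurable borel" unfolding g_def using h(1) \<Omega> by measurable
  moreover have "AE x in lborel. \<forall>b\<in>Basis. ?F x \<bullet> b = h b x"
    using h(2) by (intro AE_finite_allI) auto
  then have "AE x in lborel. x \<in> \<Omega> \<longrightarrow> f x = g x"
  proof eventually_elim
    case (elim x)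
    show ?case
    proof
      assume x: "x \<in> \<Omega>"
      then have "g x = (\<Sum>b\<in>Basis. (f x \<bullet> b) *\<^sub>R b)"
        unfolding g_def using elim by (simp cong: sum.cong)
      then show "f x = g x" by (simp add: euclidean_representation)
    qed
  qed
  ultimately show ?thesis using that[of g] by (auto simp: g_def)
qed

section \<open>Powers, weak gradients and weak limits of the representatives\<close>

lemma borel_imp_lebesgue_on: "f \<in> borel_measurable borel \<Longrightarrow> f \<in> borel_measurable (lebesgue_on \<Omega>)"
  by (intro measurable_restrict_space1 measurable_completion) simp

lemma powr_add_le:
  assumes "a \<ge> 0" "b \<ge> 0" "p \<ge> (0::real)"
  shows "(a + b) powr p \<le> 2 powr p * (a powr p + b powr p)"
proof -
  have "(a + b) powr p \<le> (2 * max a b) powr p" using assms by (intro powr_mono2) auto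
  also have "\<dots> = 2 powr p * max a b powr p" using assms by (simp add: powr_mult)
  also have "\<dots> \<le> 2 powr p * (a powr p + b powr p)" by (intro mult_left_mono) (auto simp: max_def)
  finally show ?thesis .
qed

lemma Lp_add:
  assumes f: "Lp \<Omega> p f" and g: "Lp \<Omega> p g" and p: "p \<ge> 0"
  shows "Lp \<Omega> p (\<lambda>x. f x + g x)"
proof -
  have [measurable]: "f \<in> borel_measurable (lebesgue_on \<Omega>)" "g \<in> borel_measurable (lebesgue_on \<Omega>)"
    using f g by (auto simp: Lp_def)
  have "integrable (lebesgue_on \<Omega>) (\<lambda>x. norm (f x + g x) powr p)"
  proof (rule Bochner_Integration.integrable_bound)
    show "integrable (lebesgue_on \<Omega>) (\<lambda>x. 2 powr p * (norm (f x) powr p + norm (g x) powr p))"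
      using f g by (auto simp: Lp_def)
    show "AE x in lebesgue_on \<Omega>. norm (norm (f x + g x) powr p) \<le> norm (2 powr p * (norm (f x) powr p + norm (g x) powr p))"
    proof (rule AE_I2)
      fix x
      have "norm (f x + g x) powr p \<le> (norm (f x) + norm (g x)) powr p"
        using p by (intro powr_mono2 norm_triangle_ineq) auto
      then show "norm (norm (f x + g x) powr p) \<le> norm (2 powr p * (norm (f x) powr p + norm (g x) powr p))"
        using powr_add_le[of "norm (f x)" "norm (g x)" p] p by simp
    qed
  qed measurable
  moreover have "(\<lambda>x. f x + g x) \<in> borel_measurable (lebesgue_on \<Omega>)" by measurable
  ultimately show ?thesis by (simp add: Lp_def)
qed

lemma Lp_bounded:
  fixes f :: "real^'n::finite \<Rightarrow> 'b::euclidean_space"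
  assumes \<Omega>: "open \<Omega>" "bounded \<Omega>" and f: "f \<in> borel_measurable borel" "\<And>x. norm (f x) \<le> C" and p: "p \<ge> 0"
  shows "Lp \<Omega> p f"
proof -
  have "\<Omega> \<in> lmeasurable" using \<Omega> by (simp add: lmeasurable_open)
  then interpret finite_measure "lebesgue_on \<Omega>" by (rule finite_measure_lebesgue_on)
  have fm[measurable]: "f \<in> borel_measurable (lebesgue_on \<Omega>)" by (rule borel_imp_lebesgue_on[OF f(1)])
  have "integrable (lebesgue_on \<Omega>) (\<lambda>x. norm (f x) powr p)"
    using f(2) p by (intro integrable_const_bound[of _ "C powr p"]) (auto intro!: powr_mono2)
  with fm show ?thesis by (simp add: Lp_def)
qed

lemma Lp_rep:
  fixes f g :: "real^'n::finite \<Rightarrow> 'b::euclidean_space"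
  assumes \<Omega>: "\<Omega> \<in> sets borel" and g: "g \<in> borel_measurable borel" "\<And>x. x \<notin> \<Omega> \<Longrightarrow> g x = 0"
    and fg: "AE x in lborel. x \<in> \<Omega> \<longrightarrow> f x = g x" and p: "p > 0"
  shows "integrable (lebesgue_on \<Omega>) (\<lambda>x. norm (f x) powr p) \<longleftrightarrow> integrable lborel (\<lambda>x. norm (g x) powr p)"
    and "(\<integral>x. norm (f x) powr p \<partial>lebesgue_on \<Omega>) = (\<integral>x. norm (g x) powr p \<partial>lborel)"
proof -
  have ae: "AE x in lborel. x \<in> \<Omega> \<longrightarrow> norm (f x) powr p = norm (g x) powr p"
    using fg by eventually_elim auto
  have m: "(\<lambda>x. norm (g x) powr p) \<in> borel_measurable borel" using g(1) by measurable
  show "integrable (lebesgue_on \<Omega>) (\<lambda>x. norm (f x) powr p) \<longleftrightarrow> integrable lborel (\<lambda>x. norm (g x) powr p)"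
    by (rule lebesgue_on_transfer(2)[OF \<Omega> m _ ae]) (use g(2) in auto)
  show "(\<integral>x. norm (f x) powr p \<partial>lebesgue_on \<Omega>) = (\<integral>x. norm (g x) powr p \<partial>lborel)"
    by (rule lebesgue_on_transfer(3)[OF \<Omega> m _ ae]) (use g(2) in auto)
qed

lemma integrable_of_powr:
  fixes g :: "real^'n::finite \<Rightarrow> 'b::euclidean_space"
  assumes \<Omega>: "open \<Omega>" "bounded \<Omega>" and g: "g \<in> borel_measurable borel" "\<And>x. x \<notin> \<Omega> \<Longrightarrow> g x = 0" and p: "p > 1"
    and gp: "integrable lborel (\<lambda>x. norm (g x) powr p)"
  shows "integrable lborel g"
proof (rule Bochner_Integration.integrable_bound)
  have "integrable lborel (indicator \<Omega> :: _ \<Rightarrow> real)"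
    using \<Omega> emeasure_bounded_finite[OF \<Omega>(2)] by (intro integrable_real_indicator) auto
  then show "integrable lborel (\<lambda>x. indicator \<Omega> x + norm (g x) powr p)" using gp by auto
  show "g \<in> borel_measurable lborel" using g(1) by simp
  show "AE x in lborel. norm (g x) \<le> norm (indicator \<Omega> x + norm (g x) powr p)"
  proof (rule AE_I2)
    fix x
    show "norm (g x) \<le> norm (indicator \<Omega> x + norm (g x) powr p)"
      using powr_mult_le_add[OF p, of 1 "norm (g x)"] g(2)[of x] by (cases "x \<in> \<Omega>") auto
  qed
qed

lemma wgrad_rep:
  fixes u :: "real^'n::finite \<Rightarrow> real^'m::finite"
  assumes \<Omega>: "open \<Omega>" "bounded \<Omega>" and uD: "weak_grad \<Omega> u D"
    and w: "w \<in> borel_measurable borel" "\<And>x. x \<notin> \<Omega> \<Longrightarrow> w x = 0" "AE x in lborel. x \<in> \<Omega> \<longrightarrow> u x = w x" "integrable lborel w"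
    and G: "G \<in> borel_measurable borel" "\<And>x. x \<notin> \<Omega> \<Longrightarrow> G x = 0" "AE x in lborel. x \<in> \<Omega> \<longrightarrow> D x = G x" "integrable lborel G"
  shows "wgrad \<Omega> w G"
  unfolding wgrad_def
proof (intro conjI allI impI w(4) G(4))
  fix \<phi> :: "real^'n \<Rightarrow> real" and k :: 'm and j :: 'n assume \<phi>: "test_fn \<Omega> \<phi>"
  have \<Omega>m: "\<Omega> \<in> sets borel" using \<Omega> by simp
  have \<phi>m[measurable]: "\<phi> \<in> borel_measurable borel" "pd j \<phi> \<in> borel_measurable borel"
    using \<phi> by (auto simp: test_fn_def intro: smooth_borel smooth_pd)
  have 1: "(\<integral>x. u x $ k * pd j \<phi> x \<partial>lebesgue_on \<Omega>) = (\<integral>x. w x $ k * pd j \<phi> x \<partial>lborel)"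
  proof (rule lebesgue_on_transfer(3)[OF \<Omega>m])
    show "(\<lambda>x. w x $ k * pd j \<phi> x) \<in> borel_measurable borel" using w(1) by measurable
    show "AE x in lborel. x \<in> \<Omega> \<longrightarrow> u x $ k * pd j \<phi> x = w x $ k * pd j \<phi> x"
      using w(3) by eventually_elim auto
  qed (simp add: w(2))
  have 2: "(\<integral>x. D x $ k $ j * \<phi> x \<partial>lebesgue_on \<Omega>) = (\<integral>x. G x $ k $ j * \<phi> x \<partial>lborel)"
  proof (rule lebesgue_on_transfer(3)[OF \<Omega>m])
    show "(\<lambda>x. G x $ k $ j * \<phi> x) \<in> borel_measurable borel" using G(1) by measurable
    show "AE x in lborel. x \<in> \<Omega> \<longrightarrow> D x $ k $ j * \<phi> x = G x $ k $ j * \<phi> x"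
      using G(3) by eventually_elim auto
  qed (simp add: G(2))
  show "(\<integral>x. w x $ k * pd j \<phi> x \<partial>lborel) = - (\<integral>x. G x $ k $ j * \<phi> x \<partial>lborel)"
    using uD \<phi> 1 2 by (simp add: weak_grad_def)
qed

lemma wgrad_scaleR:
  assumes "wgrad \<Omega> w G" shows "wgrad \<Omega> (\<lambda>x. c *\<^sub>R w x) (\<lambda>x. c *\<^sub>R G x)"
  using assms by (auto simp: wgrad_def mult.assoc)

text \<open>For fixed x, each component of a convolution at x is a pairing with the bounded field
  \<open>\<eta> (x - y) b\<close>, which is admissible for weak convergence because \<Omega> is
  bounded.\<close>

lemma conv_tendsto_of_weak:
  fixes f :: "nat \<Rightarrow> real^'n::finite \<Rightarrow> 'b::euclidean_space"
  assumes \<Omega>: "open \<Omega>" "bounded \<Omega>" and q: "q \<ge> 0"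
    and weak: "\<And>h. Lp \<Omega> q h \<Longrightarrow>
        (\<lambda>l. \<integral>x. f l x \<bullet> h x \<partial>lebesgue_on \<Omega>) \<longlonglongrightarrow> (\<integral>x. f0 x \<bullet> h x \<partial>lebesgue_on \<Omega>)"
    and g: "\<And>l. g l \<in> borel_measurable borel" "\<And>l x. x \<notin> \<Omega> \<Longrightarrow> g l x = 0"
      "\<And>l. AE x in lborel. x \<in> \<Omega> \<longrightarrow> f l x = g l x" "\<And>l. integrable lborel (g l)"
    and g0: "g0 \<in> borel_measurable borel" "\<And>x. x \<notin> \<Omega> \<Longrightarrow> g0 x = 0"
      "AE x in lborel. x \<in> \<Omega> \<longrightarrow> f0 x = g0 x" "integrable lborel g0"
    and \<eta>: "kernel R \<eta>"
  shows "(\<lambda>l. conv \<eta> (g l) x) \<longlonglongrightarrow> conv \<eta> g0 x"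
proof -
  have \<Omega>m: "\<Omega> \<in> sets borel" using \<Omega> by simp
  have [measurable]: "\<eta> \<in> borel_measurable borel" by (rule kernel_borel[OF \<eta>])
  obtain B where B: "B > 0" "\<And>x. \<bar>\<eta> x\<bar> \<le> B" using kernel_bounded[OF \<eta>] by blast
  have eq: "(\<integral>y. a y \<bullet> (\<eta> (x - y) *\<^sub>R b) \<partial>lebesgue_on \<Omega>) = conv \<eta> c x \<bullet> b"
    if c: "c \<in> borel_measurable borel" "\<And>x. x \<notin> \<Omega> \<Longrightarrow> c x = 0" "AE x in lborel. x \<in> \<Omega> \<longrightarrow> a x = c x" "integrable lborel c"
    for a c :: "real^'n \<Rightarrow> 'b" and b
  proof -
    have "(\<integral>y. a y \<bullet> (\<eta> (x - y) *\<^sub>R b) \<partial>lebesgue_on \<Omega>) = (\<integral>y. (\<eta> (x - y) *\<^sub>R c y) \<bullet> b \<partial>lborel)"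
    proof (rule lebesgue_on_transfer(3)[OF \<Omega>m])
      show "(\<lambda>y. (\<eta> (x - y) *\<^sub>R c y) \<bullet> b) \<in> borel_measurable borel" using c(1) by measurable
      show "AE y in lborel. y \<in> \<Omega> \<longrightarrow> a y \<bullet> (\<eta> (x - y) *\<^sub>R b) = (\<eta> (x - y) *\<^sub>R c y) \<bullet> b"
        using c(3) by eventually_elim auto
    qed (simp add: c(2))
    also have "\<dots> = conv \<eta> c x \<bullet> b"
      unfolding conv_def by (rule integral_inner_left) (rule integrable_conv[OF \<eta> c(4)])
    finally show ?thesis .
  qed
  show ?thesis
  proof (subst tendsto_componentwise_iff, intro ballI)
    fix b :: 'b assume b: "b \<in> Basis"
    have "Lp \<Omega> q (\<lambda>y. \<eta> (x - y) *\<^sub>R b)"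
      using B b by (intro Lp_bounded[OF \<Omega> _ _ q, of _ B]) auto
    note w = weak[OF this]
    have e1: "(\<integral>y. f l y \<bullet> (\<eta> (x - y) *\<^sub>R b) \<partial>lebesgue_on \<Omega>) = conv \<eta> (g l) x \<bullet> b" for l
      by (rule eq[OF g])
    have e0: "(\<integral>y. f0 y \<bullet> (\<eta> (x - y) *\<^sub>R b) \<partial>lebesgue_on \<Omega>) = conv \<eta> g0 x \<bullet> b"
      by (rule eq[OF g0])
    show "(\<lambda>l. conv \<eta> (g l) x \<bullet> b) \<longlonglongrightarrow> conv \<eta> g0 x \<bullet> b"
      using w unfolding e1 e0 .
  qed
qed

subsection \<open>The Euler-Lagrange equation\<close>

lemma jac_test_vec_bounded:
  assumes \<psi>: "test_vec \<Omega> \<psi>"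
  obtains C where "C > 0" "\<And>x. norm (\<psi> x) \<le> C" "\<And>x. norm (jac \<psi> x) \<le> C"
    "\<psi> \<in> borel_measurable borel" "jac \<psi> \<in> borel_measurable borel"
proof -
  have s: "smooth (\<lambda>x. \<psi> x $ k)" for k using \<psi> by (simp add: test_vec_def)
  have "bounded (supp \<psi>)" using \<psi> by (simp add: test_vec_def compact_imp_bounded)
  then obtain R where R: "\<And>x. x \<in> supp \<psi> \<Longrightarrow> norm x \<le> R" by (auto simp: bounded_iff)
  have "continuous_on UNIV (\<lambda>x. \<chi> k. \<psi> x $ k)"
    by (intro continuous_on_vec_lambda smooth_continuous_on s)
  then have c: "continuous_on UNIV \<psi>" by simp
  have cj: "continuous_on UNIV (jac \<psi>)" by (rule continuous_jac[OF s])
  have z: "\<psi> x = 0" "jac \<psi> x = 0" if "norm x > R" for x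
    using R[of x] that not_in_supp[of x \<psi>] jac_not_in_supp[of x \<psi>] by auto
  obtain C1 where C1: "C1 > 0" "\<And>x. norm (\<psi> x) \<le> C1"
    using bounded_support_bounded[OF c z(1)] by blast
  obtain C2 where C2: "C2 > 0" "\<And>x. norm (jac \<psi> x) \<le> C2"
    using bounded_support_bounded[OF cj z(2)] by blast
  show ?thesis
    using that[of "max C1 C2"] C1 C2 borel_measurable_continuous_onI[OF c] borel_measurable_continuous_onI[OF cj]
    by (simp add: le_max_iff_disj)
qed

lemma integrable_lebesgue_on_mult:
  fixes f :: "real^'n::finite \<Rightarrow> 'b::euclidean_space"
  assumes f: "integrable (lebesgue_on C) f" and C: "C \<in> sets borel" "C \<subseteq> \<Omega>" and \<Omega>: "\<Omega> \<in> sets borel"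
    and g: "g \<in> borel_measurable borel" "\<And>x. \<bar>g x\<bar> \<le> B" "\<And>x. x \<notin> C \<Longrightarrow> g x = 0"
  shows "integrable (lebesgue_on \<Omega>) (\<lambda>x. g x *\<^sub>R f x)"
proof -
  have "integrable lebesgue (\<lambda>x. indicator C x *\<^sub>R f x)"
    using f C by (subst (asm) integrable_restrict_space) auto
  moreover have "g \<in> borel_measurable lebesgue" using g(1) by (intro measurable_completion) simp
  ultimately have "integrable lebesgue (\<lambda>x. g x *\<^sub>R (indicator C x *\<^sub>R f x))"
    by (rule integrable_bounded_scaleR[OF _ _ g(2)])
  also have "(\<lambda>x. g x *\<^sub>R (indicator C x *\<^sub>R f x)) = (\<lambda>x. indicator \<Omega> x *\<^sub>R (g x *\<^sub>R f x))"
    using g(3) C(2) by (auto simp: fun_eq_iff indicator_def)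
  finally show ?thesis using \<Omega> by (subst integrable_restrict_space) auto
qed

lemma weak_grad_add_test:
  fixes u :: "real^'n::finite \<Rightarrow> real^'m::finite"
  assumes \<Omega>: "open \<Omega>" and u: "weak_grad \<Omega> u D" and \<psi>: "test_vec \<Omega> \<psi>"
  shows "weak_grad \<Omega> (\<lambda>x. u x + s *\<^sub>R \<psi> x) (\<lambda>x. D x + s *\<^sub>R jac \<psi> x)"
proof -
  obtain C where C: "C > 0" "\<And>x. norm (\<psi> x) \<le> C" "\<And>x. norm (jac \<psi> x) \<le> C"
    and m[measurable]: "\<psi> \<in> borel_measurable borel" "jac \<psi> \<in> borel_measurable borel"
    using jac_test_vec_bounded[OF \<psi>] by blast
  have \<Omega>m: "\<Omega> \<in> sets borel" using \<Omega> by simp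
  have \<psi>s: "smooth (\<lambda>x. \<psi> x $ k)" for k using \<psi> by (simp add: test_vec_def)
  have \<psi>\<Omega>: "supp \<psi> \<subseteq> \<Omega>" using \<psi> by (simp add: test_vec_def)
  have c: "integrable (lebesgue_on K) h" if "compact K" "h \<in> borel_measurable borel" "\<And>x. norm (h x) \<le> C"
    for K and h :: "real^'n \<Rightarrow> 'c::euclidean_space"
  proof -
    have "K \<in> lmeasurable" using that(1) by (rule lmeasurable_compact)
    then interpret finite_measure "lebesgue_on K" by (rule finite_measure_lebesgue_on)
    show ?thesis
      using that(3) by (intro integrable_const_bound[of _ C] borel_imp_lebesgue_on that(2)) auto
  qed
  show ?thesis
    unfolding weak_grad_def
  proof (intro conjI allI impI)
    fix K assume K: "compact K \<and> K \<subseteq> \<Omega>"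
    have "integrable (lebesgue_on K) \<psi>" "integrable (lebesgue_on K) (jac \<psi>)"
      using K by (auto intro!: c C m)
    moreover have "integrable (lebesgue_on K) u" "integrable (lebesgue_on K) D"
      using u K by (auto simp: weak_grad_def)
    ultimately show "integrable (lebesgue_on K) (\<lambda>x. u x + s *\<^sub>R \<psi> x)"
      "integrable (lebesgue_on K) (\<lambda>x. D x + s *\<^sub>R jac \<psi> x)" by auto
  next
    fix \<phi> :: "real^'n \<Rightarrow> real" and k :: 'm and j :: 'n assume \<phi>: "test_fn \<Omega> \<phi>"
    define S where "S = supp \<phi>"
    have S: "compact S" "S \<subseteq> \<Omega>" "S \<in> sets borel" and \<phi>s: "smooth \<phi>"
      using \<phi> by (auto simp: test_fn_def S_def)
    obtain R where R: "kernel R \<phi>" using smooth_kernelI[OF \<phi>s] S by (auto simp: S_def)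
    obtain B1 where B1: "\<And>x. \<bar>\<phi> x\<bar> \<le> B1" using kernel_bounded[OF R] by blast
    obtain B2 where B2: "\<And>x. \<bar>pd j \<phi> x\<bar> \<le> B2" using kernel_bounded[OF kernel_pd[OF R]] by blast
    have \<phi>m[measurable]: "\<phi> \<in> borel_measurable borel" "pd j \<phi> \<in> borel_measurable borel"
      using \<phi>s by (auto intro: smooth_borel smooth_pd)
    have \<phi>0: "\<phi> x = 0" "pd j \<phi> x = 0" if "x \<notin> S" for x
      using that not_in_supp[of x \<phi>] pd_not_in_supp[of x \<phi> j] by (auto simp: S_def)
    \<comment> \<open>The Bochner integral of a nonintegrable function is 0 by convention, so
      splitting the sums below needs genuine integrability; the compact support of \<phi> reduces it
      to local integrability.\<close>
    have uS: "integrable (lebesgue_on S) (\<lambda>x. u x $ k)" "integrable (lebesgue_on S) (\<lambda>x. D x $ k $ j)"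
      using u S by (auto simp: weak_grad_def intro!: integrable_nth)
    have pS: "integrable (lebesgue_on S) (\<lambda>x. \<psi> x $ k)" "integrable (lebesgue_on S) (\<lambda>x. jac \<psi> x $ k $ j)"
      by (auto intro!: integrable_nth c S C m)
    have i1: "integrable (lebesgue_on \<Omega>) (\<lambda>x. u x $ k * pd j \<phi> x)" "integrable (lebesgue_on \<Omega>) (\<lambda>x. \<psi> x $ k * pd j \<phi> x)"
      using integrable_lebesgue_on_mult[OF uS(1) S(3,2) \<Omega>m \<phi>m(2) B2 \<phi>0(2)]
        integrable_lebesgue_on_mult[OF pS(1) S(3,2) \<Omega>m \<phi>m(2) B2 \<phi>0(2)] by (simp_all add: mult.commute)
    have i2: "integrable (lebesgue_on \<Omega>) (\<lambda>x. D x $ k $ j * \<phi> x)" "integrable (lebesgue_on \<Omega>) (\<lambda>x. jac \<psi> x $ k $ j * \<phi> x)"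
      using integrable_lebesgue_on_mult[OF uS(2) S(3,2) \<Omega>m \<phi>m(1) B1 \<phi>0(1)]
        integrable_lebesgue_on_mult[OF pS(2) S(3,2) \<Omega>m \<phi>m(1) B1 \<phi>0(1)] by (simp_all add: mult.commute)
    have parts: "(\<integral>x. \<psi> x $ k * pd j \<phi> x \<partial>lebesgue_on \<Omega>) = - (\<integral>x. jac \<psi> x $ k $ j * \<phi> x \<partial>lebesgue_on \<Omega>)"
    proof -
      have z: "\<psi> x $ k * pd j \<phi> x = 0" "jac \<psi> x $ k $ j * \<phi> x = 0" if "x \<notin> \<Omega>" for x
        using that \<phi>0[of x] S(2) by auto
      have "(\<integral>x. \<psi> x $ k * pd j \<phi> x \<partial>lebesgue_on \<Omega>) = (\<integral>x. \<psi> x $ k * pd j \<phi> x \<partial>lborel)"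
        by (rule lebesgue_on_transfer(3)[OF \<Omega>m _ z(1)]) auto
      moreover have "(\<integral>x. jac \<psi> x $ k $ j * \<phi> x \<partial>lebesgue_on \<Omega>) = (\<integral>x. jac \<psi> x $ k $ j * \<phi> x \<partial>lborel)"
        by (rule lebesgue_on_transfer(3)[OF \<Omega>m _ z(2)]) auto
      ultimately show ?thesis
        using integral_by_parts_smooth[OF \<psi>s R, of k j] by (simp add: jac_nth)
    qed
    have "(\<integral>x. (u x + s *\<^sub>R \<psi> x) $ k * pd j \<phi> x \<partial>lebesgue_on \<Omega>)
        = (\<integral>x. u x $ k * pd j \<phi> x + s * (\<psi> x $ k * pd j \<phi> x) \<partial>lebesgue_on \<Omega>)"
      by (simp add: algebra_simps)
    also have "\<dots> = (\<integral>x. u x $ k * pd j \<phi> x \<partial>lebesgue_on \<Omega>) + s * (\<integral>x. \<psi> x $ k * pd j \<phi> x \<partial>lebesgue_on \<Omega>)"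
      using i1 by simp
    also have "\<dots> = - (\<integral>x. D x $ k $ j * \<phi> x \<partial>lebesgue_on \<Omega>) - s * (\<integral>x. jac \<psi> x $ k $ j * \<phi> x \<partial>lebesgue_on \<Omega>)"
      using u \<phi> parts by (simp add: weak_grad_def)
    also have "\<dots> = - (\<integral>x. D x $ k $ j * \<phi> x + s * (jac \<psi> x $ k $ j * \<phi> x) \<partial>lebesgue_on \<Omega>)"
      using i2 by simp
    also have "\<dots> = - (\<integral>x. (D x + s *\<^sub>R jac \<psi> x) $ k $ j * \<phi> x \<partial>lebesgue_on \<Omega>)"
      by (simp add: algebra_simps)
    finally show "(\<integral>x. (u x + s *\<^sub>R \<psi> x) $ k * pd j \<phi> x \<partial>lebesgue_on \<Omega>)
        = - (\<integral>x. (D x + s *\<^sub>R jac \<psi> x) $ k $ j * \<phi> x \<partial>lebesgue_on \<Omega>)" .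
  qed
qed

text \<open>Adding the same test map to the approximating maps and to the limit leaves their
  differences unchanged.\<close>

lemma W0p_add_test:
  fixes w :: "real^'n::finite \<Rightarrow> real^'m::finite"
  assumes \<Omega>: "open \<Omega>" "bounded \<Omega>" and w: "W0p \<Omega> p w" and \<psi>: "test_vec \<Omega> \<psi>" and p: "p \<ge> 0"
  shows "W0p \<Omega> p (\<lambda>x. w x + s *\<^sub>R \<psi> x)"
proof -
  obtain C where C: "C > 0" "\<And>x. norm (\<psi> x) \<le> C" "\<And>x. norm (jac \<psi> x) \<le> C"
    and m[measurable]: "\<psi> \<in> borel_measurable borel" "jac \<psi> \<in> borel_measurable borel"
    using jac_test_vec_bounded[OF \<psi>] by blast
  obtain G \<phi> where G: "W1p \<Omega> p w G" and \<phi>: "\<And>i. test_vec \<Omega> (\<phi> i)"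
    "(\<lambda>i::nat. \<integral>x. norm (\<phi> i x - w x) powr p \<partial>lebesgue_on \<Omega>) \<longlonglongrightarrow> 0"
    "(\<lambda>i. \<integral>x. norm (jac (\<phi> i) x - G x) powr p \<partial>lebesgue_on \<Omega>) \<longlonglongrightarrow> 0"
    using w unfolding W0p_def by blast
  have s: "smooth (\<lambda>x. \<psi> x $ k)" "smooth (\<lambda>x. \<phi> i x $ k)" for i k
    using \<psi> \<phi>(1)[of i] by (auto simp: test_vec_def)
  have b: "norm (s *\<^sub>R \<psi> x) \<le> \<bar>s\<bar> * C" "norm (s *\<^sub>R jac \<psi> x) \<le> \<bar>s\<bar> * C" for x
    using C by (auto intro: mult_left_mono)
  have "Lp \<Omega> p (\<lambda>x. s *\<^sub>R \<psi> x)" "Lp \<Omega> p (\<lambda>x. s *\<^sub>R jac \<psi> x)"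
    by (rule Lp_bounded[OF \<Omega> _ b(1) p], measurable, rule Lp_bounded[OF \<Omega> _ b(2) p], measurable)
  then have "W1p \<Omega> p (\<lambda>x. w x + s *\<^sub>R \<psi> x) (\<lambda>x. G x + s *\<^sub>R jac \<psi> x)"
    using G p weak_grad_add_test[OF \<Omega>(1) _ \<psi>, of w G s] by (auto simp: W1p_def intro: Lp_add)
  moreover have "test_vec \<Omega> (\<lambda>x. \<phi> i x + s *\<^sub>R \<psi> x)" for i
  proof -
    have "supp (\<lambda>x. \<phi> i x + s *\<^sub>R \<psi> x) \<subseteq> supp (\<phi> i) \<union> supp \<psi>"
      by (rule supp_subset) (auto simp: not_in_supp)
    moreover have "compact (supp (\<phi> i) \<union> supp \<psi>)" "supp (\<phi> i) \<union> supp \<psi> \<subseteq> \<Omega>"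
      using \<psi> \<phi>(1)[of i] by (auto simp: test_vec_def)
    moreover have "smooth (\<lambda>x. (\<phi> i x + s *\<^sub>R \<psi> x) $ k)" for k
      using smooth_add[OF s(2)[of i k] smooth_cmult[OF s(1)[of k], of s]] by simp
    ultimately show ?thesis
      unfolding test_vec_def using compact_supp_subset[of "supp (\<phi> i) \<union> supp \<psi>"] by blast
  qed
  moreover have "jac (\<lambda>x. \<phi> i x + s *\<^sub>R \<psi> x) x = jac (\<phi> i) x + s *\<^sub>R jac \<psi> x" for i x
    using s by (simp add: vec_eq_iff jac_nth pd_add pd_cmult smooth_differentiable smooth_cmult)
  ultimately show ?thesis
    unfolding W0p_def using \<phi>(2,3)
    by (intro exI[of _ "\<lambda>x. G x + s *\<^sub>R jac \<psi> x"] conjI exI[of _ "\<lambda>i x. \<phi> i x + s *\<^sub>R \<psi> x"]) auto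
qed

text \<open>The scalar tangent inequality at |b|, combined with Cauchy-Schwarz for b . a.\<close>

lemma powr_tangent_inner:
  fixes a b :: "'a::real_inner"
  assumes p: "p > 1"
  shows "norm b powr p + p * (norm b powr (p - 2) * (b \<bullet> (a - b))) \<le> norm a powr p"
proof -
  have "norm b powr (p - 2) * (b \<bullet> a) \<le> norm b powr (p - 2) * (norm b * norm a)"
    by (intro mult_left_mono norm_cauchy_schwarz) auto
  also have "\<dots> = norm b powr (p - 1) * norm a"
    using powr_minus2_mult[of "norm b" p] by (simp add: mult.assoc[symmetric])
  finally have 1: "norm b powr (p - 2) * (b \<bullet> a) \<le> norm b powr (p - 1) * norm a" .
  have "norm b powr (p - 2) * (b \<bullet> b) = norm b powr (p - 1) * norm b"
    using powr_minus2_mult[of "norm b" p]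
    by (simp add: power2_norm_eq_inner[symmetric] power2_eq_square mult.assoc[symmetric])
  with 1 have "norm b powr (p - 2) * (b \<bullet> (a - b)) \<le> norm b powr (p - 1) * (norm a - norm b)"
    by (simp add: inner_diff_right right_diff_distrib)
  then have "p * (norm b powr (p - 2) * (b \<bullet> (a - b))) \<le> p * (norm b powr (p - 1) * (norm a - norm b))"
    using p by (intro mult_left_mono) auto
  moreover have "norm b powr p + p * (norm b powr (p - 1) * (norm a - norm b)) \<le> norm a powr p"
    using powr_tangent[of p "norm b" "norm a"] p by (simp only: mult.assoc) simp
  ultimately show ?thesis by linarith
qed

text \<open>The energy itself is never differentiated. Convexity, with the tangent taken at the
  perturbed field G + s J instead of at G, turns minimality into 0 \<le> s I(s) with I(s) the
  integral of \<open>\<Phi> s\<close>; letting s tend to 0 from both sides gives I(0) = 0.\<close>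

lemma euler_lagrange:
  fixes u :: "real^'n::finite \<Rightarrow> real^'m::finite"
  assumes \<Omega>: "open \<Omega>" "bounded \<Omega>" and V: "measure lebesgue \<Omega> > 0" and p: "p > 2"
    and min: "Ep_minimiser \<Omega> p u0 u D"
    and G: "G \<in> borel_measurable borel" "\<And>x. x \<notin> \<Omega> \<Longrightarrow> G x = 0" "AE x in lborel. x \<in> \<Omega> \<longrightarrow> D x = G x"
    and Gp: "integrable lborel (\<lambda>x. norm (G x) powr p)"
    and \<psi>: "test_vec \<Omega> \<psi>"
  shows "(\<integral>x. norm (G x) powr (p - 2) * (G x \<bullet> jac \<psi> x) \<partial>lborel) = 0"
proof -
  have \<Omega>m: "\<Omega> \<in> sets borel" using \<Omega> by simp
  have [measurable]: "G \<in> borel_measurable borel" by fact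
  obtain C where C: "C > 0" "\<And>x. norm (\<psi> x) \<le> C" "\<And>x. norm (jac \<psi> x) \<le> C"
    and m[measurable]: "\<psi> \<in> borel_measurable borel" "jac \<psi> \<in> borel_measurable borel"
    using jac_test_vec_bounded[OF \<psi>] by blast
  define J where "J = jac \<psi>"
  have Jm[measurable]: "J \<in> borel_measurable borel" unfolding J_def by measurable
  have J0: "J x = 0" if "x \<notin> \<Omega>" for x
    using that \<psi> jac_not_in_supp[of x \<psi>] by (auto simp: J_def test_vec_def)
  have JC: "norm (J x) \<le> C" for x using C by (simp add: J_def)
  define b where "b s x = G x + s *\<^sub>R J x" for s x
  have bm[measurable]: "b s \<in> borel_measurable borel" for s unfolding b_def by measurable
  have b0: "b s x = 0" if "x \<notin> \<Omega>" for s x using that J0 G(2) by (simp add: b_def)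
  \<comment> \<open>A majorant of |G + s J|^p for all |s| \<le> 1 at once; \<open>Y\<close> below
    plays the same role for \<Phi> and dominates the passage to the limit.\<close>
  define W where "W x = 2 powr p * (norm (G x) powr p + C powr p * indicator \<Omega> x)" for x
  have iO: "integrable lborel (indicator \<Omega> :: _ \<Rightarrow> real)"
    using \<Omega> emeasure_bounded_finite[OF \<Omega>(2)] by (intro integrable_real_indicator) auto
  have Wi: "integrable lborel W" unfolding W_def using Gp iO by auto
  have bW: "norm (b s x) powr p \<le> W x" if s: "\<bar>s\<bar> \<le> 1" for s x
  proof (cases "x \<in> \<Omega>")
    case True
    have "norm (b s x) \<le> norm (G x) + \<bar>s\<bar> * norm (J x)"
      unfolding b_def by (metis norm_scaleR norm_triangle_ineq)
    also have "\<dots> \<le> norm (G x) + 1 * C" using s JC[of x] C(1) by (intro add_left_mono mult_mono) auto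
    finally have "norm (b s x) powr p \<le> (norm (G x) + C) powr p"
      using p by (intro powr_mono2) auto
    also have "\<dots> \<le> 2 powr p * (norm (G x) powr p + C powr p)"
      using p C(1) by (intro powr_add_le) auto
    finally show ?thesis using True by (simp add: W_def)
  qed (use p in \<open>simp add: b0 W_def\<close>)
  have bi: "integrable lborel (\<lambda>x. norm (b s x) powr p)" if "\<bar>s\<bar> \<le> 1" for s
    by (rule Bochner_Integration.integrable_bound[OF Wi])
      (use bW[OF that] in \<open>auto intro!: AE_I2 order_trans[OF _ abs_ge_self]\<close>)
  define \<Phi> where "\<Phi> s x = norm (b s x) powr (p - 2) * (b s x \<bullet> J x)" for s x
  have \<Phi>m: "\<Phi> s \<in> borel_measurable borel" for s unfolding \<Phi>_def by measurable
  define Y where "Y x = C * (W x + indicator \<Omega> x)" for x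
  have Yi: "integrable lborel Y" unfolding Y_def using Wi iO by auto
  have \<Phi>Y: "norm (\<Phi> s x) \<le> Y x" if s: "\<bar>s\<bar> \<le> 1" for s x
  proof (cases "x \<in> \<Omega>")
    case True
    have "norm (\<Phi> s x) \<le> norm (b s x) powr (p - 2) * (norm (b s x) * norm (J x))"
      unfolding \<Phi>_def using Cauchy_Schwarz_ineq2[of "b s x" "J x"] by (simp add: abs_mult mult_left_mono)
    also have "\<dots> = norm (b s x) powr (p - 1) * norm (J x)"
      using powr_minus2_mult[of "norm (b s x)" p] by (simp add: mult.assoc[symmetric])
    also have "\<dots> \<le> (norm (b s x) powr p + 1) * C"
      using powr_mult_le_add[of p "norm (b s x)" 1] p JC C(1) by (intro mult_mono) auto
    also have "\<dots> \<le> (W x + 1) * C" using bW[OF s] C(1) by (intro mult_right_mono) auto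
    finally show ?thesis using True by (simp add: Y_def mult.commute)
  qed (simp add: \<Phi>_def b0 Y_def W_def C(1) less_imp_le)
  have \<Phi>i: "integrable lborel (\<Phi> s)" if "\<bar>s\<bar> \<le> 1" for s
    by (rule Bochner_Integration.integrable_bound[OF Yi])
      (use \<Phi>m \<Phi>Y[OF that] in \<open>auto intro!: AE_I2 order_trans[OF _ abs_ge_self]\<close>)
  have minim: "(\<integral>x. norm (G x) powr p \<partial>lborel) \<le> (\<integral>x. norm (b s x) powr p \<partial>lborel)" for s
  proof -
    have "weak_grad \<Omega> (\<lambda>x. u x + s *\<^sub>R \<psi> x) (\<lambda>x. D x + s *\<^sub>R J x)"
      using min unfolding J_def Ep_minimiser_def by (intro weak_grad_add_test \<Omega> \<psi>) auto
    moreover have "W0p \<Omega> p (\<lambda>x. (u x + s *\<^sub>R \<psi> x) - u0 x)"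
      using W0p_add_test[OF \<Omega> _ \<psi>, of p "\<lambda>x. u x - u0 x" s] min p
      by (simp add: Ep_minimiser_def algebra_simps)
    ultimately have "Ep \<Omega> p D \<le> Ep \<Omega> p (\<lambda>x. D x + s *\<^sub>R J x)"
      using min by (auto simp: Ep_minimiser_def)
    moreover have "(\<integral>x. norm (D x) powr p \<partial>lebesgue_on \<Omega>) = (\<integral>x. norm (G x) powr p \<partial>lborel)"
      by (rule Lp_rep(2)[OF \<Omega>m G]) (use p in auto)
    moreover have "(\<integral>x. norm (D x + s *\<^sub>R J x) powr p \<partial>lebesgue_on \<Omega>) = (\<integral>x. norm (b s x) powr p \<partial>lborel)"
    proof (rule Lp_rep(2)[OF \<Omega>m bm b0])
      show "AE x in lborel. x \<in> \<Omega> \<longrightarrow> D x + s *\<^sub>R J x = b s x"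
        using G(3) by eventually_elim (auto simp: b_def)
    qed (use p in auto)
    ultimately have le: "(1 / measure lebesgue \<Omega> * (\<integral>x. norm (G x) powr p \<partial>lborel)) powr (1 / p)
        \<le> (1 / measure lebesgue \<Omega> * (\<integral>x. norm (b s x) powr p \<partial>lborel)) powr (1 / p)"
      by (simp add: Ep_def)
    \<comment> \<open>The mean and the p-th root in \<open>Ep\<close> are strictly increasing, so
      the comparison of energies descends to the integrals.\<close>
    show ?thesis
    proof (rule ccontr)
      assume "\<not> ?thesis"
      then have "1 / measure lebesgue \<Omega> * (\<integral>x. norm (b s x) powr p \<partial>lborel) < 1 / measure lebesgue \<Omega> * (\<integral>x. norm (G x) powr p \<partial>lborel)"
        using V by (intro mult_strict_left_mono) auto
      then have "(1 / measure lebesgue \<Omega> * (\<integral>x. norm (b s x) powr p \<partial>lborel)) powr (1 / p)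
          < (1 / measure lebesgue \<Omega> * (\<integral>x. norm (G x) powr p \<partial>lborel)) powr (1 / p)"
        using p V by (intro powr_less_mono2) auto
      with le show False by simp
    qed
  qed
  have sign: "0 \<le> s * (\<integral>x. \<Phi> s x \<partial>lborel)" if s: "\<bar>s\<bar> \<le> 1" for s
  proof -
    have "(\<integral>x. norm (b s x) powr p \<partial>lborel) \<le> (\<integral>x. norm (G x) powr p + p * s * \<Phi> s x \<partial>lborel)"
    proof (rule integral_mono[OF bi[OF s]])
      show "integrable lborel (\<lambda>x. norm (G x) powr p + p * s * \<Phi> s x)" using Gp \<Phi>i[OF s] by auto
      fix x
      have "norm (b s x) powr p + p * (norm (b s x) powr (p - 2) * (b s x \<bullet> (G x - b s x))) \<le> norm (G x) powr p"
        using p by (intro powr_tangent_inner) auto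
      then show "norm (b s x) powr p \<le> norm (G x) powr p + p * s * \<Phi> s x"
        by (simp add: \<Phi>_def b_def[of s x] algebra_simps)
    qed
    also have "\<dots> = (\<integral>x. norm (G x) powr p \<partial>lborel) + p * (s * (\<integral>x. \<Phi> s x \<partial>lborel))"
      using Gp \<Phi>i[OF s] by simp
    finally have "0 \<le> p * (s * (\<integral>x. \<Phi> s x \<partial>lborel))" using minim[of s] by linarith
    then show ?thesis using p by (simp add: zero_le_mult_iff)
  qed
  have lim: "(\<lambda>i. \<integral>x. \<Phi> (t i) x \<partial>lborel) \<longlonglongrightarrow> (\<integral>x. \<Phi> 0 x \<partial>lborel)"
    if t: "t \<longlonglongrightarrow> 0" "\<And>i::nat. \<bar>t i\<bar> \<le> 1" for t
  proof (rule integral_dominated_convergence[where w = Y])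
    show "AE x in lborel. (\<lambda>i. \<Phi> (t i) x) \<longlonglongrightarrow> \<Phi> 0 x"
    proof (rule AE_I2)
      fix x
      have bt: "(\<lambda>i. b (t i) x) \<longlonglongrightarrow> b 0 x"
        unfolding b_def by (intro tendsto_intros t)
      \<comment> \<open>The exponent p - 2 is positive, so the power is continuous even where the
        limit field vanishes.\<close>
      have "(\<lambda>i. norm (b (t i) x) powr (p - 2)) \<longlonglongrightarrow> norm (b 0 x) powr (p - 2)"
        using p by (intro tendsto_powr' tendsto_norm bt tendsto_const) auto
      then show "(\<lambda>i. \<Phi> (t i) x) \<longlonglongrightarrow> \<Phi> 0 x"
        unfolding \<Phi>_def by (intro tendsto_mult tendsto_inner bt tendsto_const)
    qed
  qed (use \<Phi>m Yi \<Phi>Y t in auto)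
  define I where "I = (\<integral>x. \<Phi> 0 x \<partial>lborel)"
  have t0: "(\<lambda>i. 1 / real (Suc i)) \<longlonglongrightarrow> 0" by (rule LIMSEQ_Suc[OF lim_1_over_n])
  have "I \<ge> 0"
  proof (rule tendsto_lowerbound)
    show "(\<lambda>i. \<integral>x. \<Phi> (1 / real (Suc i)) x \<partial>lborel) \<longlonglongrightarrow> I" unfolding I_def by (rule lim[OF t0]) auto
    have "0 \<le> (\<integral>x. \<Phi> (1 / real (Suc i)) x \<partial>lborel)" for i
      using sign[of "1 / real (Suc i)"] by (simp add: zero_le_divide_iff zero_le_mult_iff)
    then show "\<forall>\<^sub>F i in sequentially. 0 \<le> (\<integral>x. \<Phi> (1 / real (Suc i)) x \<partial>lborel)" by simp
  qed simp
  moreover have "I \<le> 0"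
  proof (rule tendsto_upperbound)
    show "(\<lambda>i. \<integral>x. \<Phi> (- (1 / real (Suc i))) x \<partial>lborel) \<longlonglongrightarrow> I"
      unfolding I_def by (rule lim) (use tendsto_minus[OF t0] in auto)
    have "(\<integral>x. \<Phi> (- (1 / real (Suc i))) x \<partial>lborel) \<le> 0" for i
      using sign[of "- (1 / real (Suc i))"] by (simp add: divide_le_0_iff mult_le_0_iff)
    then show "\<forall>\<^sub>F i in sequentially. (\<integral>x. \<Phi> (- (1 / real (Suc i))) x \<partial>lborel) \<le> 0" by simp
  qed simp
  ultimately show ?thesis by (simp add: I_def \<Phi>_def b_def J_def)
qed

subsection \<open>The weighted measures of the minimisers\<close>

lemma pw_eq_powr: "a \<noteq> 0 \<Longrightarrow> pw t a = t powr a"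
  by (simp add: pw_def)

lemma mu_p_integral_zero:
  fixes h :: "_ \<Rightarrow> real"
  assumes "p > 2" "Ep \<Omega> p D = 0"
  shows "(\<integral>x. h x \<partial>mu_p \<Omega> p D) = 0"
proof (rule integral_eq_zero_AE)
  \<comment> \<open>The normalising factor is 0 here, and division by 0 yields 0, so
    \<open>mu_p\<close> is the zero measure.\<close>
  have eq: "mu_p \<Omega> p D = density lebesgue (\<lambda>x. 0)"
    using assms by (simp add: mu_p_def pw_eq_powr)
  show "AE x in mu_p \<Omega> p D. h x = 0"
    unfolding eq by (subst AE_density) auto
qed

text \<open>Absorbing e^(p-2) into the field turns the weight into a power of the normalised field G
  / e. \<open>D\<close> is measurable on the whole space because \<open>mu_p\<close> is a density
  over all of it.\<close>

lemma mu_p_integral: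
  fixes D :: "real^'n::finite \<Rightarrow> real^'n^'m::finite"
  assumes \<Omega>: "open \<Omega>" and V: "V = measure lborel \<Omega>" and p: "p > 2"
    and e: "e = Ep \<Omega> p D" "e > 0" and D: "D \<in> borel_measurable lebesgue"
    and G: "G \<in> borel_measurable borel" "\<And>x. x \<notin> \<Omega> \<Longrightarrow> G x = 0" "AE x in lborel. x \<in> \<Omega> \<longrightarrow> D x = G x"
    and h: "h \<in> borel_measurable lebesgue" and k: "k \<in> borel_measurable borel" "AE x in lborel. x \<in> \<Omega> \<longrightarrow> h x = k x"
  shows "(\<integral>x. h x \<partial>mu_p \<Omega> p D) = (\<integral>x. norm ((1 / e) *\<^sub>R G x) powr (p - 2) / V * k x \<partial>lborel)"
proof -
  have \<Omega>m: "\<Omega> \<in> sets borel" using \<Omega> by simp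
  have Vl: "measure lebesgue \<Omega> = V" using \<Omega>m by (simp add: V)
  let ?\<rho> = "\<lambda>x. indicator \<Omega> x * norm (D x) powr (p - 2) / (e powr (p - 2) * V)"
  let ?g = "\<lambda>x. norm ((1 / e) *\<^sub>R G x) powr (p - 2) / V * k x"
  have \<rho>m: "?\<rho> \<in> borel_measurable lebesgue" 
  proof -
    have "(\<lambda>x. norm (D x) powr (p - 2)) \<in> borel_measurable lebesgue"
      by (rule measurable_compose[OF D]) measurable
    moreover have "(indicator \<Omega> :: _ \<Rightarrow> real) \<in> borel_measurable lebesgue"
      using \<Omega>m by (intro borel_measurable_indicator) simp
    ultimately show ?thesis
      by (intro borel_measurable_divide borel_measurable_times borel_measurable_const)
  qed
  have gm: "?g \<in> borel_measurable lborel" using G(1) k(1) by measurable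
  have V0: "V \<ge> 0" by (simp add: V)
  have "(\<integral>x. h x \<partial>mu_p \<Omega> p D) = (\<integral>x. h x \<partial>density lebesgue (\<lambda>x. ennreal (?\<rho> x)))"
    using p by (simp add: mu_p_def pw_eq_powr e(1)[symmetric] Vl)
  also have "\<dots> = (\<integral>x. ?\<rho> x *\<^sub>R h x \<partial>lebesgue)"
    using h \<rho>m V0 by (intro integral_density) auto
  also have "\<dots> = (\<integral>x. ?g x \<partial>lebesgue)"
  proof (rule integral_cong_AE)
    show "(\<lambda>x. ?\<rho> x *\<^sub>R h x) \<in> borel_measurable lebesgue" using \<rho>m h by measurable
    show "?g \<in> borel_measurable lebesgue" using gm by (rule measurable_completion)
    show "AE x in lebesgue. ?\<rho> x *\<^sub>R h x = ?g x"
      using AE_completion[OF G(3)] AE_completion[OF k(2)]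
    proof eventually_elim
      case (elim x)
      show ?case
      proof (cases "x \<in> \<Omega>")
        case True
        have "norm ((1 / e) *\<^sub>R G x) powr (p - 2) = norm (G x) powr (p - 2) / e powr (p - 2)"
          using e(2) by (simp add: powr_divide)
        then show ?thesis using True elim by simp
      next
        case False
        then show ?thesis using G(2) p by simp
      qed
    qed
  qed
  also have "\<dots> = (\<integral>x. ?g x \<partial>lborel)" by (rule integral_completion[OF gm])
  finally show ?thesis .
qed

lemma normalised_energy:
  fixes D :: "real^'n::finite \<Rightarrow> real^'n^'m::finite"
  assumes \<Omega>: "open \<Omega>" and V: "V = measure lborel \<Omega>" "V > 0" and p: "p > 2"
    and e: "e = Ep \<Omega> p D" "e > 0"
    and G: "G \<in> borel_measurable borel" "\<And>x. x \<notin> \<Omega> \<Longrightarrow> G x = 0" "AE x in lborel. x \<in> \<Omega> \<longrightarrow> D x = G x"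
  shows "integrable lborel (\<lambda>x. norm (G x) powr p)"
    and "integrable lborel (\<lambda>x. norm ((1 / e) *\<^sub>R G x) powr p)"
    and "(\<integral>x. norm ((1 / e) *\<^sub>R G x) powr p \<partial>lborel) = V"
proof -
  have \<Omega>m: "\<Omega> \<in> sets borel" using \<Omega> by simp
  have Vl: "measure lebesgue \<Omega> = V" using \<Omega>m by (simp add: V)
  let ?I = "\<integral>x. norm (G x) powr p \<partial>lborel"
  have "(\<integral>x. norm (D x) powr p \<partial>lebesgue_on \<Omega>) = ?I"
    by (rule Lp_rep(2)[OF \<Omega>m G]) (use p in auto)
  then have eI: "e = (1 / V * ?I) powr (1 / p)" by (simp add: e(1) Ep_def Vl)
  have I0: "?I \<ge> 0" by simp
  \<comment> \<open>A nonintegrable power would have Bochner integral 0 and force e = 0; positivity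
    of e therefore yields integrability.\<close>
  have "?I \<noteq> 0"
  proof
    assume "?I = 0"
    then show False using eI e(2) by simp
  qed
  then show i: "integrable lborel (\<lambda>x. norm (G x) powr p)" using not_integrable_integral_eq by blast
  have "e powr p = 1 / V * ?I"
    unfolding eI using p V(2) I0 by (simp add: powr_powr)
  then have IV: "?I = V * e powr p" using V(2) by simp
  have eq: "norm ((1 / e) *\<^sub>R G x) powr p = norm (G x) powr p / e powr p" for x
    using e(2) by (simp add: powr_divide)
  show "integrable lborel (\<lambda>x. norm ((1 / e) *\<^sub>R G x) powr p)" unfolding eq using i by simp
  show "(\<integral>x. norm ((1 / e) *\<^sub>R G x) powr p \<partial>lborel) = V" unfolding eq using IV e(2) by simp
qed

text \<open>For g = G / e the identity |g|^(p-2) |g|^2 = |g|^p makes the second moment of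
  \<open>D\<close> under \<open>mu_p\<close> equal to e^2. The moment bound in the weak convergence
  of pairs thus bounds the energies.\<close>

lemma energy_le_mu_p_integral:
  fixes D :: "real^'n::finite \<Rightarrow> real^'n^'m::finite"
  assumes \<Omega>: "open \<Omega>" "bounded \<Omega>" and V: "V = measure lborel \<Omega>" "V > 0" and p: "p > 2"
    and e: "e = Ep \<Omega> p D" "e > 0" and D: "D \<in> borel_measurable lebesgue"
    and G: "G \<in> borel_measurable borel" "\<And>x. x \<notin> \<Omega> \<Longrightarrow> G x = 0" "AE x in lborel. x \<in> \<Omega> \<longrightarrow> D x = G x"
  shows "e\<^sup>2 \<le> (\<integral>x. 1 + (norm (D x))\<^sup>2 \<partial>mu_p \<Omega> p D)"
proof -
  note N = normalised_energy[OF \<Omega>(1) V p e G]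
  have [measurable]: "G \<in> borel_measurable borel" by fact
  define t where "t x = norm ((1 / e) *\<^sub>R G x)" for x
  have [measurable]: "t \<in> borel_measurable borel" unfolding t_def by measurable
  have t0: "t x \<ge> 0" for x by (simp add: t_def)
  have tG: "norm (G x) = e * t x" for x using e(2) by (simp add: t_def)
  have iO: "integrable lborel (indicator \<Omega> :: _ \<Rightarrow> real)"
    using \<Omega> emeasure_bounded_finite[OF \<Omega>(2)] by (intro integrable_real_indicator) auto
  have tp: "integrable lborel (\<lambda>x. t x powr p)" "(\<integral>x. t x powr p \<partial>lborel) = V"
    using N by (simp_all add: t_def)
  have i2: "integrable lborel (\<lambda>x. t x powr (p - 2))"
  proof (rule Bochner_Integration.integrable_bound)
    show "integrable lborel (\<lambda>x. t x powr p + indicator \<Omega> x)" using tp iO by auto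
    show "AE x in lborel. norm (t x powr (p - 2)) \<le> norm (t x powr p + indicator \<Omega> x)"
    proof (rule AE_I2)
      fix x
      show "norm (t x powr (p - 2)) \<le> norm (t x powr p + indicator \<Omega> x)"
      proof (cases "x \<in> \<Omega>")
        case True
        have "t x powr (p - 2) \<le> t x powr p + 1"
        proof (cases "t x \<ge> 1")
          case True
          then have "t x powr (p - 2) \<le> t x powr p" by (intro powr_mono) auto
          then show ?thesis by simp
        next
          case False
          then have "t x powr (p - 2) \<le> 1 powr (p - 2)" using t0 p by (intro powr_mono2) auto
          then show ?thesis by (simp add: add_increasing)
        qed
        then show ?thesis using True by simp
      next
        case False
        then show ?thesis using G(2) p by (simp add: t_def)
      qed
    qed
  qed measurable
  have tt: "t x powr (p - 2) * (t x)\<^sup>2 = t x powr p" for x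
    using powr_minus2_mult[OF t0[of x], of p] powr_mult_self[OF t0[of x], of p]
    by (simp add: power2_eq_square mult.assoc[symmetric])
  have eq: "t x powr (p - 2) / V * (1 + (norm (G x))\<^sup>2) = t x powr (p - 2) / V + e\<^sup>2 / V * t x powr p" for x
    unfolding tG tt[symmetric] by (simp add: power_mult_distrib distrib_left)
  have "e\<^sup>2 = (\<integral>x. e\<^sup>2 / V * t x powr p \<partial>lborel)" using tp V(2) by simp
  also have "\<dots> \<le> (\<integral>x. t x powr (p - 2) / V + e\<^sup>2 / V * t x powr p \<partial>lborel)"
    using tp i2 V(2) by (intro integral_mono) auto
  also have "\<dots> = (\<integral>x. t x powr (p - 2) / V * (1 + (norm (G x))\<^sup>2) \<partial>lborel)"
    unfolding eq ..
  also have "\<dots> = (\<integral>x. 1 + (norm (D x))\<^sup>2 \<partial>mu_p \<Omega> p D)"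
    unfolding t_def
  proof (rule mu_p_integral[OF \<Omega>(1) V(1) p e D G, symmetric])
    show "(\<lambda>x. 1 + (norm (D x))\<^sup>2) \<in> borel_measurable lebesgue" using D by measurable
    show "(\<lambda>x. 1 + (norm (G x))\<^sup>2) \<in> borel_measurable borel" by measurable
    show "AE x in lborel. x \<in> \<Omega> \<longrightarrow> 1 + (norm (D x))\<^sup>2 = 1 + (norm (G x))\<^sup>2"
      using G(3) by eventually_elim auto
  qed
  finally show ?thesis .
qed

text \<open>For the second claim, |g|^(p-1) \<le> |g|^p + 1 on \<Omega> bounds the integral for the
  normalised field g by 2 V B, and the prefactor e / V leaves 2 B e.\<close>

lemma mu_p_current:
  fixes D :: "real^'n::finite \<Rightarrow> real^'n^'m::finite"
  assumes \<Omega>: "open \<Omega>" "bounded \<Omega>" and V: "V = measure lborel \<Omega>" "V > 0" and p: "p > 2"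
    and e: "e = Ep \<Omega> p D" "e > 0" and D: "D \<in> borel_measurable lebesgue"
    and G: "G \<in> borel_measurable borel" "\<And>x. x \<notin> \<Omega> \<Longrightarrow> G x = 0" "AE x in lborel. x \<in> \<Omega> \<longrightarrow> D x = G x"
    and \<phi>: "\<phi> \<in> borel_measurable borel"
  shows "(\<integral>x. D x \<bullet> \<phi> x \<partial>mu_p \<Omega> p D) =
      e / V * (\<integral>x. norm ((1 / e) *\<^sub>R G x) powr (p - 2) * (((1 / e) *\<^sub>R G x) \<bullet> \<phi> x) \<partial>lborel)"
    and "(\<And>x. norm (\<phi> x) \<le> B) \<Longrightarrow> \<bar>\<integral>x. D x \<bullet> \<phi> x \<partial>mu_p \<Omega> p D\<bar> \<le> 2 * B * e"
proof -
  note N = normalised_energy[OF \<Omega>(1) V p e G]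
  have [measurable]: "G \<in> borel_measurable borel" "\<phi> \<in> borel_measurable borel" by fact+
  have "(\<integral>x. D x \<bullet> \<phi> x \<partial>mu_p \<Omega> p D) = (\<integral>x. norm ((1 / e) *\<^sub>R G x) powr (p - 2) / V * (G x \<bullet> \<phi> x) \<partial>lborel)"
  proof (rule mu_p_integral[OF \<Omega>(1) V(1) p e D G])
    have "\<phi> \<in> borel_measurable lebesgue" using \<phi> by (intro measurable_completion) simp
    then show "(\<lambda>x. D x \<bullet> \<phi> x) \<in> borel_measurable lebesgue" using D by measurable
    show "(\<lambda>x. G x \<bullet> \<phi> x) \<in> borel_measurable borel" by measurable
    show "AE x in lborel. x \<in> \<Omega> \<longrightarrow> D x \<bullet> \<phi> x = G x \<bullet> \<phi> x"
      using G(3) by eventually_elim auto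
  qed
  also have "\<dots> = (\<integral>x. e / V * (norm ((1 / e) *\<^sub>R G x) powr (p - 2) * (((1 / e) *\<^sub>R G x) \<bullet> \<phi> x)) \<partial>lborel)"
    using e(2) by (intro Bochner_Integration.integral_cong) auto
  finally show eq: "(\<integral>x. D x \<bullet> \<phi> x \<partial>mu_p \<Omega> p D) =
      e / V * (\<integral>x. norm ((1 / e) *\<^sub>R G x) powr (p - 2) * (((1 / e) *\<^sub>R G x) \<bullet> \<phi> x) \<partial>lborel)" by simp
  assume B: "\<And>x. norm (\<phi> x) \<le> B"
  have B0: "B \<ge> 0" using B[of 0] norm_ge_zero order_trans by blast
  define g where "g x = (1 / e) *\<^sub>R G x" for x
  have [measurable]: "g \<in> borel_measurable borel" unfolding g_def by measurable
  have iO: "integrable lborel (indicator \<Omega> :: _ \<Rightarrow> real)"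
    using \<Omega> emeasure_bounded_finite[OF \<Omega>(2)] by (intro integrable_real_indicator) auto
  let ?b = "\<lambda>x. B * (norm (g x) powr p + indicator \<Omega> x)"
  have bi: "integrable lborel ?b" using N(2) iO by (auto simp: g_def)
  have pt: "norm (norm (g x) powr (p - 2) * (g x \<bullet> \<phi> x)) \<le> ?b x" for x
  proof -
    have "norm (norm (g x) powr (p - 2) * (g x \<bullet> \<phi> x)) \<le> norm (g x) powr (p - 2) * (norm (g x) * norm (\<phi> x))"
      using Cauchy_Schwarz_ineq2[of "g x" "\<phi> x"] by (simp add: abs_mult mult_left_mono)
    also have "\<dots> = norm (g x) powr (p - 1) * norm (\<phi> x)"
      using powr_minus2_mult[of "norm (g x)" p] by (simp add: mult.assoc[symmetric])
    also have "\<dots> \<le> (norm (g x) powr p + indicator \<Omega> x) * B"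
    proof (rule mult_mono[OF _ B])
      show "norm (g x) powr (p - 1) \<le> norm (g x) powr p + indicator \<Omega> x"
        using powr_mult_le_add[of p "norm (g x)" 1] p G(2)[of x] by (cases "x \<in> \<Omega>") (auto simp: g_def)
    qed auto
    finally show ?thesis by (simp add: mult.commute)
  qed
  have gi: "integrable lborel (\<lambda>x. norm (g x) powr (p - 2) * (g x \<bullet> \<phi> x))"
    by (rule Bochner_Integration.integrable_bound[OF bi])
      (use pt in \<open>auto intro!: AE_I2 order_trans[OF _ abs_ge_self]\<close>)
  have "\<bar>\<integral>x. norm (g x) powr (p - 2) * (g x \<bullet> \<phi> x) \<partial>lborel\<bar> \<le> (\<integral>x. ?b x \<partial>lborel)"
    using norm_integral_le[OF gi bi pt] by simp
  also have "\<dots> = B * (V + V)" using N(2,3) iO by (simp add: g_def V(1))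
  finally have "e / V * \<bar>\<integral>x. norm (g x) powr (p - 2) * (g x \<bullet> \<phi> x) \<partial>lborel\<bar> \<le> e / V * (B * (V + V))"
    using e(2) V(2) by (intro mult_left_mono) auto
  then show "\<bar>\<integral>x. D x \<bullet> \<phi> x \<partial>mu_p \<Omega> p D\<bar> \<le> 2 * B * e"
    using e(2) V(2) by (simp add: eq g_def[symmetric] abs_mult ac_simps)
qed

lemma tuple_apply_mf_current:
  fixes F :: "real^'n::finite \<Rightarrow> real^'n^'m::finite"
  assumes pair: "mf_pair \<Omega> \<mu> F" and \<phi>: "tuple_test_form \<phi>"
  shows "tuple_apply (mf_current \<mu> F) \<phi> = (\<integral>x. F x \<bullet> \<phi> x \<partial>\<mu>)"
    and "continuous_on UNIV \<phi>" "\<exists>B. \<forall>x. norm (\<phi> x) \<le> B"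
proof -
  have s: "smooth (\<lambda>x. \<phi> x $ k $ j)" and c: "compact (supp (\<lambda>x. \<phi> x $ k))" for k j
    using \<phi> by (auto simp: tuple_test_form_def test_form_def)
  have "continuous_on UNIV (\<lambda>x. \<chi> k j. \<phi> x $ k $ j)"
    by (intro continuous_on_vec_lambda smooth_continuous_on s)
  then show cont: "continuous_on UNIV \<phi>" by simp
  have "compact (\<Union>k. supp (\<lambda>x. \<phi> x $ k))" by (intro compact_UN c) simp
  then have "bounded (\<Union>k. supp (\<lambda>x. \<phi> x $ k))" by (rule compact_imp_bounded)
  then obtain R where R: "\<And>k x. x \<in> supp (\<lambda>x. \<phi> x $ k) \<Longrightarrow> norm x \<le> R"
    unfolding bounded_iff by blast
  have "\<phi> x = 0" if "norm x > R" for x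
    unfolding vec_eq_iff using R[of x] not_in_supp[of x] that by (metis not_le zero_index)
  then obtain B where B: "B > 0" "\<And>x. norm (\<phi> x) \<le> B"
    using bounded_support_bounded[OF cont, of R] by blast
  then show "\<exists>B. \<forall>x. norm (\<phi> x) \<le> B" by blast
  have sets[measurable_cong]: "sets \<mu> = sets borel" and fin: "finite_measure \<mu>"
    and Fm[measurable]: "F \<in> borel_measurable \<mu>" and F2: "integrable \<mu> (\<lambda>x. (norm (F x))\<^sup>2)"
    using pair by (auto simp: mf_pair_def)
  interpret finite_measure \<mu> by fact
  have [measurable]: "\<phi> \<in> borel_measurable borel" by (rule borel_measurable_continuous_onI[OF cont])
  have i: "integrable \<mu> (\<lambda>x. \<phi> x $ k \<bullet> F x $ k)" for k
  proof (rule Bochner_Integration.integrable_bound)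
    show "integrable \<mu> (\<lambda>x. B * (1 + (norm (F x))\<^sup>2))" using F2 by auto
    show "AE x in \<mu>. norm (\<phi> x $ k \<bullet> F x $ k) \<le> norm (B * (1 + (norm (F x))\<^sup>2))"
    proof (rule AE_I2)
      fix x
      have "norm (\<phi> x $ k \<bullet> F x $ k) \<le> norm (\<phi> x $ k) * norm (F x $ k)" by (simp add: Cauchy_Schwarz_ineq2)
      also have "\<dots> \<le> B * (1 + (norm (F x))\<^sup>2)"
      proof (rule mult_mono)
        show "norm (\<phi> x $ k) \<le> B" using Finite_Cartesian_Product.norm_nth_le[of "\<phi> x" k] B(2)[of x] by linarith
        have "norm (F x) \<le> 1 + (norm (F x))\<^sup>2"
          using zero_le_power2[of "norm (F x) - 1"] by (simp add: power2_diff) (smt (verit) zero_le_power2)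
        then show "norm (F x $ k) \<le> 1 + (norm (F x))\<^sup>2" using Finite_Cartesian_Product.norm_nth_le[of "F x" k] by linarith
      qed (use B in auto)
      finally show "norm (\<phi> x $ k \<bullet> F x $ k) \<le> norm (B * (1 + (norm (F x))\<^sup>2))"
        using B(1) by simp
    qed
  qed measurable
  show "tuple_apply (mf_current \<mu> F) \<phi> = (\<integral>x. F x \<bullet> \<phi> x \<partial>\<mu>)"
    unfolding tuple_apply_def mf_current_def inner_commute[of "F _"] inner_vec_def[of "\<phi> _"]
    using i by (subst Bochner_Integration.integral_sum) auto
qed

text \<open>
  The matrix fields of the minimisers are only constrained on the domain. Where they fail to be
  measurable on the whole space, Bochner integrals collapse to 0, and weak convergence forces the
  limit measure to vanish.
\<close>
lemma limit_measure_zero_of_nonmeasurable: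
  fixes D :: "nat \<Rightarrow> real^'n::finite \<Rightarrow> real^'n^'m::finite"
  assumes pair: "mf_pair \<Omega> \<mu> F" and conv: "mf_weak_conv (\<lambda>l. mu_p \<Omega> (p l) (D l)) D \<mu> F"
    and bad: "\<exists>\<^sub>F l in sequentially. D l \<notin> borel_measurable lebesgue"
  shows "emeasure \<mu> (space \<mu>) = 0"
proof -
  interpret finite_measure \<mu> using pair by (simp add: mf_pair_def)
  \<comment> \<open>There are only finitely many entries, so one of them is nonmeasurable infinitely
    often.\<close>
  have "\<exists>k j. \<exists>\<^sub>F l in sequentially. (\<lambda>x. D l x $ k $ j) \<notin> borel_measurable lebesgue"
  proof (rule ccontr)
    assume "\<not> ?thesis"
    then have "\<forall>\<^sub>F l in sequentially. \<forall>k\<in>UNIV. \<forall>j\<in>UNIV. (\<lambda>x. D l x $ k $ j) \<in> borel_measurable lebesgue"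
      by (intro eventually_ball_finite ballI) (auto simp: frequently_def)
    then have "\<forall>\<^sub>F l in sequentially. D l \<in> borel_measurable lebesgue"
    proof eventually_elim
      case (elim l)
      have "(\<lambda>x. \<Sum>b\<in>Basis. (D l x \<bullet> b) *\<^sub>R b) \<in> borel_measurable lebesgue"
      proof (intro borel_measurable_sum borel_measurable_scaleR borel_measurable_const)
        fix b :: "real^'n^'m" assume "b \<in> Basis"
        then obtain k j where "b = axis k (axis j 1)" by (auto simp: Basis_vec_def)
        then show "(\<lambda>x. D l x \<bullet> b) \<in> borel_measurable lebesgue" using elim by (simp add: inner_axis)
      qed
      then show ?case by (simp add: euclidean_representation)
    qed
    with bad show False by (simp add: frequently_def)
  qed
  then obtain k j where kj: "\<exists>\<^sub>F l in sequentially. (\<lambda>x. D l x $ k $ j) \<notin> borel_measurable lebesgue" by blast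
  \<comment> \<open>Adding a constant does not repair measurability, so the approximating integrals
    are 0 infinitely often and the limit is 0 for every c. The cases c = 0 and c = 1 differ by the
    total mass of \<mu>.\<close>
  have z: "(\<integral>x. c + F x $ k $ j \<partial>\<mu>) = 0" for c
  proof -
    let ?a = "\<lambda>l. \<integral>x. c + D l x \<bullet> axis k (axis j 1) \<partial>mu_p \<Omega> (p l) (D l)"
    have lim: "?a \<longlonglongrightarrow> (\<integral>x. c + F x \<bullet> axis k (axis j 1) \<partial>\<mu>)"
      using conv unfolding mf_weak_conv_def by (elim conjE allE[of _ "\<lambda>_. c"] allE[of _ "\<lambda>_. axis k (axis j 1)"]) auto
    have "\<exists>\<^sub>F l in sequentially. ?a l = 0"
      using kj
    proof (rule frequently_elim1)
      fix l assume n: "(\<lambda>x. D l x $ k $ j) \<notin> borel_measurable lebesgue"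
      have "\<not> integrable (mu_p \<Omega> (p l) (D l)) (\<lambda>x. c + D l x \<bullet> axis k (axis j 1))"
      proof
        assume "integrable (mu_p \<Omega> (p l) (D l)) (\<lambda>x. c + D l x \<bullet> axis k (axis j 1))"
        then have "(\<lambda>x. c + D l x $ k $ j) \<in> borel_measurable lebesgue"
          by (auto simp: mu_p_def inner_axis dest!: borel_measurable_integrable)
        from borel_measurable_diff[OF this borel_measurable_const[of c]] n show False by simp
      qed
      then show "?a l = 0" by (rule not_integrable_integral_eq)
    qed
    then have "(\<integral>x. c + F x \<bullet> axis k (axis j 1) \<partial>\<mu>) = 0"
      using tendsto_imp_eventually_ne[OF lim, of 0] by (auto simp: frequently_def)
    then show ?thesis by (simp add: inner_axis)
  qed
  have Fi: "integrable \<mu> (\<lambda>x. F x $ k $ j)"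
  proof (rule ccontr)
    assume n: "\<not> integrable \<mu> (\<lambda>x. F x $ k $ j)"
    have [measurable]: "F \<in> borel_measurable \<mu>" and F2: "integrable \<mu> (\<lambda>x. (norm (F x))\<^sup>2)"
      using pair by (auto simp: mf_pair_def)
    have "integrable \<mu> (\<lambda>x. F x $ k $ j)"
    proof (rule Bochner_Integration.integrable_bound)
      show "integrable \<mu> (\<lambda>x. 1 + (norm (F x))\<^sup>2)" using F2 by auto
      show "AE x in \<mu>. norm (F x $ k $ j) \<le> norm (1 + (norm (F x))\<^sup>2)"
      proof (rule AE_I2)
        fix x
        have "norm (F x $ k $ j) \<le> norm (F x)"
          using Finite_Cartesian_Product.norm_nth_le[of "F x $ k" j] Finite_Cartesian_Product.norm_nth_le[of "F x" k] by linarith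
        moreover have "norm (F x) \<le> 1 + (norm (F x))\<^sup>2"
          using zero_le_power2[of "norm (F x) - 1"] by (simp add: power2_diff) (smt (verit) zero_le_power2)
        ultimately show "norm (F x $ k $ j) \<le> norm (1 + (norm (F x))\<^sup>2)" by simp
      qed
    qed measurable
    with n show False by simp
  qed
  have "measure \<mu> (space \<mu>) = 0" using z[of 0] z[of 1] Fi by simp
  then show ?thesis by (simp add: emeasure_eq_measure)
qed

lemma conv_scaleR: "conv \<eta> (\<lambda>x. c *\<^sub>R f x) x = c *\<^sub>R conv \<eta> f x"
  unfolding conv_def by (subst integral_scaleR_right[symmetric]) (simp add: mult.commute)

subsection \<open>The minimality theorem\<close>

lemma measure_lborel_open_pos:
  assumes "open \<Omega>" "bounded \<Omega>" "\<Omega> \<noteq> {}"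
  shows "measure lborel (\<Omega> :: (real^'n::finite) set) > 0"
proof (rule ccontr)
  assume "\<not> ?thesis"
  then have "measure lborel \<Omega> = 0" using zero_less_measure_iff by blast
  then have "emeasure lborel \<Omega> = 0"
    using emeasure_bounded_finite[OF assms(2)] by (simp add: emeasure_eq_ennreal_measure)
  then have "\<Omega> \<in> null_sets lebesgue"
    using assms(1) by (intro null_sets_completionI) (auto simp: null_sets_def)
  then show False using open_not_negligible[OF assms(1,3)] by (simp add: negligible_iff_null_sets)
qed

text \<open>The nondegenerate case, with all properties required at every index. The energies and
  their limit are positive, so the fields can be divided by \<open>E l\<close>; the currents then
  differ from the normalised ones by the factor \<open>E l / V\<close>.\<close>

lemma current_mass_le:
  fixes u :: "nat \<Rightarrow> real^'n::finite \<Rightarrow> real^'m::finite"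
  assumes \<Omega>: "open \<Omega>" "bounded \<Omega>" "\<Omega> \<noteq> {}"
    and min: "\<And>l. Ep_minimiser \<Omega> (p l) u0 (u l) (Du l)"
    and conv: "W1q_weak_conv \<Omega> 2 u Du U DU"
    and W1p: "\<And>l. W1p \<Omega> 2 (u l) (Du l)"
    and p: "\<And>l. p l > 2" "filterlim p at_top sequentially"
    and Dm: "\<And>l. Du l \<in> borel_measurable lebesgue"
    and e: "\<And>l. Ep \<Omega> (p l) (Du l) > 0" "(\<lambda>l. Ep \<Omega> (p l) (Du l)) \<longlonglongrightarrow> e" "e > 0"
    and pair: "mf_pair \<Omega> \<mu> F"
    and M: "\<And>\<phi>. continuous_on UNIV \<phi> \<Longrightarrow>
      (\<lambda>l. \<integral>x. Du l x \<bullet> \<phi> x \<partial>mu_p \<Omega> (p l) (Du l)) \<longlonglongrightarrow> (\<integral>x. F x \<bullet> \<phi> x \<partial>\<mu>)"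
    and bdS: "supp_bd S \<inter> \<Omega> = {}"
    and K: "compact K" "K \<subseteq> \<Omega>"
    and S_eq: "\<forall>\<omega>. tuple_test_form \<omega> \<and> (\<forall>k. supp (\<lambda>x. \<omega> x $ k) \<subseteq> \<Omega>) \<and> (\<forall>x\<in>K. \<omega> x = 0)
                 \<longrightarrow> tuple_apply S \<omega> = tuple_apply (mf_current \<mu> F) \<omega>"
    and repS: "mass_rep S \<nu>S VS" and repT: "mass_rep (mf_current \<mu> F) \<nu>T VT"
  shows "emeasure \<nu>T K \<le> emeasure \<nu>S K"
proof -
  define V where "V = measure lborel \<Omega>"
  have V: "V > 0" unfolding V_def by (rule measure_lborel_open_pos[OF \<Omega>])
  have \<Omega>m: "\<Omega> \<in> sets borel" using \<Omega> by simp
  have Vl: "measure lebesgue \<Omega> > 0" using V \<Omega>m by (simp add: V_def)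
  have rep: "\<exists>w G. (w \<in> borel_measurable borel \<and> (\<forall>x. x \<notin> \<Omega> \<longrightarrow> w x = 0) \<and> (AE x in lborel. x \<in> \<Omega> \<longrightarrow> a x = w x) \<and> integrable lborel w) \<and>
      (G \<in> borel_measurable borel \<and> (\<forall>x. x \<notin> \<Omega> \<longrightarrow> G x = 0) \<and> (AE x in lborel. x \<in> \<Omega> \<longrightarrow> b x = G x) \<and> integrable lborel G) \<and>
      wgrad \<Omega> w G"
    if W: "W1p \<Omega> 2 a b" for a :: "real^'n \<Rightarrow> real^'m" and b
  proof -
    have La: "Lp \<Omega> 2 a" and Lb: "Lp \<Omega> 2 b" and wg: "weak_grad \<Omega> a b" using W by (auto simp: W1p_def)
    obtain w where w: "w \<in> borel_measurable borel" "\<And>x. x \<notin> \<Omega> \<Longrightarrow> w x = 0" "AE x in lborel. x \<in> \<Omega> \<longrightarrow> a x = w x"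
      using ex_borel_rep[OF \<Omega>m] La by (auto simp: Lp_def)
    obtain G where G: "G \<in> borel_measurable borel" "\<And>x. x \<notin> \<Omega> \<Longrightarrow> G x = 0" "AE x in lborel. x \<in> \<Omega> \<longrightarrow> b x = G x"
      using ex_borel_rep[OF \<Omega>m] Lb by (auto simp: Lp_def)
    have wi: "integrable lborel w"
      using La Lp_rep(1)[OF \<Omega>m w, of 2] by (intro integrable_of_powr[OF \<Omega>(1,2) w(1,2), of 2]) (auto simp: Lp_def)
    have Gi: "integrable lborel G"
      using Lb Lp_rep(1)[OF \<Omega>m G, of 2] by (intro integrable_of_powr[OF \<Omega>(1,2) G(1,2), of 2]) (auto simp: Lp_def)
    have "wgrad \<Omega> w G" by (rule wgrad_rep[OF \<Omega>(1,2) wg w wi G Gi])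
    with w G wi Gi show ?thesis by blast
  qed
  have "\<forall>l. \<exists>w G. (w \<in> borel_measurable borel \<and> (\<forall>x. x \<notin> \<Omega> \<longrightarrow> w x = 0) \<and> (AE x in lborel. x \<in> \<Omega> \<longrightarrow> u l x = w x) \<and> integrable lborel w) \<and>
      (G \<in> borel_measurable borel \<and> (\<forall>x. x \<notin> \<Omega> \<longrightarrow> G x = 0) \<and> (AE x in lborel. x \<in> \<Omega> \<longrightarrow> Du l x = G x) \<and> integrable lborel G) \<and>
      wgrad \<Omega> w G"
    using rep[OF W1p] by blast
  then obtain w G where
    w: "\<And>l. w l \<in> borel_measurable borel" "\<And>l x. x \<notin> \<Omega> \<Longrightarrow> w l x = 0"
      "\<And>l. AE x in lborel. x \<in> \<Omega> \<longrightarrow> u l x = w l x" "\<And>l. integrable lborel (w l)"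
    and G: "\<And>l. G l \<in> borel_measurable borel" "\<And>l x. x \<notin> \<Omega> \<Longrightarrow> G l x = 0"
      "\<And>l. AE x in lborel. x \<in> \<Omega> \<longrightarrow> Du l x = G l x" "\<And>l. integrable lborel (G l)"
    and wG: "\<And>l. wgrad \<Omega> (w l) (G l)"
    unfolding choice_iff by blast
  have "W1p \<Omega> 2 U DU" using conv by (simp add: W1q_weak_conv_def)
  from rep[OF this] obtain W H where
    W: "W \<in> borel_measurable borel" "\<And>x. x \<notin> \<Omega> \<Longrightarrow> W x = 0"
      "AE x in lborel. x \<in> \<Omega> \<longrightarrow> U x = W x" "integrable lborel W"
    and H: "H \<in> borel_measurable borel" "\<And>x. x \<notin> \<Omega> \<Longrightarrow> H x = 0"
      "AE x in lborel. x \<in> \<Omega> \<longrightarrow> DU x = H x" "integrable lborel H"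
    and WH: "wgrad \<Omega> W H" by blast
  define E where "E l = Ep \<Omega> (p l) (Du l)" for l
  have E: "E l > 0" "E \<longlonglongrightarrow> e" for l using e by (auto simp: E_def[abs_def])
  have Einv: "(\<lambda>l. 1 / E l) \<longlonglongrightarrow> 1 / e" using e(3) by (intro tendsto_divide E tendsto_const) auto
  have wW: "(\<lambda>l. conv \<eta> (w l) x) \<longlonglongrightarrow> conv \<eta> W x" if "kernel R \<eta>" for R \<eta> x
    by (rule conv_tendsto_of_weak[OF \<Omega>(1,2) _ _ w W that, of "2 / (2 - 1)"])
      (use conv in \<open>auto simp: W1q_weak_conv_def\<close>)
  have GH: "(\<lambda>l. conv \<eta> (G l) x) \<longlonglongrightarrow> conv \<eta> H x" if "kernel R \<eta>" for R \<eta> x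
    by (rule conv_tendsto_of_weak[OF \<Omega>(1,2) _ _ G H that, of "2 / (2 - 1)"])
      (use conv in \<open>auto simp: W1q_weak_conv_def\<close>)
  note en = normalised_energy[OF \<Omega>(1) V_def V p(1) E_def E(1) G(1-3)]
  have EL0: "(\<integral>x. norm (G l x) powr (p l - 2) * (G l x \<bullet> jac \<psi> x) \<partial>lborel) = 0" if "test_vec \<Omega> \<psi>" for l \<psi>
    by (rule euler_lagrange[OF \<Omega>(1,2) Vl p(1) min G(1-3) en(1) that])
  \<comment> \<open>The Euler-Lagrange expression is homogeneous of degree p - 1 in the field, so it
    also vanishes for the normalised one.\<close>
  have EL: "(\<integral>x. norm ((1 / E l) *\<^sub>R G l x) powr (p l - 2) * (((1 / E l) *\<^sub>R G l x) \<bullet> jac \<psi> x) \<partial>lborel) = 0"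
    if "test_vec \<Omega> \<psi>" for l \<psi>
  proof -
    have eq: "norm ((1 / E l) *\<^sub>R G l x) powr (p l - 2) * (((1 / E l) *\<^sub>R G l x) \<bullet> jac \<psi> x) =
        (1 / E l) powr (p l - 2) * (1 / E l) * (norm (G l x) powr (p l - 2) * (G l x \<bullet> jac \<psi> x))" for x
      using E(1)[of l] by (simp add: powr_divide)
    show ?thesis
      unfolding eq by (simp only: integral_mult_right_zero EL0[OF that] mult_zero_right)
  qed
  let ?T = "tuple_apply (mf_current \<mu> F)"
  have Tlim: "(\<lambda>l. E l / V * (\<integral>x. norm ((1 / E l) *\<^sub>R G l x) powr (p l - 2) * (((1 / E l) *\<^sub>R G l x) \<bullet> \<phi> x) \<partial>lborel)) \<longlonglongrightarrow> ?T \<phi>"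
    if \<phi>: "tuple_test_form \<phi>" for \<phi>
  proof -
    note c = tuple_apply_mf_current(1,2)[OF pair \<phi>]
    have "(\<integral>x. Du l x \<bullet> \<phi> x \<partial>mu_p \<Omega> (p l) (Du l)) =
        E l / V * (\<integral>x. norm ((1 / E l) *\<^sub>R G l x) powr (p l - 2) * (((1 / E l) *\<^sub>R G l x) \<bullet> \<phi> x) \<partial>lborel)" for l
      by (rule mu_p_current(1)[OF \<Omega>(1,2) V_def V p(1) E_def E(1) Dm G(1-3) borel_measurable_continuous_onI[OF c(2)]])
    with M[OF c(2)] c(1) show ?thesis by simp
  qed
  \<comment> \<open>The normalised functionals converge to V / e times T, and it is this multiple
    that gets calibrated.\<close>
  have Tlim': "(\<lambda>l. \<integral>x. norm ((1 / E l) *\<^sub>R G l x) powr (p l - 2) * (((1 / E l) *\<^sub>R G l x) \<bullet> \<phi> x) \<partial>lborel)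
      \<longlonglongrightarrow> V / e * ?T \<phi>" if \<phi>: "tuple_test_form \<phi>" for \<phi>
  proof -
    have lim: "(\<lambda>l. V * (1 / E l) * (E l / V * (\<integral>x. norm ((1 / E l) *\<^sub>R G l x) powr (p l - 2) * (((1 / E l) *\<^sub>R G l x) \<bullet> \<phi> x) \<partial>lborel)))
        \<longlonglongrightarrow> V * (1 / e) * ?T \<phi>"
      by (intro tendsto_mult tendsto_const Einv Tlim \<phi>)
    have cancel: "V * (1 / E l) * (E l / V * z) = z" for l z using V E(1)[of l] by simp
    show ?thesis using lim unfolding cancel by (simp only: times_divide_eq_right mult_1_right)
  qed
  show ?thesis
  proof (rule calibrated_mass_le[OF \<Omega>(1) K repS repT bdS])
    show "tuple_apply S \<omega> = ?T \<omega>"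
      if "tuple_test_form \<omega>" "\<And>k. supp (\<lambda>x. \<omega> x $ k) \<subseteq> \<Omega>" "\<And>x. x \<in> K \<Longrightarrow> \<omega> x = 0" for \<omega>
      using S_eq that by blast
    show "?T (jac \<Psi>) = 0" if \<Psi>: "test_vec \<Omega> \<Psi>" for \<Psi>
    proof -
      have "tuple_test_form (jac \<Psi>)"
        using tuple_test_form_scaleR_jac[OF smooth_const[of 1] \<Psi>] by simp
      from Tlim[OF this] have "(\<lambda>l. 0) \<longlonglongrightarrow> ?T (jac \<Psi>)" by (simp only: EL[OF \<Psi>] mult_zero_right)
      then show ?thesis by (simp add: LIMSEQ_const_iff)
    qed
    show "\<exists>\<Psi>. test_vec \<Omega> \<Psi> \<and> (\<forall>x\<in>supp \<zeta>. norm (jac \<Psi> x) \<le> 1) \<and>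
        (\<forall>\<phi>. tuple_test_form \<phi> \<and> (\<forall>x. norm (\<phi> x) \<le> \<zeta> x) \<longrightarrow> ?T \<phi> \<le> ?T (\<lambda>x. \<zeta> x *\<^sub>R jac \<Psi> x) + \<kappa>)"
      if \<zeta>: "test_fn \<Omega> \<zeta>" "\<And>x. 0 \<le> \<zeta> x" "\<And>x. \<zeta> x \<le> 1" and \<kappa>: "\<kappa> > 0" for \<zeta> \<kappa>
    proof -
      \<comment> \<open>The tolerance is rescaled together with T, so that cancelling V / e returns
        \<kappa>.\<close>
      have \<kappa>': "V / e * \<kappa> > 0" using V e(3) \<kappa> by simp
      have cw: "(\<lambda>l. conv \<eta> (\<lambda>x. (1 / E l) *\<^sub>R w l x) x) \<longlonglongrightarrow> conv \<eta> (\<lambda>x. (1 / e) *\<^sub>R W x) x"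
        if "kernel R \<eta>" for R \<eta> x
        unfolding conv_scaleR by (intro tendsto_scaleR Einv wW[OF that])
      have cG: "(\<lambda>l. conv \<eta> (\<lambda>x. (1 / E l) *\<^sub>R G l x) x) \<longlonglongrightarrow> conv \<eta> (\<lambda>x. (1 / e) *\<^sub>R H x) x"
        if "kernel R \<eta>" for R \<eta> x
        unfolding conv_scaleR by (intro tendsto_scaleR Einv GH[OF that])
      obtain \<Psi> where \<Psi>: "test_vec \<Omega> \<Psi>" "\<And>x. x \<in> supp \<zeta> \<Longrightarrow> norm (jac \<Psi> x) \<le> 1"
        "\<And>\<phi>. tuple_test_form \<phi> \<Longrightarrow> (\<And>x. norm (\<phi> x) \<le> \<zeta> x) \<Longrightarrow>
          V / e * ?T \<phi> \<le> V / e * ?T (\<lambda>x. \<zeta> x *\<^sub>R jac \<Psi> x) + V / e * \<kappa>"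
        by (rule calibration_exists[where T = "\<lambda>\<phi>. V / e * ?T \<phi>",
              OF \<Omega>(1,2) V_def wgrad_scaleR[OF wG] _ _ p en(2,3) EL wgrad_scaleR[OF WH] cw cG Tlim' \<zeta> \<kappa>'])
          (auto simp: w(2) G(2))
      have "?T \<phi> \<le> ?T (\<lambda>x. \<zeta> x *\<^sub>R jac \<Psi> x) + \<kappa>"
        if "tuple_test_form \<phi>" "\<And>x. norm (\<phi> x) \<le> \<zeta> x" for \<phi>
      proof -
        have "V / e * ?T \<phi> \<le> V / e * (?T (\<lambda>x. \<zeta> x *\<^sub>R jac \<Psi> x) + \<kappa>)"
          using \<Psi>(3)[OF that] by (simp only: distrib_left)
        moreover have "V / e > 0" using V e(3) by simp
        ultimately show ?thesis by (rule mult_left_le_imp_le)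
      qed
      with \<Psi>(1,2) show ?thesis by blast
    qed
  qed
qed

lemma eventually_energy_bounded:
  fixes Du :: "nat \<Rightarrow> real^'n::finite \<Rightarrow> real^'n^'m::finite"
  assumes \<Omega>: "open \<Omega>" "bounded \<Omega>" "\<Omega> \<noteq> {}"
    and p: "\<forall>\<^sub>F l in sequentially. p l > 2"
    and Dm: "\<forall>\<^sub>F l in sequentially. Du l \<in> borel_measurable lebesgue"
    and M: "mf_weak_conv (\<lambda>l. mu_p \<Omega> (p l) (Du l)) Du \<mu> F"
  obtains C where "\<forall>\<^sub>F l in sequentially. Ep \<Omega> (p l) (Du l) \<in> {0..C}"
proof -
  have V: "measure lborel \<Omega> > 0" by (rule measure_lborel_open_pos[OF \<Omega>])
  have \<Omega>m: "\<Omega> \<in> sets borel" using \<Omega> by simp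
  let ?f = "\<lambda>l. \<integral>x. 1 + (norm (Du l x))\<^sup>2 \<partial>mu_p \<Omega> (p l) (Du l)"
  have "limsup (\<lambda>l. ereal (?f l)) < \<infinity>" using M by (simp add: mf_weak_conv_def)
  then obtain B where "limsup (\<lambda>l. ereal (?f l)) < ereal B" using ereal_dense2 by blast
  then have ev: "\<forall>\<^sub>F l in sequentially. ereal (?f l) < ereal B" by (rule Limsup_lessD)
  \<comment> \<open>Being at least 1 and above B ensures B \<le> C^2, so that e^2 \<le> B implies e
    \<le> C.\<close>
  define C where "C = max 0 B + 1"
  have "\<forall>\<^sub>F l in sequentially. Ep \<Omega> (p l) (Du l) \<in> {0..C}"
    using ev p Dm
  proof eventually_elim
    case (elim l)
    let ?e = "Ep \<Omega> (p l) (Du l)"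
    have e0: "?e \<ge> 0" by (simp add: Ep_def)
    show ?case
    proof (cases "?e = 0")
      case False
      then have e: "?e > 0" using e0 by simp
      obtain G where G: "G \<in> borel_measurable borel" "\<And>x. x \<notin> \<Omega> \<Longrightarrow> G x = 0" "AE x in lborel. x \<in> \<Omega> \<longrightarrow> Du l x = G x"
        using ex_borel_rep[OF \<Omega>m measurable_restrict_space1[OF elim(3)]] by blast
      have "?e\<^sup>2 \<le> ?f l"
        by (rule energy_le_mu_p_integral[OF \<Omega>(1,2) refl V elim(2) refl e elim(3) G])
      also have "\<dots> \<le> B" using elim(1) by simp
      also have "B \<le> C\<^sup>2"
        unfolding C_def power2_eq_square by (cases "B \<ge> 0") (auto simp: max_def algebra_simps)
      finally have "?e \<le> C" by (rule power2_le_imp_le) (simp add: C_def)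
      with e0 show ?thesis by simp
    qed (simp add: C_def)
  qed
  then show ?thesis by (rule that)
qed

text \<open>Each approximating current is bounded on \<phi> by 2 B times its energy. Indices with
  energy 0 are harmless, since the measure itself vanishes there.\<close>

lemma mf_current_zero_of_energy_tendsto_zero:
  fixes Du :: "nat \<Rightarrow> real^'n::finite \<Rightarrow> real^'n^'m::finite"
  assumes \<Omega>: "open \<Omega>" "bounded \<Omega>" "\<Omega> \<noteq> {}"
    and p: "\<And>l. p l > 2" and Dm: "\<And>l. Du l \<in> borel_measurable lebesgue"
    and e: "(\<lambda>l. Ep \<Omega> (p l) (Du l)) \<longlonglongrightarrow> 0"
    and pair: "mf_pair \<Omega> \<mu> F"
    and M: "\<And>\<phi>. continuous_on UNIV \<phi> \<Longrightarrow>
      (\<lambda>l. \<integral>x. Du l x \<bullet> \<phi> x \<partial>mu_p \<Omega> (p l) (Du l)) \<longlonglongrightarrow> (\<integral>x. F x \<bullet> \<phi> x \<partial>\<mu>)"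
    and \<phi>: "tuple_test_form \<phi>"
  shows "tuple_apply (mf_current \<mu> F) \<phi> = 0"
proof -
  have V: "measure lborel \<Omega> > 0" by (rule measure_lborel_open_pos[OF \<Omega>])
  have \<Omega>m: "\<Omega> \<in> sets borel" using \<Omega> by simp
  note c = tuple_apply_mf_current[OF pair \<phi>]
  obtain B where B: "\<And>x. norm (\<phi> x) \<le> B" using c(3) by blast
  have B0: "B \<ge> 0" using B[of 0] norm_ge_zero order_trans by blast
  have \<phi>m: "\<phi> \<in> borel_measurable borel" by (rule borel_measurable_continuous_onI[OF c(2)])
  let ?a = "\<lambda>l. \<integral>x. Du l x \<bullet> \<phi> x \<partial>mu_p \<Omega> (p l) (Du l)"
  have bound: "\<bar>?a l\<bar> \<le> 2 * B * Ep \<Omega> (p l) (Du l)" for l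
  proof (cases "Ep \<Omega> (p l) (Du l) = 0")
    case True
    then show ?thesis using mu_p_integral_zero[OF p True, of "\<lambda>x. Du l x \<bullet> \<phi> x"] by simp
  next
    case False
    moreover have "Ep \<Omega> (p l) (Du l) \<ge> 0" by (simp add: Ep_def)
    ultimately have e: "Ep \<Omega> (p l) (Du l) > 0" by simp
    obtain G where G: "G \<in> borel_measurable borel" "\<And>x. x \<notin> \<Omega> \<Longrightarrow> G x = 0" "AE x in lborel. x \<in> \<Omega> \<longrightarrow> Du l x = G x"
      using ex_borel_rep[OF \<Omega>m measurable_restrict_space1[OF Dm]] by blast
    show ?thesis by (rule mu_p_current(2)[OF \<Omega>(1,2) refl V p refl e Dm G \<phi>m B])
  qed
  have "?a \<longlonglongrightarrow> 0"
  proof (rule Lim_null_comparison)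
    show "\<forall>\<^sub>F l in sequentially. norm (?a l) \<le> 2 * B * Ep \<Omega> (p l) (Du l)"
      by (rule always_eventually) (simp only: real_norm_def bound simp_thms)
    show "(\<lambda>l. 2 * B * Ep \<Omega> (p l) (Du l)) \<longlonglongrightarrow> 0"
      using tendsto_mult[OF tendsto_const[of "2 * B"] e] by simp
  qed
  with M[OF c(2)] show ?thesis unfolding c(1) by (rule LIMSEQ_unique)
qed

theorem mainTheorem12:
  fixes \<Omega> :: "(real^'n::finite) set"
    and u0 :: "real^'n \<Rightarrow> real^'m::finite"
    and p :: "nat \<Rightarrow> real"
    and u :: "nat \<Rightarrow> real^'n \<Rightarrow> real^'m"
    and Du :: "nat \<Rightarrow> real^'n \<Rightarrow> real^'n^'m"
    and u_inf :: "real^'n \<Rightarrow> real^'m"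
    and Du_inf :: "real^'n \<Rightarrow> real^'n^'m"
    and \<mu>_inf :: "(real^'n) measure"
    and F_inf :: "real^'n \<Rightarrow> real^'n^'m"
    and S :: "'m \<Rightarrow> (real^'n \<Rightarrow> real^'n) \<Rightarrow> real"
    and K :: "(real^'n) set"
  assumes dom: "smooth_bounded_domain \<Omega>"
    and lip: "\<exists>L. L-lipschitz_on UNIV u0"
    and einf_pos: "e_inf \<Omega> u0 > 0"
    and p_ge: "\<forall>l. 2 \<le> p l"
    and p_lim: "filterlim p at_top sequentially"
    and u_min: "\<forall>l. Ep_minimiser \<Omega> (p l) u0 (u l) (Du l)"
    and u_conv: "\<forall>q>1. W1q_weak_conv \<Omega> q u Du u_inf Du_inf"
    and pair: "mf_pair \<Omega> \<mu>_inf F_inf"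
    and M_conv: "mf_weak_conv (\<lambda>l. mu_p \<Omega> (p l) (Du l)) Du \<mu>_inf F_inf"
    and S_cur: "\<forall>k. current1 (S k)"
    and S_mass: "loc_finite_joint_mass S"
    and S_bd: "supp_bd S \<inter> \<Omega> = {}"
    and K_cpt: "compact K" and K_sub: "K \<subseteq> \<Omega>"
    and S_eq: "\<forall>\<omega>. tuple_test_form \<omega> \<and> (\<forall>k. supp (\<lambda>x. \<omega> x $ k) \<subseteq> \<Omega>) \<and> (\<forall>x\<in>K. \<omega> x = 0)
                 \<longrightarrow> tuple_apply S \<omega> = tuple_apply (mf_current \<mu>_inf F_inf) \<omega>"
  shows "\<forall>\<nu>S VS \<nu>T VT. mass_rep S \<nu>S VS \<and> mass_rep (mf_current \<mu>_inf F_inf) \<nu>T VT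
           \<longrightarrow> emeasure \<nu>T K \<le> emeasure \<nu>S K"
proof (intro allI impI)
  fix \<nu>S VS \<nu>T VT
  assume "mass_rep S \<nu>S VS \<and> mass_rep (mf_current \<mu>_inf F_inf) \<nu>T VT"
  then have repS: "mass_rep S \<nu>S VS" and repT: "mass_rep (mf_current \<mu>_inf F_inf) \<nu>T VT" by auto
  have \<Omega>: "open \<Omega>" "bounded \<Omega>" "\<Omega> \<noteq> {}" using dom by (auto simp: smooth_bounded_domain_def)
  have zero_case: "emeasure \<nu>T K \<le> emeasure \<nu>S K"
    if "\<And>\<phi>. tuple_test_form \<phi> \<Longrightarrow> tuple_apply (mf_current \<mu>_inf F_inf) \<phi> = 0"
    using mass_eq_0_of_zero[OF K_cpt repT that] by simp
  \<comment> \<open>Choosing 0 as the scalar test function isolates the current part of the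
    convergence.\<close>
  have M: "(\<lambda>l. \<integral>x. Du l x \<bullet> \<phi> x \<partial>mu_p \<Omega> (p l) (Du l)) \<longlonglongrightarrow> (\<integral>x. F_inf x \<bullet> \<phi> x \<partial>\<mu>_inf)"
    if "continuous_on UNIV \<phi>" for \<phi>
    using M_conv that unfolding mf_weak_conv_def by (elim conjE allE[of _ "\<lambda>_. 0"] allE[of _ \<phi>]) auto
  show "emeasure \<nu>T K \<le> emeasure \<nu>S K"
  \<comment> \<open>Outside \<Omega> the fields \<open>Du l\<close> are arbitrary. If they are
    nonmeasurable infinitely often, the limit measure is 0 and so is T.\<close>
  proof (cases "\<forall>\<^sub>F l in sequentially. Du l \<in> borel_measurable lebesgue")
    case False
    then have "\<exists>\<^sub>F l in sequentially. Du l \<notin> borel_measurable lebesgue" by (simp add: frequently_def)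
    then have z: "emeasure \<mu>_inf (space \<mu>_inf) = 0"
      by (rule limit_measure_zero_of_nonmeasurable[OF pair M_conv])
    have ae: "AE x in \<mu>_inf. P x" for P
      by (rule AE_I[of _ _ "space \<mu>_inf"]) (use z in auto)
    show ?thesis
    proof (rule zero_case)
      fix \<phi> :: "real^'n \<Rightarrow> real^'n^'m" assume "tuple_test_form \<phi>"
      then show "tuple_apply (mf_current \<mu>_inf F_inf) \<phi> = 0"
        using tuple_apply_mf_current(1)[OF pair] integral_eq_zero_AE[OF ae] by simp
    qed
  next
    case Dm: True
    \<comment> \<open>Strict inequality, obtained for large l from the divergence of the exponents,
      keeps p - 2 a positive power.\<close>
    have p2: "\<forall>\<^sub>F l in sequentially. p l > 2"
      using p_lim by (simp add: filterlim_at_top_dense)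
    have conv2: "W1q_weak_conv \<Omega> 2 u Du u_inf Du_inf" using u_conv by simp
    then have W: "\<forall>\<^sub>F l in sequentially. W1p \<Omega> 2 (u l) (Du l)" by (simp add: W1q_weak_conv_def)
    define E where "E l = Ep \<Omega> (p l) (Du l)" for l
    obtain C where C: "\<forall>\<^sub>F l in sequentially. E l \<in> {0..C}"
      using eventually_energy_bounded[OF \<Omega> p2 Dm M_conv] by (auto simp: E_def)
    \<comment> \<open>From this index on all eventual properties hold together. The subsequence is
      extracted from the sequence shifted by N, so that they hold for each of its members.\<close>
    obtain N where N: "\<And>l. l \<ge> N \<Longrightarrow> p l > 2" "\<And>l. l \<ge> N \<Longrightarrow> W1p \<Omega> 2 (u l) (Du l)"
      "\<And>l. l \<ge> N \<Longrightarrow> Du l \<in> borel_measurable lebesgue" "\<And>l. l \<ge> N \<Longrightarrow> E l \<in> {0..C}"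
      using eventually_conj[OF p2 eventually_conj[OF W eventually_conj[OF Dm C]]]
      unfolding eventually_sequentially by blast
    have "seq_compact {0..C}" by (intro compact_imp_seq_compact compact_Icc)
    then obtain e r where r: "e \<in> {0..C}" "strict_mono r" "((\<lambda>i. E (i + N)) \<circ> r) \<longlonglongrightarrow> e"
      using N(4) unfolding seq_compact_def by (metis le_add2)
    define s where "s i = r i + N" for i
    have s: "strict_mono s" "s i \<ge> N" for i using r(2) by (auto simp: s_def strict_mono_def)
    have Es: "(\<lambda>i. E (s i)) \<longlonglongrightarrow> e" using r(3) by (simp add: s_def o_def)
    show ?thesis
    proof (cases "e = 0")
      case True
      show ?thesis
      proof (rule zero_case, rule mf_current_zero_of_energy_tendsto_zero[OF \<Omega> _ _ _ pair])
        show "p (s l) > 2" "Du (s l) \<in> borel_measurable lebesgue" for l using N s by auto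
        show "(\<lambda>l. Ep \<Omega> (p (s l)) (Du (s l))) \<longlonglongrightarrow> 0" using Es True by (simp add: E_def)
        show "(\<lambda>l. \<integral>x. Du (s l) x \<bullet> \<phi> x \<partial>mu_p \<Omega> (p (s l)) (Du (s l))) \<longlonglongrightarrow> (\<integral>x. F_inf x \<bullet> \<phi> x \<partial>\<mu>_inf)"
          if "continuous_on UNIV \<phi>" for \<phi>
          using LIMSEQ_subseq_LIMSEQ[OF M[OF that] s(1)] by (simp add: o_def)
      qed
    next
      case False
      then have e: "e > 0" using r(1) by simp
      \<comment> \<open>A positive limit makes the energies positive from some index on; a second
        shift makes this hold throughout.\<close>
      obtain N' where N': "\<And>i. i \<ge> N' \<Longrightarrow> E (s i) > 0"
        using order_tendstoD(1)[OF Es e] unfolding eventually_sequentially by blast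
      define t where "t i = s (i + N')" for i
      have t: "strict_mono t" "t i \<ge> N" "E (t i) > 0" for i
        using s N' by (auto simp: t_def strict_mono_def)
      have Et: "(\<lambda>i. E (t i)) \<longlonglongrightarrow> e" unfolding t_def using LIMSEQ_ignore_initial_segment[OF Es] .
      show ?thesis
      proof (rule current_mass_le[OF \<Omega> _ _ _ _ _ _ _ _ e pair _ S_bd K_cpt K_sub S_eq repS repT])
        show "Ep_minimiser \<Omega> (p (t l)) u0 (u (t l)) (Du (t l))" for l using u_min by blast
        have sub: "(\<lambda>l. f (t l)) \<longlonglongrightarrow> a" if "f \<longlonglongrightarrow> a" for f and a :: real
          using LIMSEQ_subseq_LIMSEQ[OF that t(1)] by (simp add: o_def)
        show "W1q_weak_conv \<Omega> 2 (\<lambda>l. u (t l)) (\<lambda>l. Du (t l)) u_inf Du_inf"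
          using conv2 N(2) t(2) unfolding W1q_weak_conv_def by (auto intro: sub)
        show "W1p \<Omega> 2 (u (t l)) (Du (t l))" "p (t l) > 2" "Du (t l) \<in> borel_measurable lebesgue"
          "Ep \<Omega> (p (t l)) (Du (t l)) > 0" for l
          using N t by (auto simp: E_def)
        show "filterlim (\<lambda>l. p (t l)) at_top sequentially"
          by (rule filterlim_compose[OF p_lim filterlim_subseq[OF t(1)]])
        show "(\<lambda>l. Ep \<Omega> (p (t l)) (Du (t l))) \<longlonglongrightarrow> e" using Et by (simp add: E_def)
        show "(\<lambda>l. \<integral>x. Du (t l) x \<bullet> \<phi> x \<partial>mu_p \<Omega> (p (t l)) (Du (t l))) \<longlonglongrightarrow> (\<integral>x. F_inf x \<bullet> \<phi> x \<partial>\<mu>_inf)"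
          if "continuous_on UNIV \<phi>" for \<phi>
          by (rule sub[OF M[OF that]])
      qed
    qed
  qed
qed

end
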